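(* Let $\alpha>0$. Assume that $X:(0,1/\tau_0]\to\mathbb{R}$, $\tau_0>0$, $X(\tau)=P(\tau)\sin (1/\tau)$, where $P(\tau)$ is a positive function such that $P(\tau)\sim_3\tau^\alpha$ as $\tau\to 0$. Define $x(t):=X(1/t)$ for $t\in[\tau_0,\infty)$, and a continuous function $\varphi(t)$ by $\tan\varphi(t)=\frac{\dot x(t)}{x(t)}$. (i) If $\alpha\in(0,1)$, then the planar curve $\Gamma:=\{(x(t),\dot x(t))\in\mathbb{R}^2: t\in[\tau_0,\infty)\}$ generated by $X$ is a wavy spiral $r=f(\varphi)$, $\varphi\in(-\infty,-\phi_0]$ (for some $\phi_0>0$), near the origin. We have $f(\varphi)\simeq|\varphi|^{-\alpha}$ as $\varphi\to-\infty$, and $$\dim_{ph}(x):=\dim_B\Gamma=\frac{2}{1+\alpha}.$$ (ii) If $\alpha>1$, then the planar curve $\Gamma:=\{(x(t),\dot x(t))\in\mathbb{R}^2: t\in[\tau_0,\infty)\}$ is a rectifiable wavy spiral near the origin.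
   Context: Asymptotic notation. For functions $f,g$ of class $C^k$ ($k$ a positive integer), $f(t)\sim_k g(t)$ as $t\to0$ means $f^{(j)}(t)/g^{(j)}(t)\to1$ as $t\to 0$ for all $j=0,1,\dots,k$. $f\simeq g$ (as the variable tends to a limit) means that there are positive constants $C,D$ with $C f\le g\le D f$ for all values of the variable sufficiently close to the limit. Box dimension. For bounded $A\subset\mathbb{R}^N$ let $A_\varepsilon=\{y\in\mathbb{R}^N: d(y,A)<\varepsilon\}$ and, for $s\ge0$, let $\mathcal{M}_*^s(A)=\liminf_{\varepsilon\to0}|A_\varepsilon|/\varepsilon^{N-s}$ and $\mathcal{M}^{*s}(A)=\limsup_{\varepsilon\to0}|A_\varepsilon|/\varepsilon^{N-s}$. Then $\underline{\dim}_BA=\inf\{s\ge0:\mathcal{M}_*^s(A)=0\}$, $\overline{\dim}_BA=\inf\{s\ge0:\mathcal{M}^{*s}(A)=0\}$, and $\dim_BA$ is the common value if they coincide. The phase dimension $\dim_{ph}(x)$ of a $C^1$ function $x:[\tau_0,\infty)\to\mathbb{R}$ is the box dimension of $\{(x(t),\dot x(t)):t\in[\tau_0,\infty)\}$. A curve is rectifiable if it has finite length. Spirals. A spiral is the graph of a function $r=f(\varphi)$, $\varphi\ge\varphi_1>0$, in polar coordinates, where $f:[\varphi_1,\infty)\to(0,\infty)$ satisfies $f(\varphi)\to0$ as $\varphi\to\infty$ and $f$ is radially decreasing, i.e. for any fixed $\varphi\ge\varphi_1$ the function $\mathbb{N}\ni k\mapsto f(\varphi+2k\pi)$ is decreasing.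 The graph of $r=g(\varphi)$, $\varphi\le\varphi_1'<0$, in polar coordinates is also called a spiral if the function $h(\varphi):=g(-\varphi)$, $\varphi\ge|\varphi_1'|$, takes values in $(0,\infty)$, satisfies $h(\varphi)\to0$ as $\varphi\to\infty$, and is radially decreasing, i.e. for any fixed $\varphi\ge|\varphi_1'|$ the function $\mathbb{N}\ni k\mapsto h(\varphi+2k\pi)$ is decreasing. The graph of $r=f(\varphi)$, $\varphi\ge\varphi_1>0$, is a spiral near the origin if there is $\varphi_2\ge\varphi_1$ such that the graph of $r=f(\varphi)$, $\varphi\ge\varphi_2$, is a spiral (and analogously for angles tending to $-\infty$). Wavy functions. Let $r:[t_0,\infty)\to(0,\infty)$ be a $C^1$ function with $r'(t_0)\le0$. It is a wavy function if the sequence $(t_n)$ defined inductively, for $k\in\mathbb{N}_0$, by $t_{2k+1}:=\inf\{t:t>t_{2k},\ r'(t)>0\}$ and $t_{2k+2}:=\inf\{t: t>t_{2k+1},\ r(t)=r(t_{2k+1})\}$ is well defined and satisfies: (i) $(t_n)$ is increasing and $t_n\to\infty$; (ii) there is $\varepsilon>0$ such that $t_{2k+1}-t_{2k}\ge\varepsilon$ for all $k\in\mathbb{N}_0$; (iii) for some exponent $a\in(0,1)$, $\operatorname{osc}_{t\in[t_{2k+1},t_{2k+2}]}r(t)=o(t_{2k+1}^{-a-1})$ as $k\to\infty$, where $\operatorname{osc}_{I}r=\max_I r-\min_I r$. Wavy spirals. A spiral given in polar coordinates by $r=f(\varphi)$ is a wavy spiral if there is an increasing or decreasing $C^1$ function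 $\varphi=\varphi(t)$ such that $r(t)=f(\varphi(t))$ is a wavy function. A curve is a wavy spiral near the origin if it becomes a wavy spiral after restricting to $|\varphi|$ sufficiently large (equivalently to $t$ sufficiently large). *)

theory Defs
  imports "HOL-Analysis.Analysis" "HOL-Library.Landau_Symbols"
begin

subsection \<open>Smoothness and asymptotic comparison\<close>

(* D j is the j-th derivative; at an end point of an interval S it is one-sided. *)
definition Ck_on :: "nat \<Rightarrow> (real \<Rightarrow> real) \<Rightarrow> real set \<Rightarrow> bool" where
  "Ck_on k f S \<longleftrightarrow>
    (\<exists>D. (\<forall>t\<in>S. D 0 t = f t) \<and>
         (\<forall>j<k. \<forall>t\<in>S. (D j has_real_derivative D (Suc j) t) (at t within S)) \<and>
         continuous_on S (D k))"

(* The library relation \<sim>[F] says that the quotient tends to 1, reading 0/0 as 1. The 0/0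
   case matters only if a derivative of g vanishes, e.g. the third derivative of t^2. *)
definition asymp_equiv_Ck :: "nat \<Rightarrow> (real \<Rightarrow> real) \<Rightarrow> (real \<Rightarrow> real) \<Rightarrow> real filter \<Rightarrow> bool" where
  "asymp_equiv_Ck k f g F \<longleftrightarrow>
    (\<forall>j\<le>k. (deriv ^^ j) f \<sim>[F] (deriv ^^ j) g)"

definition asymp_comparable :: "(real \<Rightarrow> real) \<Rightarrow> (real \<Rightarrow> real) \<Rightarrow> real filter \<Rightarrow> bool" where
  "asymp_comparable f g F \<longleftrightarrow>
    (\<exists>C>0. \<exists>D>0. \<forall>\<^sub>F t in F. C * f t \<le> g t \<and> g t \<le> D * f t)"

subsection \<open>Box dimension\<close>

(* The conjunct on A only excludes the library convention infdist y {} = 0. *)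
definition nbhd_of :: "'a::euclidean_space set \<Rightarrow> real \<Rightarrow> 'a set" where
  "nbhd_of A \<epsilon> = {y. A \<noteq> {} \<and> infdist y A < \<epsilon>}"

definition lower_content :: "real \<Rightarrow> 'a::euclidean_space set \<Rightarrow> ennreal" where
  "lower_content s A =
    Liminf (at_right 0) (\<lambda>\<epsilon>. emeasure lborel (nbhd_of A \<epsilon>) / ennreal (\<epsilon> powr (real DIM('a) - s)))"

definition upper_content :: "real \<Rightarrow> 'a::euclidean_space set \<Rightarrow> ennreal" where
  "upper_content s A =
    Limsup (at_right 0) (\<lambda>\<epsilon>. emeasure lborel (nbhd_of A \<epsilon>) / ennreal (\<epsilon> powr (real DIM('a) - s)))"

(* For bounded A both contents vanish at every s > DIM('a), so the infima below are
   taken over nonempty sets of reals that are bounded below. *)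
definition lower_box_dim :: "'a::euclidean_space set \<Rightarrow> real" where
  "lower_box_dim A = Inf {s. 0 \<le> s \<and> lower_content s A = 0}"

definition upper_box_dim :: "'a::euclidean_space set \<Rightarrow> real" where
  "upper_box_dim A = Inf {s. 0 \<le> s \<and> upper_content s A = 0}"

definition has_box_dim :: "'a::euclidean_space set \<Rightarrow> real \<Rightarrow> bool" where
  "has_box_dim A d \<longleftrightarrow> bounded A \<and> lower_box_dim A = d \<and> upper_box_dim A = d"

subsection \<open>Curves\<close>

definition curve_length :: "(real \<Rightarrow> 'a::metric_space) \<Rightarrow> real set \<Rightarrow> ennreal" where
  "curve_length c S =
    Sup {\<Sum>i<n. ennreal (dist (c (t i)) (c (t (Suc i)))) | (n::nat) t.
           (\<forall>i\<le>n. t i \<in> S) \<and> (\<forall>i<n. t i \<le> t (Suc i))}"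

definition rectifiable :: "(real \<Rightarrow> 'a::metric_space) \<Rightarrow> real set \<Rightarrow> bool" where
  "rectifiable c S \<longleftrightarrow> curve_length c S < \<infinity>"

(* The derivative is taken within the time interval, hence one-sided at t0. *)
definition phase_traj :: "real \<Rightarrow> (real \<Rightarrow> real) \<Rightarrow> real \<Rightarrow> real \<times> real" where
  "phase_traj t0 x t = (x t, vector_derivative x (at t within {t0..}))"

(* The equation tan \<phi> = y / x determines \<phi> only up to a constant multiple of \<pi>.
   It is imposed where the quotient is defined; cos \<phi> \<noteq> 0 rules out the library
   convention that tan is 0 at its poles. *)
definition phase_angle :: "real \<Rightarrow> (real \<Rightarrow> real \<times> real) \<Rightarrow> (real \<Rightarrow> real) \<Rightarrow> bool" where
  "phase_angle t0 c \<phi> \<longleftrightarrow>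
    continuous_on {t0..} \<phi> \<and>
    (\<forall>t\<ge>t0. fst (c t) \<noteq> 0 \<longrightarrow> cos (\<phi> t) \<noteq> 0 \<and> tan (\<phi> t) = snd (c t) / fst (c t))"

definition polar_point :: "real \<Rightarrow> real \<Rightarrow> real \<times> real" where
  "polar_point r \<phi> = (r * cos \<phi>, r * sin \<phi>)"

definition polar_graph :: "(real \<Rightarrow> real) \<Rightarrow> real set \<Rightarrow> (real \<times> real) set" where
  "polar_graph f I = (\<lambda>\<phi>. polar_point (f \<phi>) \<phi>) ` I"

subsection \<open>Spirals and wavy spirals\<close>

definition pos_spiral :: "(real \<Rightarrow> real) \<Rightarrow> real \<Rightarrow> bool" where
  "pos_spiral f \<phi>\<^sub>1 \<longleftrightarrow>
    \<phi>\<^sub>1 > 0 \<and> (\<forall>\<phi>\<ge>\<phi>\<^sub>1. f \<phi> > 0) \<and> (f \<longlongrightarrow> 0) at_top \<and>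
    (\<forall>\<phi>\<ge>\<phi>\<^sub>1. \<forall>k::nat. f (\<phi> + 2 * real (Suc k) * pi) < f (\<phi> + 2 * real k * pi))"

definition spiral :: "(real \<Rightarrow> real) \<Rightarrow> real set \<Rightarrow> bool" where
  "spiral f I \<longleftrightarrow>
    (\<exists>\<phi>\<^sub>1. I = {\<phi>\<^sub>1..} \<and> pos_spiral f \<phi>\<^sub>1) \<or>
    (\<exists>\<phi>\<^sub>1. I = {..\<phi>\<^sub>1} \<and> pos_spiral (\<lambda>\<phi>. f (- \<phi>)) (- \<phi>\<^sub>1))"

(* For a continuous function on a compact interval this is max - min. *)
definition osc :: "(real \<Rightarrow> real) \<Rightarrow> real set \<Rightarrow> real" where
  "osc r I = (SUP t\<in>I. r t) - (INF t\<in>I. r t)"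

(* The sets whose infima define T must be nonempty for T to be well defined; they are
   bounded below by construction. T is determined uniquely by r and t0. *)
definition wavy_times :: "(real \<Rightarrow> real) \<Rightarrow> real \<Rightarrow> (nat \<Rightarrow> real) \<Rightarrow> bool" where
  "wavy_times r t0 T \<longleftrightarrow>
    T 0 = t0 \<and>
    (\<forall>k. (let S = {t. t > T (2 * k) \<and> vector_derivative r (at t within {t0..}) > 0}
          in S \<noteq> {} \<and> T (2 * k + 1) = Inf S) \<and>
         (let S = {t. t > T (2 * k + 1) \<and> r t = r (T (2 * k + 1))}
          in S \<noteq> {} \<and> T (2 * k + 2) = Inf S))"

definition wavy_function :: "(real \<Rightarrow> real) \<Rightarrow> real \<Rightarrow> bool" where
  "wavy_function r t0 \<longleftrightarrow>
    (\<forall>t\<ge>t0. r t > 0) \<and> Ck_on 1 r {t0..} \<and>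
    vector_derivative r (at t0 within {t0..}) \<le> 0 \<and>
    (\<exists>T. wavy_times r t0 T \<and>
      strict_mono T \<and> filterlim T at_top sequentially \<and>
      (\<exists>\<epsilon>>0. \<forall>k. T (2 * k + 1) - T (2 * k) \<ge> \<epsilon>) \<and>
      (\<exists>a. 0 < a \<and> a < 1 \<and>
        (\<lambda>k. osc r {T (2 * k + 1)..T (2 * k + 2)}) \<in> o(\<lambda>k. T (2 * k + 1) powr (- a - 1))))"

definition wavy_spiral :: "(real \<Rightarrow> real) \<Rightarrow> real set \<Rightarrow> bool" where
  "wavy_spiral f I \<longleftrightarrow>
    spiral f I \<and>
    (\<exists>t0 \<phi>. Ck_on 1 \<phi> {t0..} \<and> \<phi> ` {t0..} = I \<and>
      (strict_mono_on {t0..} \<phi> \<or> strict_antimono_on {t0..} \<phi>) \<and>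
      wavy_function (\<lambda>t. f (\<phi> t)) t0)"

(* The tail of the curve c, defined on {t0..}, is the wavy spiral r = f(\<phi>), \<phi> \<in> I. *)
definition wavy_spiral_near_origin ::
    "(real \<Rightarrow> real \<times> real) \<Rightarrow> real \<Rightarrow> (real \<Rightarrow> real) \<Rightarrow> real set \<Rightarrow> bool" where
  "wavy_spiral_near_origin c t0 f I \<longleftrightarrow>
    wavy_spiral f I \<and> (\<exists>t1\<ge>t0. c ` {t1..} = polar_graph f I)"

end

theory Submission
  imports Defs
begin

text \<open>The curve is \<open>(x, x')\<close> with \<open>x(t) = p(t) sin t\<close> and
\<open>p(t) = P(1/t)\<close>, and the hypothesis on \<open>P\<close> says that \<open>p\<close>
behaves like \<open>t^(-\<alpha>)\<close> up to the third derivative (lemma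
\<open>damped_oscillation_if_Ck_asymp\<close>). To leading order the curve is \<open>p(t) (sin t,
cos t)\<close>: it turns clockwise with angular velocity tending to \<open>-1\<close>, so that
time and \<open>-\<phi>\<close> are comparable, and its radius is of order
\<open>t^(-\<alpha>)\<close>. This gives the spiral and \<open>f(\<phi>) \<simeq>
|\<phi>|^(-\<alpha>)\<close>. That \<open>f\<close> decreases from turn to turn follows
from the logarithmic derivative of the radius, which is \<open>-2 \<alpha> cos\<^sup>2 t /
t\<close> up to \<open>o(1/t)\<close>: over a full turn its mean is negative
(\<open>radius_falls\<close>).

The radius is not monotone, because that leading term vanishes where the cosine does. Exactly,
\<open>r r' = x' (x + x'') = 2 p p' w1 w2\<close> with \<open>w1 = cos t + q sin t\<close> and
\<open>w2 = cos t + h sin t\<close>, where \<open>q = p'/p\<close> is about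
\<open>-\<alpha>/t\<close> and \<open>h = p''/(2 p')\<close> is about \<open>-(\<alpha> +
1)/(2t)\<close>. In each half turn each factor has one zero near the zero of the cosine, and for
\<open>\<alpha> \<noteq> 1\<close> the two zeros differ; since \<open>p' < 0\<close>, the radius
grows between them and falls elsewhere (\<open>radius_increases_once_per_half_turn\<close>).
Uniqueness of the zeros uses \<open>h'\<close>, and hence the third derivative. The net fall over
the rest of the half turn brings the radius back below its value before the rise, and the
oscillation over a rise is small because \<open>r'\<close> is
\<open>O(t^(-\<alpha>-1))\<close>; these are the requirements on a wavy
function (locale \<open>wavy_pattern\<close>).

The speed of the curve is \<open>O(t^(-\<alpha>))\<close>, hence the length is finite
for \<open>\<alpha> > 1\<close>. For \<open>\<alpha> < 1\<close> consecutive turns at time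
\<open>t\<close> are at a distance of order
\<open>t^(-\<alpha>-1)\<close>. Up to time
\<open>\<epsilon>^(-1/(1+\<alpha>))\<close>
the curve has length of order
\<open>\<epsilon>^(-(1-\<alpha>)/(1+\<alpha>))\<close>;
afterwards it fills, up to distance \<open>\<epsilon>\<close>, a disc of radius of order
\<open>\<epsilon>^(\<alpha>/(1+\<alpha>))\<close>.
Both parts of the \<open>\<epsilon>\<close>-neighbourhood have area at most of order
\<open>\<epsilon>^(2-d)\<close> with \<open>d = 2/(1 + \<alpha>)\<close>, and
the disc has at least that order (\<open>area_upper_bound\<close>,
\<open>area_lower_bound\<close>).\<close>

section \<open>Calculus on half-lines\<close>

lemma at_within_Ici_interior: "a < t \<Longrightarrow> at t within {a..} = at (t::real)"
  by (rule at_within_interior) auto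

lemma nondecreasing_on_Ici:
  fixes f :: "real \<Rightarrow> real"
  assumes der: "\<And>u. a \<le> u \<Longrightarrow> (f has_real_derivative f' u) (at u within {a..})"
    and "a \<le> s" "s \<le> t" and nonneg: "\<And>u. s < u \<Longrightarrow> u < t \<Longrightarrow> 0 \<le> f' u"
  shows "f s \<le> f t"
proof (rule DERIV_nonneg_imp_increasing_open[of s t f])
  show "s \<le> t" by fact
  show "\<exists>D. (f has_real_derivative D) (at u) \<and> 0 \<le> D" if "s < u" "u < t" for u
    using der[of u] nonneg[OF that] that \<open>a \<le> s\<close>
    by (auto simp: at_within_Ici_interior intro!: exI[of _ "f' u"])
  show "continuous_on {s..t} f"
    using \<open>a \<le> s\<close> has_field_derivative_subset[OF der, of _ "{s..t}"]
    by (intro DERIV_continuous_on[of _ _ f']) auto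
qed

lemma strictly_increasing_on_Ici:
  fixes f :: "real \<Rightarrow> real"
  assumes der: "\<And>u. a \<le> u \<Longrightarrow> (f has_real_derivative f' u) (at u within {a..})"
    and "a \<le> s" "s < t" and pos: "\<And>u. s < u \<Longrightarrow> u < t \<Longrightarrow> 0 < f' u"
  shows "f s < f t"
proof (rule DERIV_pos_imp_increasing_open[of s t f])
  show "s < t" by fact
  show "\<exists>D. (f has_real_derivative D) (at u) \<and> 0 < D" if "s < u" "u < t" for u
    using der[of u] pos[OF that] that \<open>a \<le> s\<close>
    by (auto simp: at_within_Ici_interior intro!: exI[of _ "f' u"])
  show "continuous_on {s..t} f"
    using \<open>a \<le> s\<close> has_field_derivative_subset[OF der, of _ "{s..t}"]
    by (intro DERIV_continuous_on[of _ _ f']) auto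
qed

text \<open>The mean value inequality in the form in which all size estimates below use it: the
majorant is integrated in closed form instead of estimating an integral.\<close>

lemma increment_bounded_by_majorant:
  fixes f g :: "real \<Rightarrow> real"
  assumes "\<And>u. a \<le> u \<Longrightarrow> (f has_real_derivative f' u) (at u within {a..})"
    and "\<And>u. a \<le> u \<Longrightarrow> (g has_real_derivative g' u) (at u within {a..})"
    and "a \<le> s" "s \<le> t" and bound: "\<And>u. s < u \<Longrightarrow> u < t \<Longrightarrow> \<bar>f' u\<bar> \<le> g' u"
  shows "\<bar>f t - f s\<bar> \<le> g t - g s"
proof -
  have "g s - f s \<le> g t - f t"
    using assms(3,4)
    by (rule nondecreasing_on_Ici[where f' = "\<lambda>u. g' u - f' u", rotated])
       (use bound in \<open>auto intro!: derivative_eq_intros assms(1,2) simp: abs_le_iff\<close>)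
  moreover have "g s + f s \<le> g t + f t"
    using assms(3,4)
    by (rule nondecreasing_on_Ici[where f' = "\<lambda>u. g' u + f' u", rotated])
       (use bound in \<open>force intro!: derivative_eq_intros assms(1,2) simp: abs_le_iff\<close>)+
  ultimately show ?thesis by (simp add: abs_le_iff)
qed

lemma tendsto_zero_mult_bounded:
  fixes f g :: "'a \<Rightarrow> real"
  assumes "(f \<longlongrightarrow> 0) F" "\<And>t. \<bar>g t\<bar> \<le> 1"
  shows "((\<lambda>t. f t * g t) \<longlongrightarrow> 0) F"
proof (rule Lim_null_comparison)
  show "((\<lambda>t. \<bar>f t\<bar>) \<longlongrightarrow> 0) F"
    using assms(1) by (rule tendsto_rabs_zero)
  show "\<forall>\<^sub>F t in F. norm (f t * g t) \<le> \<bar>f t\<bar>"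
    using assms(2) by (auto simp: abs_mult intro!: always_eventually mult_left_le)
qed

lemma tendsto_ratio_of_powers:
  fixes f g :: "real \<Rightarrow> real"
  assumes "((\<lambda>t. f t * t powr a) \<longlongrightarrow> A) at_top" "((\<lambda>t. g t * t powr b) \<longlongrightarrow> B) at_top" "B \<noteq> 0"
  shows "((\<lambda>t. f t / g t * t powr (a - b)) \<longlongrightarrow> A / B) at_top"
proof -
  have "((\<lambda>t. (f t * t powr a) / (g t * t powr b)) \<longlongrightarrow> A / B) at_top"
    using assms by (intro tendsto_divide)
  moreover have "\<forall>\<^sub>F t in at_top. (f t * t powr a) / (g t * t powr b) = f t / g t * t powr (a - b)"
    using eventually_gt_at_top[of 0] by eventually_elim (simp add: powr_diff)
  ultimately show ?thesis by (rule Lim_transform_eventually)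
qed

lemma tendsto_zero_if_powr_tendsto:
  fixes f :: "real \<Rightarrow> real"
  assumes "((\<lambda>t. f t * t powr a) \<longlongrightarrow> A) at_top" "0 < a"
  shows "(f \<longlongrightarrow> 0) at_top"
proof -
  have "((\<lambda>t::real. t powr (- a)) \<longlongrightarrow> 0) at_top"
    using assms(2) by (intro tendsto_neg_powr filterlim_ident) auto
  then have "((\<lambda>t. f t * t powr a * t powr (- a)) \<longlongrightarrow> A * 0) at_top"
    using assms(1) by (intro tendsto_mult)
  moreover have "\<forall>\<^sub>F t in at_top. f t * t powr a * t powr (- a) = f t"
    using eventually_gt_at_top[of 0] by eventually_elim (simp add: powr_minus)
  ultimately show ?thesis by (simp add: Lim_transform_eventually)
qed

text \<open>The derivatives at the end point of a half-line are one-sided, as they are for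
trajectories that start at a given time.\<close>

lemma continuous_on_Ici_antiderivative:
  fixes g :: "real \<Rightarrow> real"
  assumes "continuous_on {a..} g"
  obtains G where "\<And>t. a \<le> t \<Longrightarrow> (G has_real_derivative g t) (at t within {a..})"
proof -
  have "((\<lambda>t. integral {a..t} g) has_real_derivative g t) (at t within {a..})" if t: "a \<le> t" for t
  proof -
    have "continuous_on {a..t+1} g"
      using assms by (rule continuous_on_subset) auto
    then have "((\<lambda>t. integral {a..t} g) has_real_derivative g t) (at t within {a..t+1})"
      using t by (intro integral_has_real_derivative) auto
    moreover have "at t within {a..} = at t within {a..t+1}"
      by (rule at_within_nhd[of _ "{t-1<..<t+1}"]) auto
    ultimately show ?thesis by simp
  qed
  then show thesis by (rule that)
qed

lemma bounded_on_Ici_if_convergent: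
  fixes g :: "real \<Rightarrow> real"
  assumes cont: "continuous_on {a..} g" and lim: "(g \<longlongrightarrow> L) at_top"
  shows "\<exists>K>0. \<forall>t\<ge>a. \<bar>g t\<bar> \<le> K"
proof -
  have "\<forall>\<^sub>F t in at_top. dist (g t) L < 1" using lim by (rule tendstoD) simp
  then obtain b where b: "\<And>t. b \<le> t \<Longrightarrow> dist (g t) L < 1"
    by (auto simp: eventually_at_top_linorder)
  have "continuous_on {a..b} g" using cont by (rule continuous_on_subset) auto
  then have "bounded (g ` {a..b})"
    by (intro compact_imp_bounded compact_continuous_image) auto
  then obtain M where "\<forall>y\<in>g ` {a..b}. norm y \<le> M"
    unfolding bounded_iff by blast
  then have M: "\<And>t. t \<in> {a..b} \<Longrightarrow> \<bar>g t\<bar> \<le> M" by auto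
  show ?thesis
  proof (intro exI[of _ "\<bar>M\<bar> + \<bar>L\<bar> + 1"] conjI allI impI)
    fix t assume "a \<le> t"
    show "\<bar>g t\<bar> \<le> \<bar>M\<bar> + \<bar>L\<bar> + 1"
    proof (cases "t \<le> b")
      case True
      then show ?thesis using M[of t] \<open>a \<le> t\<close> by auto
    next
      case False
      then show ?thesis using b[of t] by (auto simp: dist_real_def)
    qed
  qed simp
qed

lemma at_within_Ici_not_bot: "a \<le> t \<Longrightarrow> at t within {a..} \<noteq> (bot :: real filter)"
proof
  assume "a \<le> t" and bot: "at t within {a..} = bot"
  then have "{t<..} \<subseteq> {a..}" by auto
  from at_le[OF this, of t] bot have "at_right t = bot" by (metis bot.extremum_uniqueI)
  then show False by simp
qed

lemma vector_derivative_within_Ici: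
  fixes f :: "real \<Rightarrow> real"
  assumes "a \<le> t" "(f has_real_derivative D) (at t within {a..})"
  shows "vector_derivative f (at t within {a..}) = D"
  using assms at_within_Ici_not_bot[of a t]
  by (intro vector_derivative_within) (simp_all add: has_real_derivative_iff_has_vector_derivative)

section \<open>Box dimension and length from covering estimates\<close>

text \<open>The dimension is read off from the order of magnitude of the neighbourhoods: at
exponents above \<open>d\<close> both contents vanish, and at exponents up to \<open>d\<close>
both are positive or infinite.\<close>

lemma has_box_dim_if_volume_comparable:
  fixes A :: "'a::euclidean_space set"
  assumes bdd: "bounded A" and d: "0 \<le> d" and c: "0 < c"
    and lower: "\<forall>\<^sub>F \<epsilon> in at_right 0.
      ennreal (c * \<epsilon> powr (real DIM('a) - d)) \<le> emeasure lborel (nbhd_of A \<epsilon>)"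
    and upper: "\<forall>\<^sub>F \<epsilon> in at_right 0.
      emeasure lborel (nbhd_of A \<epsilon>) \<le> ennreal (C * \<epsilon> powr (real DIM('a) - d))"
  shows "has_box_dim A d"
proof -
  let ?n = "real DIM('a)"
  let ?q = "\<lambda>s \<epsilon>. emeasure lborel (nbhd_of A \<epsilon>) / ennreal (\<epsilon> powr (?n - s))"
  have small: "\<forall>\<^sub>F \<epsilon>::real in at_right 0. 0 < \<epsilon> \<and> \<epsilon> < 1"
    by (auto simp: eventually_at_right_field intro!: exI[of _ 1])
  have zero: "upper_content s A = 0 \<and> lower_content s A = 0" if s: "d < s" for s
  proof -
    have "\<forall>\<^sub>F \<epsilon> in at_right 0. ?q s \<epsilon> \<le> ennreal (C * \<epsilon> powr (s - d))"
      using upper small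
    proof eventually_elim
      case (elim \<epsilon>)
      have "?q s \<epsilon> \<le> ennreal (C * \<epsilon> powr (?n - d)) / ennreal (\<epsilon> powr (?n - s))"
        using elim by (intro divide_right_mono_ennreal) auto
      also have "\<dots> = ennreal (C * \<epsilon> powr (s - d))"
      proof (cases "C \<ge> 0")
        case True
        have "\<epsilon> powr (?n - d) = \<epsilon> powr (s - d) * \<epsilon> powr (?n - s)"
          using elim by (simp flip: powr_add)
        then show ?thesis using True elim by (simp add: divide_ennreal)
      next
        case False
        then have "C * \<epsilon> powr (?n - d) \<le> 0" "C * \<epsilon> powr (s - d) \<le> 0"
          by (auto simp: mult_nonpos_nonneg)
        then show ?thesis by (simp add: ennreal_neg)
      qed
      finally show ?case .
    qed
    moreover have "((\<lambda>\<epsilon>. ennreal (C * \<epsilon> powr (s - d))) \<longlongrightarrow> ennreal (C * 0)) (at_right 0)"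
    proof (intro tendsto_ennrealI tendsto_mult tendsto_const)
      have "((\<lambda>\<epsilon>::real. \<epsilon>) \<longlongrightarrow> 0) (at_right 0)" by (rule tendsto_ident_at)
      then show "((\<lambda>\<epsilon>::real. \<epsilon> powr (s - d)) \<longlongrightarrow> 0) (at_right 0)"
        using s small
        by (intro tendsto_zero_powrI[where b = "s - d"]) (auto elim: eventually_mono)
    qed
    ultimately have "(?q s \<longlongrightarrow> 0) (at_right 0)"
      using tendsto_sandwich[of "\<lambda>_. 0" "?q s" "at_right 0" "\<lambda>\<epsilon>. ennreal (C * \<epsilon> powr (s - d))" 0] by simp
    then show ?thesis
      unfolding upper_content_def lower_content_def
      by (auto intro!: lim_imp_Limsup lim_imp_Liminf)
  qed
  have pos: "lower_content s A > 0 \<and> upper_content s A > 0" if s: "s \<le> d" for s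
  proof -
    have "\<forall>\<^sub>F \<epsilon> in at_right 0. ennreal c \<le> ?q s \<epsilon>"
      using lower small
    proof eventually_elim
      case (elim \<epsilon>)
      have "c \<le> c * \<epsilon> powr (s - d)"
        using elim s c powr_mono'[of "s - d" 0 \<epsilon>] by simp
      moreover have "\<epsilon> powr (?n - d) = \<epsilon> powr (s - d) * \<epsilon> powr (?n - s)"
        using elim by (simp flip: powr_add)
      ultimately have "ennreal c \<le> ennreal (c * \<epsilon> powr (?n - d)) / ennreal (\<epsilon> powr (?n - s))"
        using elim c by (simp add: divide_ennreal)
      also have "\<dots> \<le> ?q s \<epsilon>" using elim by (intro divide_right_mono_ennreal) auto
      finally show ?case .
    qed
    then have "ennreal c \<le> lower_content s A"
      unfolding lower_content_def by (rule Liminf_bounded)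
    moreover have "lower_content s A \<le> upper_content s A"
      unfolding lower_content_def upper_content_def by (intro Liminf_le_Limsup) simp
    moreover have "0 < ennreal c" using c by simp
    ultimately show ?thesis by (meson less_le_trans)
  qed
  have "{s. 0 \<le> s \<and> lower_content s A = 0} = {d<..}"
       "{s. 0 \<le> s \<and> upper_content s A = 0} = {d<..}"
    using zero pos d by (force simp: not_le[symmetric])+
  then show ?thesis
    using bdd unfolding has_box_dim_def lower_box_dim_def upper_box_dim_def by simp
qed

lemma nbhd_of_iff: "y \<in> nbhd_of A \<epsilon> \<longleftrightarrow> (\<exists>a\<in>A. dist y a < \<epsilon>)"
proof (cases "A = {}")
  case True
  then show ?thesis by (simp add: nbhd_of_def)
next
  case False
  then have "infdist y A < \<epsilon> \<longleftrightarrow> (\<exists>a\<in>A. dist y a < \<epsilon>)"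
    unfolding infdist_def by (simp add: cInf_less_iff)
  then show ?thesis using False by (simp add: nbhd_of_def)
qed

lemma open_nbhd_of: "open (nbhd_of A \<epsilon>)"
proof -
  have "nbhd_of A \<epsilon> = (\<Union>a\<in>A. ball a \<epsilon>)" by (auto simp: nbhd_of_iff dist_commute)
  then show ?thesis by (simp add: open_UN)
qed

text \<open>If the curve is Lipschitz with respect to a parameter \<open>G\<close>, then cutting
the range of \<open>G\<close> into pieces of length \<open>\<epsilon>\<close> cuts the curve into
pieces of diameter at most \<open>K \<epsilon>\<close>, and one ball per piece covers the
neighbourhood. On a spiral the parameter will be proportional to a bound of the arc
length.\<close>

lemma emeasure_nbhd_of_lipschitz_le:
  fixes c :: "real \<Rightarrow> 'a::euclidean_space"
  assumes eps: "0 < \<epsilon>" and K: "0 \<le> K"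
    and lip: "\<And>s t. s \<in> S \<Longrightarrow> t \<in> S \<Longrightarrow> dist (c s) (c t) \<le> K * \<bar>G t - G s\<bar>"
    and G: "\<And>t. t \<in> S \<Longrightarrow> 0 \<le> G t \<and> G t \<le> U" and U: "0 \<le> U"
  shows "emeasure lborel (nbhd_of (c ` S) \<epsilon>)
    \<le> ennreal ((U / \<epsilon> + 1) * (unit_ball_vol DIM('a) * ((K + 1) * \<epsilon>) ^ DIM('a)))"
proof -
  define ind where "ind t = nat \<lfloor>G t / \<epsilon>\<rfloor>" for t
  define M where "M = nat \<lfloor>U / \<epsilon>\<rfloor>"
  \<comment> \<open>\<open>w i\<close> is an arbitrary point of the curve in the
  \<open>i\<close>-th piece; it is unspecified if the piece is empty.\<close>
  define w where "w i = c (SOME t. t \<in> S \<and> ind t = i)" for i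
  let ?V = "unit_ball_vol DIM('a) * ((K + 1) * \<epsilon>) ^ DIM('a)"
  have "nbhd_of (c ` S) \<epsilon> \<subseteq> (\<Union>i\<le>M. ball (w i) ((K + 1) * \<epsilon>))"
  proof
    fix y assume "y \<in> nbhd_of (c ` S) \<epsilon>"
    then obtain t where t: "t \<in> S" "dist y (c t) < \<epsilon>" by (auto simp: nbhd_of_iff)
    define s where "s = (SOME s. s \<in> S \<and> ind s = ind t)"
    have s: "s \<in> S" "ind s = ind t" using someI[of "\<lambda>s. s \<in> S \<and> ind s = ind t" t] t by (auto simp: s_def)
    have "\<lfloor>G s / \<epsilon>\<rfloor> = \<lfloor>G t / \<epsilon>\<rfloor>"
      using s(2) G[OF s(1)] G[OF t(1)] eps unfolding ind_def by (simp add: eq_nat_nat_iff)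
    then have "\<bar>G t / \<epsilon> - G s / \<epsilon>\<bar> \<le> 1" by linarith
    then have "\<bar>G t - G s\<bar> \<le> \<epsilon>" using eps by (simp add: abs_divide flip: diff_divide_distrib)
    then have "dist (c s) (c t) \<le> K * \<epsilon>"
      using lip[OF s(1) t(1)] mult_left_mono[OF _ K] by (meson order_trans)
    then have "dist (c s) y < (K + 1) * \<epsilon>"
      using t(2) dist_triangle[of "c s" y "c t"] by (simp add: dist_commute algebra_simps)
    moreover have "c s = w (ind t)" by (simp add: w_def s_def)
    moreover have "ind t \<le> M"
      using G[OF t(1)] eps unfolding ind_def M_def by (intro nat_mono floor_mono divide_right_mono) auto
    ultimately show "y \<in> (\<Union>i\<le>M. ball (w i) ((K + 1) * \<epsilon>))" by auto
  qed
  then have "emeasure lborel (nbhd_of (c ` S) \<epsilon>) \<le> emeasure lborel (\<Union>i\<le>M. ball (w i) ((K + 1) * \<epsilon>))"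
    by (intro emeasure_mono) auto
  also have "\<dots> \<le> (\<Sum>i\<le>M. emeasure lborel (ball (w i) ((K + 1) * \<epsilon>)))"
    by (intro emeasure_subadditive_finite) auto
  also have "\<dots> = (\<Sum>i\<le>M. ennreal ?V)"
    using eps K by (intro sum.cong refl emeasure_ball) auto
  also have "\<dots> = ennreal ((real M + 1) * ?V)"
    by (subst sum_ennreal) (auto simp: K eps less_imp_le)
  also have "\<dots> \<le> ennreal ((U / \<epsilon> + 1) * ?V)"
    using K eps U by (intro ennreal_leI mult_right_mono) (auto simp: M_def)
  finally show ?thesis .
qed

lemma rectifiable_if_dominated:
  fixes c :: "real \<Rightarrow> 'a::metric_space"
  assumes "\<And>s t. s \<in> S \<Longrightarrow> t \<in> S \<Longrightarrow> s \<le> t \<Longrightarrow> dist (c s) (c t) \<le> G t - G s \<and> G t - G s \<le> B"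
  shows "rectifiable c S"
proof -
  have "curve_length c S \<le> ennreal (max B 0)"
    unfolding curve_length_def
  proof (rule Sup_least, clarify)
    fix n :: nat and t :: "nat \<Rightarrow> real"
    assume t: "\<forall>i\<le>n. t i \<in> S" "\<forall>i<n. t i \<le> t (Suc i)"
    have "t 0 \<le> t m" if "m \<le> n" for m
      using that t(2) by (induction m) (auto intro: order_trans)
    have "(\<Sum>i<n. ennreal (dist (c (t i)) (c (t (Suc i))))) = ennreal (\<Sum>i<n. dist (c (t i)) (c (t (Suc i))))"
      by (rule sum_ennreal) simp
    also have "(\<Sum>i<n. dist (c (t i)) (c (t (Suc i)))) \<le> (\<Sum>i<n. G (t (Suc i)) - G (t i))"
      using t assms by (intro sum_mono) auto
    also have "\<dots> = G (t n) - G (t 0)" by (rule sum_lessThan_telescope)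
    also have "\<dots> \<le> B" using t(1) assms[of "t 0" "t n"] \<open>\<And>m. m \<le> n \<Longrightarrow> t 0 \<le> t m\<close>[of n] by auto
    also have "B \<le> max B 0" by simp
    finally show "(\<Sum>i<n. ennreal (dist (c (t i)) (c (t (Suc i))))) \<le> ennreal (max B 0)"
      by (simp add: ennreal_leI)
  qed
  then show ?thesis unfolding rectifiable_def by (rule le_less_trans) simp
qed

section \<open>Damped oscillations in the phase plane\<close>

text \<open>The setting \<open>x(t) = p(t) sin t\<close> with an amplitude \<open>p(t) =
P(1/t)\<close>. Of the hypothesis on \<open>P\<close> only the leading orders of \<open>p\<close>
and its first three derivatives enter; in contrast to the derivatives of
\<open>\<tau>^(\<alpha>)\<close>, those of \<open>t^(-\<alpha>)\<close> have
leading coefficients that never vanish for \<open>\<alpha> > 0\<close>, so the same estimates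
cover integer exponents.\<close>

locale damped_oscillation =
  fixes \<alpha> t\<^sub>0 :: real and p p1 p2 p3 :: "real \<Rightarrow> real"
  assumes alpha_pos: "0 < \<alpha>" and t0_pos: "0 < t\<^sub>0"
    and p_pos: "\<And>t. t\<^sub>0 \<le> t \<Longrightarrow> 0 < p t"
    and p_deriv: "\<And>t. t\<^sub>0 \<le> t \<Longrightarrow> (p has_real_derivative p1 t) (at t within {t\<^sub>0..})"
    and p1_deriv: "\<And>t. t\<^sub>0 \<le> t \<Longrightarrow> (p1 has_real_derivative p2 t) (at t within {t\<^sub>0..})"
    and p2_deriv: "\<And>t. t\<^sub>0 \<le> t \<Longrightarrow> (p2 has_real_derivative p3 t) (at t within {t\<^sub>0..})"
    and p_lim: "((\<lambda>t. p t * t powr \<alpha>) \<longlongrightarrow> 1) at_top"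
    and p1_lim: "((\<lambda>t. p1 t * t powr (\<alpha> + 1)) \<longlongrightarrow> - \<alpha>) at_top"
    and p2_lim: "((\<lambda>t. p2 t * t powr (\<alpha> + 2)) \<longlongrightarrow> \<alpha> * (\<alpha> + 1)) at_top"
    and p3_lim: "((\<lambda>t. p3 t * t powr (\<alpha> + 3)) \<longlongrightarrow> - (\<alpha> * (\<alpha> + 1) * (\<alpha> + 2))) at_top"
begin

text \<open>The curve is \<open>(x, y)\<close> with \<open>y = x'\<close> and \<open>z =
x''\<close>. In units of the amplitude \<open>y\<close> is \<open>w1\<close>, a cosine perturbed
by the logarithmic derivative \<open>q\<close>; in units of \<open>2 p'\<close> the sum \<open>x +
x''\<close> is \<open>w2\<close>, a cosine perturbed by \<open>h\<close>. The radius satisfies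
\<open>r r' = y (x + z)\<close>, so these two perturbed cosines decide where the radius grows, and
\<open>\<omega>\<close> is the angular velocity.\<close>

definition "q t = p1 t / p t"
definition "h t = p2 t / (2 * p1 t)"
definition "w1 t = cos t + q t * sin t"
definition "w2 t = cos t + h t * sin t"
definition "x t = p t * sin t"
definition "y t = p1 t * sin t + p t * cos t"
definition "z t = p2 t * sin t + 2 * p1 t * cos t - p t * sin t"
definition "r t = sqrt ((x t)\<^sup>2 + (y t)\<^sup>2)"
definition "r' t = y t * (x t + z t) / r t"
definition "\<omega> t = (x t * z t - (y t)\<^sup>2) / ((x t)\<^sup>2 + (y t)\<^sup>2)"

lemma continuous_p: "continuous_on {t\<^sub>0..} p"
  and continuous_p1: "continuous_on {t\<^sub>0..} p1"
  and continuous_p2: "continuous_on {t\<^sub>0..} p2"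
  using p_deriv p1_deriv p2_deriv by (auto intro!: DERIV_continuous_on)

lemma x_deriv: "t\<^sub>0 \<le> t \<Longrightarrow> (x has_real_derivative y t) (at t within {t\<^sub>0..})"
  unfolding x_def[abs_def] y_def
  by (auto intro!: derivative_eq_intros p_deriv)

lemma y_deriv: "t\<^sub>0 \<le> t \<Longrightarrow> (y has_real_derivative z t) (at t within {t\<^sub>0..})"
  unfolding y_def[abs_def] z_def
  by (auto intro!: derivative_eq_intros p_deriv p1_deriv simp: algebra_simps)

lemma continuous_x: "continuous_on {t\<^sub>0..} x"
  and continuous_y: "continuous_on {t\<^sub>0..} y"
  using x_deriv y_deriv by (auto intro!: DERIV_continuous_on)

lemma continuous_z: "continuous_on {t\<^sub>0..} z"
  unfolding z_def[abs_def]
  by (intro continuous_intros continuous_p continuous_p1 continuous_p2)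

text \<open>The curve avoids the origin because the zeros of \<open>x\<close> are those of the
sine, where \<open>y\<close> is plus or minus the amplitude.\<close>

lemma xy_nonzero: "t\<^sub>0 \<le> t \<Longrightarrow> 0 < (x t)\<^sup>2 + (y t)\<^sup>2"
proof -
  assume t: "t\<^sub>0 \<le> t"
  have "x t \<noteq> 0 \<or> y t \<noteq> 0"
  proof (cases "sin t = 0")
    case True
    then have "cos t \<noteq> 0" by (metis sin_zero_abs_cos_one abs_zero zero_neq_one)
    then show ?thesis using True p_pos[OF t] by (simp add: y_def)
  next
    case False
    then show ?thesis using p_pos[OF t] by (simp add: x_def)
  qed
  then show ?thesis by (simp add: sum_power2_gt_zero_iff)
qed

lemma r_pos: "t\<^sub>0 \<le> t \<Longrightarrow> 0 < r t"
  using xy_nonzero by (simp add: r_def)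

lemma r_square: "(r t)\<^sup>2 = (x t)\<^sup>2 + (y t)\<^sup>2"
  by (simp add: r_def)

lemma r_deriv: "t\<^sub>0 \<le> t \<Longrightarrow> (r has_real_derivative r' t) (at t within {t\<^sub>0..})"
proof -
  assume t: "t\<^sub>0 \<le> t"
  have "((\<lambda>t. (x t)\<^sup>2 + (y t)\<^sup>2) has_real_derivative 2 * (y t * (x t + z t))) (at t within {t\<^sub>0..})"
    by (auto intro!: derivative_eq_intros x_deriv y_deriv t simp: algebra_simps)
  from DERIV_chain2[OF DERIV_real_sqrt[OF xy_nonzero[OF t]] this]
  have "(r has_real_derivative inverse (r t) / 2 * (2 * (y t * (x t + z t)))) (at t within {t\<^sub>0..})"
    unfolding r_def[abs_def] .
  moreover have "inverse a / 2 * (2 * b) = b / a" for a b :: real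
    by (simp add: inverse_eq_divide)
  ultimately show ?thesis unfolding r'_def by (simp only:)
qed

lemma continuous_r: "continuous_on {t\<^sub>0..} r"
  using r_deriv by (auto intro!: DERIV_continuous_on)

lemma continuous_r': "continuous_on {t\<^sub>0..} r'"
  unfolding r'_def[abs_def] using r_pos
  by (intro continuous_intros continuous_x continuous_y continuous_z continuous_r) force

lemma continuous_omega: "continuous_on {t\<^sub>0..} \<omega>"
  unfolding \<omega>_def[abs_def] using xy_nonzero
  by (intro continuous_intros continuous_x continuous_y continuous_z) force

lemma q_lim: "((\<lambda>t. t * q t) \<longlongrightarrow> - \<alpha>) at_top"
proof -
  have "((\<lambda>t. q t * t powr 1) \<longlongrightarrow> - \<alpha>) at_top"
    using tendsto_ratio_of_powers[OF p1_lim p_lim] by (simp add: q_def)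
  moreover have "\<forall>\<^sub>F t in at_top. q t * t powr 1 = t * q t"
    using eventually_gt_at_top[of 0] by eventually_elim simp
  ultimately show ?thesis by (rule Lim_transform_eventually)
qed

lemma h_lim: "((\<lambda>t. t * h t) \<longlongrightarrow> - (\<alpha> + 1) / 2) at_top"
proof -
  have "((\<lambda>t. 2 * p1 t * t powr (\<alpha> + 1)) \<longlongrightarrow> 2 * (- \<alpha>)) at_top"
    using tendsto_mult[OF tendsto_const[of 2] p1_lim] by (simp add: mult.assoc)
  from tendsto_ratio_of_powers[OF p2_lim this]
  have "((\<lambda>t. h t * t powr 1) \<longlongrightarrow> \<alpha> * (\<alpha> + 1) / (2 * (- \<alpha>))) at_top"
    using alpha_pos by (simp add: h_def)
  also have "\<alpha> * (\<alpha> + 1) / (2 * (- \<alpha>)) = - (\<alpha> + 1) / 2"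
    using alpha_pos by (simp add: field_simps)
  finally have "((\<lambda>t. h t * t powr 1) \<longlongrightarrow> - (\<alpha> + 1) / 2) at_top" .
  moreover have "\<forall>\<^sub>F t in at_top. h t * t powr 1 = t * h t"
    using eventually_gt_at_top[of 0] by eventually_elim simp
  ultimately show ?thesis by (rule Lim_transform_eventually)
qed

lemma tendsto_zero_if_times_t:
  fixes f :: "real \<Rightarrow> real"
  assumes "((\<lambda>t. t * f t) \<longlongrightarrow> A) at_top"
  shows "(f \<longlongrightarrow> 0) at_top"
proof (rule tendsto_zero_if_powr_tendsto[of _ 1 A])
  have "\<forall>\<^sub>F t in at_top. t * f t = f t * t powr 1"
    using eventually_gt_at_top[of 0] by eventually_elim simp
  with assms show "((\<lambda>t. f t * t powr 1) \<longlongrightarrow> A) at_top" by (rule Lim_transform_eventually)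
qed simp

lemmas q_tendsto_0 = tendsto_zero_if_times_t[OF q_lim]
lemmas h_tendsto_0 = tendsto_zero_if_times_t[OF h_lim]

lemma p2_over_p_tendsto_0: "((\<lambda>t. p2 t / p t) \<longlongrightarrow> 0) at_top"
  using tendsto_ratio_of_powers[OF p2_lim p_lim]
  by (intro tendsto_zero_if_powr_tendsto[where a = 2]) auto

lemma p3_over_p1_tendsto_0: "((\<lambda>t. p3 t / p1 t) \<longlongrightarrow> 0) at_top"
  using tendsto_ratio_of_powers[OF p3_lim p1_lim] alpha_pos
  by (intro tendsto_zero_if_powr_tendsto[where a = 2]) (auto simp: algebra_simps)

lemma p1_neg: "\<forall>\<^sub>F t in at_top. p1 t < 0"
proof -
  have "\<forall>\<^sub>F t in at_top. p1 t * t powr (\<alpha> + 1) < 0"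
    using p1_lim alpha_pos by (intro order_tendstoD(2)) auto
  then show ?thesis
    using eventually_gt_at_top[of 0]
    by eventually_elim (auto simp: mult_less_0_iff)
qed

lemma q_deriv: "t\<^sub>0 \<le> t \<Longrightarrow> (q has_real_derivative (p2 t / p t - (q t)\<^sup>2)) (at t within {t\<^sub>0..})"
  unfolding q_def[abs_def] using p_pos[of t]
  by (auto intro!: derivative_eq_intros p_deriv p1_deriv simp: field_simps power2_eq_square)

lemma h_deriv: "t\<^sub>0 \<le> t \<Longrightarrow> p1 t \<noteq> 0 \<Longrightarrow>
    (h has_real_derivative (p3 t / p1 t / 2 - 2 * (h t)\<^sup>2)) (at t within {t\<^sub>0..})"
  unfolding h_def[abs_def]
  by (auto intro!: derivative_eq_intros p1_deriv p2_deriv simp: field_simps power2_eq_square)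

text \<open>The two perturbations are of the same order, \<open>t q \<rightarrow>
-\<alpha>\<close> and \<open>t h \<rightarrow> -(\<alpha> + 1)/2\<close>. These limits differ for
\<open>\<alpha> \<noteq> 1\<close>, which is the source of the waves.\<close>

lemma h_q_distinct:
  assumes "\<alpha> \<noteq> 1"
  shows "\<forall>\<^sub>F t in at_top. h t \<noteq> q t"
proof -
  have "((\<lambda>t. t * h t - t * q t) \<longlongrightarrow> - (\<alpha> + 1) / 2 - (- \<alpha>)) at_top"
    by (intro tendsto_diff h_lim q_lim)
  then have "\<forall>\<^sub>F t in at_top. t * h t - t * q t \<noteq> 0"
    by (rule tendsto_imp_eventually_ne) (use assms in \<open>auto simp: field_simps\<close>)
  then show ?thesis by eventually_elim auto
qed

text \<open>The squared distance to the origin in units of the squared amplitude.\<close>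

definition "D t = (sin t)\<^sup>2 + (w1 t)\<^sup>2"

lemma y_eq: "t\<^sub>0 \<le> t \<Longrightarrow> y t = p t * w1 t"
  using p_pos[of t] by (simp add: y_def w1_def q_def field_simps)

lemma r_eq: "t\<^sub>0 \<le> t \<Longrightarrow> r t = p t * sqrt (D t)"
proof -
  assume t: "t\<^sub>0 \<le> t"
  have "(x t)\<^sup>2 + (y t)\<^sup>2 = (p t)\<^sup>2 * D t"
    by (simp add: y_eq[OF t] x_def D_def algebra_simps power_mult_distrib)
  then show ?thesis using p_pos[OF t] by (simp add: r_def real_sqrt_mult)
qed

lemma D_pos: "t\<^sub>0 \<le> t \<Longrightarrow> 0 < D t"
  using r_pos[of t] p_pos[of t] r_eq[of t] by (simp add: zero_less_mult_iff)

lemma e1_tendsto_0: "((\<lambda>t. q t * sin t) \<longlongrightarrow> 0) at_top"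
  and e2_tendsto_0: "((\<lambda>t. h t * sin t) \<longlongrightarrow> 0) at_top"
  by (rule tendsto_zero_mult_bounded[OF q_tendsto_0]
           tendsto_zero_mult_bounded[OF h_tendsto_0]; simp)+

lemma D_tendsto_1: "(D \<longlongrightarrow> 1) at_top"
proof -
  have "((\<lambda>t. (q t * sin t) * cos t) \<longlongrightarrow> 0) at_top"
    by (rule tendsto_zero_mult_bounded[OF e1_tendsto_0]) simp
  from tendsto_add[OF tendsto_add[OF tendsto_const[of 1] tendsto_mult[OF tendsto_const[of 2] this]]
      tendsto_power[OF e1_tendsto_0, of 2]]
  have "((\<lambda>t. 1 + 2 * ((q t * sin t) * cos t) + (q t * sin t)\<^sup>2) \<longlongrightarrow> 1) at_top" by simp
  moreover have "1 + 2 * ((q t * sin t) * cos t) + (q t * sin t)\<^sup>2 = D t" for t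
    using sin_cos_squared_add[of t] unfolding D_def w1_def by (simp add: power2_eq_square algebra_simps)
  ultimately show ?thesis by simp
qed

lemma r_lim: "((\<lambda>t. r t * t powr \<alpha>) \<longlongrightarrow> 1) at_top"
proof -
  have "((\<lambda>t. (p t * t powr \<alpha>) * sqrt (D t)) \<longlongrightarrow> 1 * sqrt 1) at_top"
    by (intro tendsto_mult p_lim tendsto_real_sqrt D_tendsto_1)
  moreover have "\<forall>\<^sub>F t in at_top. (p t * t powr \<alpha>) * sqrt (D t) = r t * t powr \<alpha>"
    using eventually_ge_at_top[of t\<^sub>0] by eventually_elim (simp add: r_eq)
  ultimately show ?thesis by (simp add: Lim_transform_eventually)
qed

text \<open>To leading order the curve and its velocity are those of \<open>p(t) (sin t, cos
t)\<close>, which turns clockwise at unit angular speed.\<close>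

lemma omega_tendsto: "(\<omega> \<longlongrightarrow> - 1) at_top"
proof -
  have "((\<lambda>t. ((q t)\<^sup>2 - p2 t / p t) * (sin t)\<^sup>2) \<longlongrightarrow> 0) at_top"
  proof (rule tendsto_zero_mult_bounded)
    show "((\<lambda>t. (q t)\<^sup>2 - p2 t / p t) \<longlongrightarrow> 0) at_top"
      using tendsto_diff[OF tendsto_power[OF q_tendsto_0, of 2] p2_over_p_tendsto_0] by simp
  qed (simp add: abs_square_le_1)
  from tendsto_minus[OF tendsto_divide[OF tendsto_add[OF tendsto_const[of 1] this] D_tendsto_1]]
  have "((\<lambda>t. - ((1 + ((q t)\<^sup>2 - p2 t / p t) * (sin t)\<^sup>2) / D t)) \<longlongrightarrow> - 1) at_top" by simp
  moreover have "\<forall>\<^sub>F t in at_top. - ((1 + ((q t)\<^sup>2 - p2 t / p t) * (sin t)\<^sup>2) / D t) = \<omega> t"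
    using eventually_ge_at_top[of t\<^sub>0]
  proof eventually_elim
    case (elim t)
    note p = p_pos[OF elim]
    have D: "(x t)\<^sup>2 + (y t)\<^sup>2 = (p t)\<^sup>2 * D t"
      by (simp add: y_eq[OF elim] x_def D_def algebra_simps power_mult_distrib)
    have "(p t)\<^sup>2 * (1 + ((q t)\<^sup>2 - p2 t / p t) * (sin t)\<^sup>2)
        = (p t)\<^sup>2 * ((sin t)\<^sup>2 + (cos t)\<^sup>2) + (p1 t * sin t)\<^sup>2 - p t * p2 t * (sin t)\<^sup>2"
      using p unfolding q_def sin_cos_squared_add by (simp add: field_simps power2_eq_square)
    also have "\<dots> = - (x t * z t - (y t)\<^sup>2)"
      unfolding x_def y_def z_def by (simp only: power2_eq_square) algebra
    finally have "(1 + ((q t)\<^sup>2 - p2 t / p t) * (sin t)\<^sup>2) = - (x t * z t - (y t)\<^sup>2) / (p t)\<^sup>2"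
      using p by (simp add: field_simps)
    then show ?case unfolding \<omega>_def D
      by (simp only: divide_divide_eq_left minus_divide_left[symmetric] minus_minus)
  qed
  ultimately show ?thesis by (rule Lim_transform_eventually)
qed

text \<open>The product \<open>w1 w2\<close> is a perturbed \<open>cos\<^sup>2\<close>, so for
falling amplitude \<open>r'\<close> is nonpositive except between neighbouring zeros of
\<open>w1\<close> and \<open>w2\<close>.\<close>

lemma r'_eq: "t\<^sub>0 \<le> t \<Longrightarrow> p1 t \<noteq> 0 \<Longrightarrow> r' t = 2 * p t * p1 t * (w1 t * w2 t) / r t"
proof -
  assume t: "t\<^sub>0 \<le> t" and p1: "p1 t \<noteq> 0"
  have "x t + z t = 2 * p1 t * w2 t"
    using p1 by (simp add: x_def z_def w2_def h_def field_simps)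
  then show ?thesis by (simp add: r'_def y_eq[OF t])
qed

text \<open>The logarithmic derivative of the radius is \<open>-2 \<alpha> cos\<^sup>2 t /
t\<close> up to \<open>o(1/t)\<close>: in \<open>r' / r = 2 q w1 w2 / D\<close> the factor
\<open>t q\<close> tends to \<open>-\<alpha>\<close>, both perturbed cosines are within
\<open>o(1)\<close> of the cosine, and \<open>D\<close> tends to 1.\<close>

lemma log_deriv_lim: "((\<lambda>t. t * (r' t / r t) + 2 * \<alpha> * (cos t)\<^sup>2) \<longlongrightarrow> 0) at_top"
proof -
  define e1 e2 where "e1 t = q t * sin t" and "e2 t = h t * sin t" for t
  have e: "(e1 \<longlongrightarrow> 0) at_top" "(e2 \<longlongrightarrow> 0) at_top"
    using e1_tendsto_0 e2_tendsto_0 unfolding e1_def[abs_def] e2_def[abs_def] by auto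
  have bd: "\<bar>cos t\<bar> \<le> 1" "\<bar>(cos t)\<^sup>2\<bar> \<le> 1" "\<bar>(cos t) ^ 3\<bar> \<le> 1" for t :: real
    using power_le_one[of "\<bar>cos t\<bar>" 2] power_le_one[of "\<bar>cos t\<bar>" 3] by (auto simp: power_abs)
  have "((\<lambda>t. e1 t * cos t + e2 t * cos t + e1 t * e2 t - 2 * (e1 t * (cos t) ^ 3)
      - (e1 t)\<^sup>2 * (cos t)\<^sup>2) \<longlongrightarrow> 0 + 0 + 0 * 0 - 2 * 0 - 0) at_top"
    by (intro tendsto_intros e tendsto_zero_mult_bounded bd)
       (use tendsto_power[OF e(1), of 2] in \<open>simp_all add: bd\<close>)
  moreover have "e1 t * cos t + e2 t * cos t + e1 t * e2 t - 2 * (e1 t * (cos t) ^ 3)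
      - (e1 t)\<^sup>2 * (cos t)\<^sup>2 = w1 t * w2 t - (cos t)\<^sup>2 * D t" for t
  proof -
    have "D t = 1 + 2 * e1 t * cos t + (e1 t)\<^sup>2"
      using sin_cos_squared_add[of t] unfolding D_def w1_def e1_def
      by (simp add: power2_eq_square algebra_simps)
    then show ?thesis unfolding w1_def w2_def e1_def[symmetric] e2_def[symmetric]
      by (simp add: algebra_simps power2_eq_square power3_eq_cube)
  qed
  ultimately have num: "((\<lambda>t. w1 t * w2 t - (cos t)\<^sup>2 * D t) \<longlongrightarrow> 0) at_top" by simp
  have "((\<lambda>t. 2 * (t * q t) * ((w1 t * w2 t - (cos t)\<^sup>2 * D t) / D t)
      + 2 * ((t * q t + \<alpha>) * (cos t)\<^sup>2)) \<longlongrightarrow> 2 * (- \<alpha>) * (0 / 1) + 2 * 0) at_top"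
    by (intro tendsto_intros num D_tendsto_1 q_lim tendsto_zero_mult_bounded bd)
       (use tendsto_add[OF q_lim tendsto_const[of \<alpha>]] in auto)
  moreover have "\<forall>\<^sub>F t in at_top. 2 * (t * q t) * ((w1 t * w2 t - (cos t)\<^sup>2 * D t) / D t)
      + 2 * ((t * q t + \<alpha>) * (cos t)\<^sup>2) = t * (r' t / r t) + 2 * \<alpha> * (cos t)\<^sup>2"
    using eventually_ge_at_top[of t\<^sub>0] p1_neg
  proof eventually_elim
    case (elim t)
    have "r t * r t = (p t)\<^sup>2 * D t"
      using r_eq[OF elim(1)] D_pos[OF elim(1)] by (simp add: power2_eq_square)
    then have "r' t / r t = 2 * q t * (w1 t * w2 t) / D t"
      using r'_eq[OF elim(1)] elim p_pos[OF elim(1)]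
      by (simp add: q_def power2_eq_square)
    then have A: "r' t / r t = 2 * q t * u" if "u = w1 t * w2 t / D t" for u
      using that by simp
    have B: "(w1 t * w2 t - (cos t)\<^sup>2 * D t) / D t = w1 t * w2 t / D t - (cos t)\<^sup>2"
      using D_pos[OF elim(1)] by (simp add: diff_divide_distrib)
    have "2 * (t * q t) * (u - (cos t)\<^sup>2) + 2 * ((t * q t + \<alpha>) * (cos t)\<^sup>2)
        = t * (2 * q t * u) + 2 * \<alpha> * (cos t)\<^sup>2" for u
      by (simp add: algebra_simps)
    then show ?case unfolding B A[OF refl] .
  qed
  ultimately show ?thesis by (simp add: Lim_transform_eventually)
qed

end

section \<open>Fall and growth of the radius\<close>

lemma abs_le_three_times:
  fixes a b c :: real
  shows "\<bar>a + b\<bar> < c \<Longrightarrow> 0 \<le> b \<Longrightarrow> b \<le> 2 * c \<Longrightarrow> \<bar>a\<bar> \<le> 3 * c"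
  by linarith

context damped_oscillation
begin

text \<open>Although the radius is not monotone, at late times it falls over every span of
moderate length. By the estimate of its logarithmic derivative, for fixed \<open>t\<close> the
derivative of \<open>t ln (r s)\<close> is \<open>-\<alpha> (1 + cos 2s)\<close> up to a small
error, as long as \<open>s\<close> stays in a bounded window after \<open>t\<close>; integrating,
the loss \<open>\<alpha> (s - t)\<close> beats the oscillating term, which is at most
\<open>\<alpha>\<close>, once \<open>s - t\<close> exceeds 1 by a margin. The window \<open>[t +
3/2, t + 16]\<close> contains the time of the next full turn, and it begins early enough to show
that a temporary growth is undone within the same half turn.\<close>

lemma radius_falls:
  "\<forall>\<^sub>F t in at_top. \<forall>s. t + 3/2 \<le> s \<and> s \<le> t + 16 \<longrightarrow> r s < r t"
proof -
  have "\<forall>\<^sub>F t in at_top. \<bar>t * (r' t / r t) + 2 * \<alpha> * (cos t)\<^sup>2\<bar> < \<alpha> / 40"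
    using tendstoD[OF log_deriv_lim, of "\<alpha> / 40"] alpha_pos by (simp add: dist_real_def)
  then obtain b where b: "\<And>t. b \<le> t \<Longrightarrow> \<bar>t * (r' t / r t) + 2 * \<alpha> * (cos t)\<^sup>2\<bar> < \<alpha> / 40"
    by (auto simp: eventually_at_top_linorder)
  \<comment> \<open>Replacing \<open>1/s\<close> by \<open>1/t\<close> costs at most
  \<open>16/t\<close> times \<open>3 \<alpha>\<close>, which is \<open>\<alpha>/40\<close> from
  1920 = 16 * 3 * 40 on.\<close>
  have "\<forall>s. t + 3/2 \<le> s \<and> s \<le> t + 16 \<longrightarrow> r s < r t" if t: "t\<^sub>0 \<le> t" "b \<le> t" "1920 \<le> t" for t
  proof (intro allI impI)
    fix s assume s: "t + 3/2 \<le> s \<and> s \<le> t + 16"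
    \<comment> \<open>Up to the error allowance \<open>\<alpha> u / 20\<close>, \<open>G\<close>
    is constant to leading order; it is made nondecreasing by the allowance.\<close>
    define G where "G u = - (t * ln (r u)) - \<alpha> * (u + sin (2 * u) / 2) + \<alpha> / 20 * u" for u
    define G' where "G' u = - (t * (r' u / r u)) - \<alpha> * (1 + cos (2 * u)) + \<alpha> / 20" for u
    have "G t \<le> G s"
    proof (rule nondecreasing_on_Ici[of t\<^sub>0 G G'])
      show "(G has_real_derivative G' u) (at u within {t\<^sub>0..})" if "t\<^sub>0 \<le> u" for u
        unfolding G_def[abs_def] G'_def using that r_pos[OF that]
        by (auto intro!: derivative_eq_intros r_deriv simp: field_simps)
      show "0 \<le> G' u" if u: "t < u" "u < s" for u
      proof -
        let ?L = "r' u / r u"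
        have L: "\<bar>u * ?L + 2 * \<alpha> * (cos u)\<^sup>2\<bar> < \<alpha> / 40" using b[of u] t u by simp
        have "(cos u)\<^sup>2 \<le> 1" by (simp add: abs_square_le_1)
        then have "2 * \<alpha> * (cos u)\<^sup>2 \<le> 2 * \<alpha> * 1" using alpha_pos by (intro mult_left_mono) auto
        moreover have "0 \<le> 2 * \<alpha> * (cos u)\<^sup>2" using alpha_pos by simp
        ultimately have "\<bar>u * ?L\<bar> \<le> 3 * \<alpha>" using L alpha_pos
          by (intro abs_le_three_times[of _ "2 * \<alpha> * (cos u)\<^sup>2"]) auto
        then have "u * \<bar>?L\<bar> \<le> 3 * \<alpha>" using u t by (simp add: abs_mult)
        moreover have "1920 * \<bar>?L\<bar> \<le> u * \<bar>?L\<bar>" using u t by (intro mult_right_mono) auto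
        ultimately have "16 * \<bar>?L\<bar> \<le> \<alpha> / 40" by simp
        moreover have "\<bar>(u - t) * ?L\<bar> \<le> 16 * \<bar>?L\<bar>"
          unfolding abs_mult using u s by (intro mult_right_mono) auto
        ultimately have "\<bar>(u - t) * ?L\<bar> \<le> \<alpha> / 40" by linarith
        moreover have "t * ?L = u * ?L - (u - t) * ?L"
          using left_diff_distrib[of u t ?L] by linarith
        moreover have "\<alpha> * (1 + cos (2 * u)) = 2 * \<alpha> * (cos u)\<^sup>2"
          by (simp add: cos_double_cos)
        moreover have "0 \<le> - v - w + \<alpha> / 20"
          if "\<bar>d\<bar> \<le> \<alpha> / 40" "v = e - d" "w = c" "\<bar>e + c\<bar> < \<alpha> / 40" for v w c d e
          using that by linarith
        ultimately show ?thesis using L unfolding G'_def by blast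
      qed
    qed (use t s in auto)
    have "\<bar>sin (2 * s) - sin (2 * t)\<bar> \<le> 2"
      using sin_le_one[of "2 * s"] sin_ge_minus_one[of "2 * s"] sin_le_one[of "2 * t"] sin_ge_minus_one[of "2 * t"]
      by linarith
    then have "0 < s - t + (sin (2 * s) - sin (2 * t)) / 2 - (s - t) / 20"
      unfolding diff_divide_distrib using s by linarith
    then have "0 < \<alpha> * (s - t + (sin (2 * s) - sin (2 * t)) / 2 - (s - t) / 20)"
      using alpha_pos by (rule mult_pos_pos[rotated])
    with \<open>G t \<le> G s\<close> have "t * ln (r s) < t * ln (r t)"
      unfolding G_def by (simp add: algebra_simps add_divide_distrib diff_divide_distrib)
    then show "r s < r t" using t r_pos[of t] r_pos[of s] s by simp
  qed
  moreover have "\<forall>\<^sub>F t in at_top. t\<^sub>0 \<le> t \<and> b \<le> t \<and> 1920 \<le> t"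
    by (intro eventually_conj eventually_ge_at_top)
  ultimately show ?thesis by (auto elim!: eventually_mono)
qed

lemma radial_speed_bound: "\<forall>\<^sub>F t in at_top. \<bar>r' t\<bar> \<le> 6 * \<alpha> * t powr (- \<alpha> - 1)"
proof -
  have "\<forall>\<^sub>F t in at_top. \<bar>t * (r' t / r t) + 2 * \<alpha> * (cos t)\<^sup>2\<bar> < \<alpha>"
    using tendstoD[OF log_deriv_lim, of "\<alpha>"] alpha_pos by (simp add: dist_real_def)
  moreover have "\<forall>\<^sub>F t in at_top. r t * t powr \<alpha> < 2"
    using r_lim by (rule order_tendstoD) simp
  ultimately show ?thesis using eventually_ge_at_top[of t\<^sub>0]
  proof eventually_elim
    case (elim t)
    have t: "0 < t" and r: "0 < r t" using elim t0_pos r_pos[of t] by auto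
    have "(cos t)\<^sup>2 \<le> 1" by (simp add: abs_square_le_1)
    then have "2 * \<alpha> * (cos t)\<^sup>2 \<le> 2 * \<alpha> * 1" using alpha_pos by (intro mult_left_mono) auto
    moreover have "0 \<le> 2 * \<alpha> * (cos t)\<^sup>2" using alpha_pos by simp
    ultimately have "\<bar>t * (r' t / r t)\<bar> \<le> 3 * \<alpha>" using elim(1) by (intro abs_le_three_times[of _ "2 * \<alpha> * (cos t)\<^sup>2"]) auto
    then have "\<bar>t * (r' t / r t)\<bar> * (r t * t powr \<alpha>) \<le> (3 * \<alpha>) * 2"
      using elim(2) r alpha_pos by (intro mult_mono) auto
    also have "\<bar>t * (r' t / r t)\<bar> * (r t * t powr \<alpha>) = \<bar>r' t\<bar> * t powr (\<alpha> + 1)"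
      using t r by (simp add: abs_mult powr_add)
    finally have "\<bar>r' t\<bar> * t powr (\<alpha> + 1) * t powr (- \<alpha> - 1) \<le> 6 * \<alpha> * t powr (- \<alpha> - 1)"
      by (intro mult_right_mono) auto
    also have "\<bar>r' t\<bar> * t powr (\<alpha> + 1) * t powr (- \<alpha> - 1) = \<bar>r' t\<bar>"
      using t by (simp add: mult.assoc flip: powr_add)
    finally show ?case .
  qed
qed

end

text \<open>A cosine with a slowly varying negative sine admixture still has exactly one zero per
half turn, in the second quarter of its interval: outside the middle half of the interval the
cosine dominates, and inside it the function is strictly monotone because the derivative is
dominated by the sine. The sign \<open>(-1)\<^sup>n\<close> makes all half turns look like the
first one.\<close>

lemma zero_of_perturbed_cos:
  fixes g g' :: "real \<Rightarrow> real" and n :: nat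
  defines "W \<equiv> \<lambda>t. (-1) ^ n * (cos t + g t * sin t)"
  assumes a: "a \<le> n * pi"
    and der: "\<And>t. n * pi \<le> t \<Longrightarrow> (g has_real_derivative g' t) (at t within {a..})"
    and neg: "\<And>t. n * pi \<le> t \<Longrightarrow> g t < 0"
    and small: "\<And>t. n * pi \<le> t \<Longrightarrow> \<bar>g t\<bar> \<le> 1/4" "\<And>t. n * pi \<le> t \<Longrightarrow> \<bar>g' t\<bar> \<le> 1/4"
  shows "\<exists>c. n * pi + pi/4 < c \<and> c < n * pi + pi/2 \<and> W c = 0 \<and>
    (\<forall>t. n * pi \<le> t \<and> t < c \<longrightarrow> 0 < W t) \<and>
    (\<forall>t. c < t \<and> t \<le> n * pi + pi \<longrightarrow> W t < 0)"
proof -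
  define b where "b = real n * pi"
  note a = a[folded b_def] and der = der[folded b_def] and small = small[folded b_def]
  have cs: "cos t = (-1) ^ n * cos (t - b)" "sin t = (-1) ^ n * sin (t - b)" for t
    by (simp_all add: b_def cos_diff sin_diff)
  have sq: "(-1) ^ n * ((-1) ^ n * v) = v" for v :: real
    by (simp flip: mult.assoc power_add power_mult_distrib)
  have W: "W t = cos (t - b) + g t * sin (t - b)" for t
    unfolding W_def cs[of t] by (simp add: distrib_left sq mult.left_commute[of "g t"])
  have small_mult: "\<bar>g t * v\<bar> \<le> \<bar>v\<bar> / 4" "\<bar>g' t * v\<bar> \<le> \<bar>v\<bar> / 4" if "b \<le> t" for t v
    unfolding abs_mult
    using mult_right_mono[OF small(1)[OF that], of "\<bar>v\<bar>"] mult_right_mono[OF small(2)[OF that], of "\<bar>v\<bar>"]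
    by auto
  have early: "0 < W t" if t: "b \<le> t" "t \<le> b + pi/4" for t
  proof -
    let ?s = "t - b"
    have c: "0 < cos ?s" "0 \<le> sin ?s" 
      by (rule cos_gt_zero_pi sin_ge_zero; use t pi_gt_zero in linarith)+
    have "- (pi/2) \<le> 2 * ?s" "2 * ?s \<le> pi/2"
      unfolding right_diff_distrib using t pi_gt_zero by linarith+
    then have "0 \<le> cos (2 * ?s)" by (rule cos_ge_zero)
    then have "(sin ?s)\<^sup>2 \<le> (cos ?s)\<^sup>2" unfolding cos_double by simp
    then have "sin ?s \<le> cos ?s" by (rule power2_le_imp_le) (use c in simp)
    then show ?thesis unfolding W using small_mult(1)[OF t(1), of "sin ?s"] c by linarith
  qed
  have late: "W t < 0" if t: "b + 3*pi/4 \<le> t" "t \<le> b + pi" for t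
  proof -
    let ?s = "t - b" and ?v = "t - b - pi"
    have tb: "b \<le> t" using t pi_gt_zero by linarith
    have "0 < cos ?v" by (intro cos_gt_zero_pi; use t pi_gt_zero in linarith)
    then have c: "cos ?s < 0" by (simp add: cos_diff[of "t - b" pi])
    have s: "0 \<le> sin ?s" by (intro sin_ge_zero; use t pi_gt_zero in linarith)
    have "- (pi/2) \<le> 2 * ?v" "2 * ?v \<le> pi/2"
      unfolding right_diff_distrib using t pi_gt_zero by linarith+
    then have "0 \<le> cos (2 * ?v)" by (rule cos_ge_zero)
    then have "(sin ?s)\<^sup>2 \<le> (- cos ?s)\<^sup>2"
      unfolding cos_double by (simp add: cos_diff[of "t - b" pi] sin_diff[of "t - b" pi])
    then have "sin ?s \<le> - cos ?s" by (rule power2_le_imp_le) (use c in simp)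
    then show ?thesis unfolding W using small_mult(1)[OF tb, of "sin ?s"] c s by linarith
  qed
  define W' where "W' t = (-1) ^ n * (- sin t + g' t * sin t + g t * cos t)" for t
  have W'_eq: "W' t = - sin (t - b) + g' t * sin (t - b) + g t * cos (t - b)" for t
    unfolding W'_def cs[of t]
    by (simp add: distrib_left right_diff_distrib sq mult.left_commute[of "g t"] mult.left_commute[of "g' t"])
  have W_deriv: "(W has_real_derivative W' t) (at t within {b..})" if "b \<le> t" for t
    unfolding W_def W'_def using that a
    by (auto intro!: derivative_eq_intros has_field_derivative_subset[OF der] simp: algebra_simps)
  have slope: "W' t < 0" if t: "b + pi/4 < t" "t < b + 3*pi/4" for t
  proof -
    let ?s = "t - b"
    have tb: "b \<le> t" using t pi_gt_zero by linarith
    have s: "0 < sin ?s" by (intro sin_gt_zero; use t pi_gt_zero in linarith)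
    have "- (pi/2) \<le> 2 * ?s - pi" "2 * ?s - pi \<le> pi/2"
      unfolding right_diff_distrib using t pi_gt_zero by linarith+
    then have "0 \<le> cos (2 * ?s - pi)" by (rule cos_ge_zero)
    then have "(cos ?s)\<^sup>2 \<le> (sin ?s)\<^sup>2"
      unfolding cos_diff[of "2 * ?s" pi] cos_double by simp
    then have "\<bar>cos ?s\<bar> \<le> sin ?s" using s by (simp flip: abs_le_square_iff)
    then show ?thesis unfolding W'_eq
      using small_mult(2)[OF tb, of "sin ?s"] small_mult(1)[OF tb, of "cos ?s"] s by linarith
  qed
  have decr: "W t < W s" if "b + pi/4 \<le> s" "s < t" "t \<le> b + 3*pi/4" for s t
  proof -
    have "- W s < - W t"
    proof (rule strictly_increasing_on_Ici[of b "\<lambda>t. - W t" "\<lambda>t. - W' t"])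
      show "((\<lambda>t. - W t) has_real_derivative - W' v) (at v within {b..})" if "b \<le> v" for v
        using W_deriv[OF that] by (rule DERIV_minus)
      show "b \<le> s" using that(1) pi_gt_zero by linarith
      show "0 < - W' v" if "s < v" "v < t" for v
        using slope[of v] that \<open>b + pi/4 \<le> s\<close> \<open>t \<le> b + 3*pi/4\<close> by simp
    qed fact
    then show ?thesis by simp
  qed
  have "continuous_on {b + pi/4..b + pi/2} W"
    using pi_gt_zero by (intro continuous_on_subset[OF DERIV_continuous_on[OF W_deriv]]) auto
  moreover have half: "W (b + pi/2) < 0"
    unfolding W using neg[folded b_def, of "b + pi/2"] pi_gt_zero by simp
  moreover have quarter: "0 < W (b + pi/4)" by (rule early) (use pi_gt_zero in auto)
  moreover have "b + pi/4 \<le> b + pi/2" using pi_gt_zero by simp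
  ultimately obtain c where c: "b + pi/4 \<le> c" "c \<le> b + pi/2" "W c = 0"
    using IVT2'[of W "b + pi/2" 0 "b + pi/4"] by auto
  moreover have "c \<noteq> b + pi/4" "c \<noteq> b + pi/2" using half quarter c(3) by auto
  moreover have "0 < W t" if "b \<le> t" "t < c" for t
    using early[of t] decr[of t c] that c pi_gt_zero by (cases "t \<le> b + pi/4") auto
  moreover have "W t < 0" if "c < t" "t \<le> b + pi" for t
    using late[of t] decr[of c t] that c pi_gt_zero by (cases "b + 3*pi/4 \<le> t") auto
  ultimately show ?thesis unfolding b_def by (intro exI[of _ c]) auto
qed

context damped_oscillation
begin

text \<open>By the factorisation of \<open>r'\<close> the radius grows precisely between the zeros
\<open>a\<close> of \<open>w1\<close> and \<open>b\<close> of \<open>w2\<close>. These are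
distinct because at a common zero \<open>q\<close> and \<open>h\<close> would agree; which of them
comes first depends on whether \<open>\<alpha> < 1\<close> or \<open>\<alpha> > 1\<close>, hence
the minimum and maximum in the proof.\<close>

lemma radius_increases_once_per_half_turn:
  assumes "\<alpha> \<noteq> 1"
  shows "\<forall>\<^sub>F b in at_top. \<forall>n::nat. b \<le> n * pi \<longrightarrow>
    (\<exists>l u. n * pi + pi/4 < l \<and> l < u \<and> u < n * pi + pi/2 \<and>
      (\<forall>t. n * pi \<le> t \<and> t \<le> l \<longrightarrow> r' t \<le> 0) \<and>
      (\<forall>t. l < t \<and> t < u \<longrightarrow> 0 < r' t) \<and>
      (\<forall>t. u < t \<and> t \<le> n * pi + pi \<longrightarrow> r' t < 0))"
proof -
  have small: "\<forall>\<^sub>F t in at_top. \<bar>f t\<bar> \<le> 1/4" if "(f \<longlongrightarrow> 0) at_top" for f :: "real \<Rightarrow> real"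
    using tendstoD[OF that, of "1/4"] by (auto elim: eventually_mono)
  have neg: "\<forall>\<^sub>F t in at_top. f t < 0" if "((\<lambda>t. t * f t) \<longlongrightarrow> L) at_top" "L < 0" for f :: "real \<Rightarrow> real" and L
    using order_tendstoD(2)[OF that] eventually_gt_at_top[of 0]
    by eventually_elim (simp add: mult_less_0_iff)
  have q_neg: "\<forall>\<^sub>F t in at_top. q t < 0" and h_neg: "\<forall>\<^sub>F t in at_top. h t < 0"
    using neg[OF q_lim] neg[OF h_lim] alpha_pos by auto
  have q'0: "((\<lambda>t. p2 t / p t - (q t)\<^sup>2) \<longlongrightarrow> 0) at_top"
    using tendsto_diff[OF p2_over_p_tendsto_0 tendsto_power[OF q_tendsto_0, of 2]] by simp
  have h'0: "((\<lambda>t. p3 t / p1 t / 2 - 2 * (h t)\<^sup>2) \<longlongrightarrow> 0) at_top"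
    using tendsto_diff[OF tendsto_divide[OF p3_over_p1_tendsto_0 tendsto_const[of 2]]
        tendsto_mult[OF tendsto_const[of 2] tendsto_power[OF h_tendsto_0, of 2]]] by simp
  have "\<forall>\<^sub>F t in at_top. t\<^sub>0 \<le> t \<and> p1 t < 0 \<and> h t \<noteq> q t \<and> q t < 0 \<and> h t < 0 \<and> \<bar>q t\<bar> \<le> 1/4 \<and> \<bar>h t\<bar> \<le> 1/4 \<and>
      \<bar>p2 t / p t - (q t)\<^sup>2\<bar> \<le> 1/4 \<and> \<bar>p3 t / p1 t / 2 - 2 * (h t)\<^sup>2\<bar> \<le> 1/4"
    by (intro eventually_conj eventually_ge_at_top p1_neg h_q_distinct assms small q_neg h_neg
        q_tendsto_0 h_tendsto_0 q'0 h'0)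
  then obtain B where B: "\<And>t. B \<le> t \<Longrightarrow> t\<^sub>0 \<le> t \<and> p1 t < 0 \<and> h t \<noteq> q t \<and> q t < 0 \<and> h t < 0 \<and> \<bar>q t\<bar> \<le> 1/4 \<and> \<bar>h t\<bar> \<le> 1/4 \<and>
      \<bar>p2 t / p t - (q t)\<^sup>2\<bar> \<le> 1/4 \<and> \<bar>p3 t / p1 t / 2 - 2 * (h t)\<^sup>2\<bar> \<le> 1/4"
    by (auto simp: eventually_at_top_linorder)
  have "\<exists>l u. n * pi + pi/4 < l \<and> l < u \<and> u < n * pi + pi/2 \<and>
      (\<forall>t. n * pi \<le> t \<and> t \<le> l \<longrightarrow> r' t \<le> 0) \<and>
      (\<forall>t. l < t \<and> t < u \<longrightarrow> 0 < r' t) \<and>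
      (\<forall>t. u < t \<and> t \<le> n * pi + pi \<longrightarrow> r' t < 0)" if n: "B \<le> n * pi" for n :: nat
  proof -
    define W1 where "W1 t = (-1) ^ n * w1 t" for t
    define W2 where "W2 t = (-1) ^ n * w2 t" for t
    have Bt: "B \<le> t" if "n * pi \<le> t" for t using n that by simp
    have "\<exists>c. n * pi + pi/4 < c \<and> c < n * pi + pi/2 \<and> W1 c = 0 \<and>
        (\<forall>t. n * pi \<le> t \<and> t < c \<longrightarrow> 0 < W1 t) \<and>
        (\<forall>t. c < t \<and> t \<le> n * pi + pi \<longrightarrow> W1 t < 0)"
      unfolding W1_def w1_def
    proof (rule zero_of_perturbed_cos)
      show "t\<^sub>0 \<le> n * pi" using B[OF n] by simp
      show "(q has_real_derivative (\<lambda>t. p2 t / p t - (q t)\<^sup>2) t) (at t within {t\<^sub>0..})" if "n * pi \<le> t" for t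
        using B[OF Bt[OF that]] q_deriv[of t] by simp
    qed (use B[OF Bt] in auto)
    then obtain a where a: "n * pi + pi/4 < a" "a < n * pi + pi/2" "W1 a = 0"
      "\<And>t. n * pi \<le> t \<Longrightarrow> t < a \<Longrightarrow> 0 < W1 t"
      "\<And>t. a < t \<Longrightarrow> t \<le> n * pi + pi \<Longrightarrow> W1 t < 0"
      by blast
    have "\<exists>c. n * pi + pi/4 < c \<and> c < n * pi + pi/2 \<and> W2 c = 0 \<and>
        (\<forall>t. n * pi \<le> t \<and> t < c \<longrightarrow> 0 < W2 t) \<and>
        (\<forall>t. c < t \<and> t \<le> n * pi + pi \<longrightarrow> W2 t < 0)"
      unfolding W2_def w2_def
    proof (rule zero_of_perturbed_cos)
      show "t\<^sub>0 \<le> n * pi" using B[OF n] by simp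
      show "(h has_real_derivative (\<lambda>t. p3 t / p1 t / 2 - 2 * (h t)\<^sup>2) t) (at t within {t\<^sub>0..})" if "n * pi \<le> t" for t
        using B[OF Bt[OF that]] h_deriv[of t] by simp
    qed (use B[OF Bt] in auto)
    then obtain b where b: "n * pi + pi/4 < b" "b < n * pi + pi/2" "W2 b = 0"
      "\<And>t. n * pi \<le> t \<Longrightarrow> t < b \<Longrightarrow> 0 < W2 t"
      "\<And>t. b < t \<Longrightarrow> t \<le> n * pi + pi \<Longrightarrow> W2 t < 0"
      by blast
    have r': "r' t = (2 * p t * - p1 t / r t) * - (W1 t * W2 t)"
      and pos: "0 < 2 * p t * - p1 t / r t" if "n * pi \<le> t" for t
    proof -
      note t = B[OF Bt[OF that]]
      have "W1 t * W2 t = w1 t * w2 t"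
        unfolding W1_def W2_def by (simp add: algebra_simps flip: power_add mult_2)
      then show "r' t = (2 * p t * - p1 t / r t) * - (W1 t * W2 t)" using r'_eq[of t] t by simp
      show "0 < 2 * p t * - p1 t / r t" using t p_pos[of t] r_pos[of t]
        by (intro divide_pos_pos mult_pos_pos) auto
    qed
    have neq: "a \<noteq> b"
    proof
      assume "a = b"
      then have "cos a + q a * sin a = cos a + h a * sin a"
        using a(3) b(3) by (simp add: W1_def W2_def w1_def w2_def)
      moreover have "sin a \<noteq> 0"
      proof
        assume "sin a = 0"
        moreover from this have "cos a = 0" using a(3) by (simp add: W1_def w1_def)
        ultimately show False by (metis sin_zero_abs_cos_one abs_zero zero_neq_one)
      qed
      ultimately show False using B[OF Bt, of a] a(1) pi_gt_zero by auto
    qed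
    have "0 < k * - v \<longleftrightarrow> v < 0" "k * - v < 0 \<longleftrightarrow> 0 < v" if "0 < k" for k v :: real
      using that by (simp_all add: zero_less_mult_iff mult_less_0_iff)
    then have sgn: "r' t > 0 \<longleftrightarrow> W1 t * W2 t < 0" "r' t < 0 \<longleftrightarrow> 0 < W1 t * W2 t" if "n * pi \<le> t" for t
      unfolding r'[OF that] using pos[OF that] by blast+
    define l u where "l = min a b" and "u = max a b"
    have lu: "n * pi + pi/4 < l" "l < u" "u < n * pi + pi/2"
      using a(1,2) b(1,2) neq by (auto simp: l_def u_def)
    moreover have "r' t \<le> 0" if "n * pi \<le> t" "t \<le> l" for t
    proof -
      have "0 \<le> W1 t" using a(3) a(4)[of t] that by (cases "t = a") (auto simp: l_def)
      moreover have "0 \<le> W2 t" using b(3) b(4)[of t] that by (cases "t = b") (auto simp: l_def)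
      ultimately show ?thesis using sgn(1)[OF that(1)] mult_nonneg_nonneg[of "W1 t" "W2 t"] by linarith
    qed
    moreover have "0 < r' t" if "l < t" "t < u" for t
    proof -
      have t: "n * pi \<le> t" "t \<le> n * pi + pi" using that lu pi_gt_zero by auto
      have "W1 t * W2 t < 0"
        using a(4,5)[of t] b(4,5)[of t] t that
        by (cases "a < b") (auto simp: l_def u_def mult_less_0_iff)
      then show ?thesis using sgn(1)[OF t(1)] by simp
    qed
    moreover have "r' t < 0" if "u < t" "t \<le> n * pi + pi" for t
    proof -
      have t: "n * pi \<le> t" using that lu pi_gt_zero by auto
      have "W1 t * W2 t > 0"
        using a(5)[of t] b(5)[of t] t that by (auto simp: u_def intro: mult_neg_neg)
      then show ?thesis using sgn(2)[OF t] by simp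
    qed
    ultimately show ?thesis by blast
  qed
  then show ?thesis
    using eventually_ge_at_top[of B] by (elim eventually_mono) (use order_trans in blast)
qed

end

section \<open>A criterion for wavy functions\<close>

lemma Inf_eq_left_endpoint:
  fixes S :: "real set"
  assumes "l < u" "{l<..<u} \<subseteq> S" "S \<subseteq> {l..}"
  shows "Inf S = l"
proof (rule antisym)
  have "Inf S \<le> Inf {l<..<u}"
    using assms by (intro cInf_superset_mono) (auto intro: bdd_belowI[of _ l])
  then show "Inf S \<le> l" using assms(1) by simp
  have "(l + u) / 2 \<in> S" using assms(1,2) by auto
  then show "l \<le> Inf S" using assms(3) by (intro cInf_greatest) auto
qed

lemma osc_le:
  fixes r :: "real \<Rightarrow> real"
  assumes "I \<noteq> {}" "\<And>t. t \<in> I \<Longrightarrow> \<bar>r t - v\<bar> \<le> d"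
  shows "0 \<le> osc r I" "osc r I \<le> 2 * d"
proof -
  have b: "v - d \<le> r t" "r t \<le> v + d" if "t \<in> I" for t
    using assms(2)[OF that] by (auto simp: abs_le_iff)
  have "(SUP t\<in>I. r t) \<le> v + d" "v - d \<le> (INF t\<in>I. r t)"
    using assms(1) b by (auto intro!: cSUP_least cINF_greatest)
  then show "osc r I \<le> 2 * d" by (simp add: osc_def)
  obtain t where t: "t \<in> I" using assms(1) by blast
  have "(INF t\<in>I. r t) \<le> r t" "r t \<le> (SUP t\<in>I. r t)"
    using t b by (auto intro!: cINF_lower cSUP_upper bdd_belowI2[of _ "v - d"] bdd_aboveI2[of _ _ "v + d"])
  then show "0 \<le> osc r I" by (simp add: osc_def)
qed

text \<open>The combinatorics of a wavy function, freed from the spiral: between consecutive marks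
\<open>c k\<close> the function falls until \<open>l k\<close>, rises until \<open>u k\<close> and
falls again to below its value at \<open>l k\<close>. The net fall forces the return to the value
at \<open>l k\<close> to happen before the next mark, so that the next rise is at least
\<open>\<epsilon>\<close> away. The oscillation over a rise is bounded crudely by the length of
the interval times the speed; this suffices because the speed is
\<open>O(t^(-\<beta>-1))\<close> and the definition only asks for
\<open>o(t^(-a-1))\<close> with an \<open>a\<close> that may be taken
below \<open>\<beta>\<close>.\<close>

locale wavy_pattern =
  fixes \<rho> \<rho>' :: "real \<Rightarrow> real" and c l u :: "nat \<Rightarrow> real" and \<epsilon> M K \<beta> :: real
  assumes pos: "\<And>t. c 0 \<le> t \<Longrightarrow> 0 < \<rho> t"
    and der: "\<And>t. c 0 \<le> t \<Longrightarrow> (\<rho> has_real_derivative \<rho>' t) (at t within {c 0..})"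
    and cont: "continuous_on {c 0..} \<rho>'"
    and c0: "0 < c 0" and eps: "0 < \<epsilon>"
    and cl: "\<And>k. c k + \<epsilon> \<le> l k" and lu: "\<And>k. l k < u k" and uc: "\<And>k. u k < c (Suc k)"
    and width: "\<And>k. c (Suc k) \<le> c k + M"
    and falls1: "\<And>k t. c k \<le> t \<Longrightarrow> t \<le> l k \<Longrightarrow> \<rho>' t \<le> 0"
    and rises: "\<And>k t. l k < t \<Longrightarrow> t < u k \<Longrightarrow> 0 < \<rho>' t"
    and falls2: "\<And>k t. u k < t \<Longrightarrow> t \<le> c (Suc k) \<Longrightarrow> \<rho>' t < 0"
    and net_fall: "\<And>k. \<rho> (c (Suc k)) < \<rho> (l k)"
    and beta: "0 < \<beta>"
    and slow: "\<And>t. c 0 \<le> t \<Longrightarrow> \<bar>\<rho>' t\<bar> \<le> K * t powr (- \<beta> - 1)"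
begin

lemma c_mono: "k \<le> m \<Longrightarrow> c k \<le> c m"
proof -
  assume "k \<le> m"
  moreover have "c k \<le> c (Suc k)" for k using cl[of k] lu[of k] uc[of k] eps by linarith
  ultimately show ?thesis by (rule lift_Suc_mono_le[rotated])
qed

lemma c0_le: "c 0 \<le> c k" "c 0 \<le> l k" "c 0 \<le> u k"
  using c_mono[of 0 k] cl[of k] lu[of k] eps by auto

lemma ex_return:
  "\<exists>v. u k < v \<and> v < c (Suc k) \<and> \<rho> v = \<rho> (l k) \<and> (\<forall>t. l k < t \<and> t < v \<longrightarrow> \<rho> t \<noteq> \<rho> (l k))"
proof -
  have up: "\<rho> (l k) < \<rho> t" if "l k < t" "t \<le> u k" for t
    using der c0_le that rises[of k]
    by (intro strictly_increasing_on_Ici[of "c 0" \<rho> \<rho>']) auto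
  have down: "\<rho> t < \<rho> s" if "u k \<le> s" "s < t" "t \<le> c (Suc k)" for s t
  proof -
    have "- \<rho> s < - \<rho> t"
      using der c0_le(3)[of k] that falls2[of k]
      by (intro strictly_increasing_on_Ici[of "c 0" "\<lambda>t. - \<rho> t" "\<lambda>t. - \<rho>' t"]) (auto intro!: DERIV_minus)
    then show ?thesis by simp
  qed
  have "continuous_on {u k..c (Suc k)} \<rho>"
    using c0_le(3)[of k] by (intro continuous_on_subset[OF DERIV_continuous_on[OF der]]) auto
  then have "\<exists>v\<ge>u k. v \<le> c (Suc k) \<and> \<rho> v = \<rho> (l k)"
    using up[of "u k"] lu[of k] net_fall[of k] uc[of k] by (intro IVT2') auto
  then obtain v where v: "u k \<le> v" "v \<le> c (Suc k)" "\<rho> v = \<rho> (l k)" by blast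
  have "v \<noteq> u k" using up[of "u k"] lu[of k] v(3) by auto
  moreover have "v \<noteq> c (Suc k)" using net_fall[of k] v(3) by auto
  moreover have "\<rho> t \<noteq> \<rho> (l k)" if "l k < t" "t < v" for t
    using up[of t] down[of t v] v that by (cases "t \<le> u k") auto
  ultimately show ?thesis using v by (intro exI[of _ v]) auto
qed

text \<open>The first time after \<open>l k\<close> at which the value at \<open>l k\<close> is
attained again.\<close>

definition "v k = (SOME v. u k < v \<and> v < c (Suc k) \<and> \<rho> v = \<rho> (l k) \<and>
  (\<forall>t. l k < t \<and> t < v \<longrightarrow> \<rho> t \<noteq> \<rho> (l k)))"

lemma v: "u k < v k" "v k < c (Suc k)" "\<rho> (v k) = \<rho> (l k)"
  "\<And>t. l k < t \<Longrightarrow> t < v k \<Longrightarrow> \<rho> t \<noteq> \<rho> (l k)"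
  using someI_ex[OF ex_return[of k]] unfolding v_def by blast+

definition "T m = (if m = 0 then c 0 else if even m then v (m div 2 - 1) else l (m div 2))"

lemma T_simps: "T 0 = c 0" "T (2 * k + 1) = l k" "T (2 * k + 2) = v k"
  by (simp_all add: T_def)

text \<open>The interval before a rise starts at the previous return, which lies before the mark
\<open>c k\<close> but after the previous rise.\<close>

lemma T_even: "c 0 \<le> T (2 * k)" "T (2 * k) \<le> c k" "\<And>t. T (2 * k) < t \<Longrightarrow> t \<le> l k \<Longrightarrow> \<rho>' t \<le> 0"
proof -
  have "c 0 \<le> T (2 * k) \<and> T (2 * k) \<le> c k \<and> (\<forall>t. T (2 * k) < t \<and> t \<le> l k \<longrightarrow> \<rho>' t \<le> 0)"
  proof (cases k)
    case 0
    then show ?thesis using falls1[of 0] by (auto simp: T_def)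
  next
    case (Suc j)
    then have T: "T (2 * k) = v j" by (simp add: T_def)
    have "\<rho>' t \<le> 0" if "v j < t" "t \<le> l k" for t
      using falls2[of j t] falls1[of k t] v(1)[of j] that Suc by (cases "t \<le> c k") auto
    then show ?thesis using v(1,2)[of j] c0_le(3)[of j] Suc unfolding T by auto
  qed
  then show "c 0 \<le> T (2 * k)" "T (2 * k) \<le> c k" "\<And>t. T (2 * k) < t \<Longrightarrow> t \<le> l k \<Longrightarrow> \<rho>' t \<le> 0"
    by auto
qed

lemma vd: "c 0 \<le> t \<Longrightarrow> vector_derivative \<rho> (at t within {c 0..}) = \<rho>' t"
  by (intro vector_derivative_within_Ici der)

lemma T_wavy_times: "wavy_times \<rho> (c 0) T"
proof -
  have rise_set: "{l k<..<u k} \<subseteq> {t. t > T (2 * k) \<and> vector_derivative \<rho> (at t within {c 0..}) > 0}"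
    "{t. t > T (2 * k) \<and> vector_derivative \<rho> (at t within {c 0..}) > 0} \<subseteq> {l k..}" for k
  proof -
    show "{l k<..<u k} \<subseteq> {t. t > T (2 * k) \<and> vector_derivative \<rho> (at t within {c 0..}) > 0}"
      using rises[of k] T_even(2)[of k] cl[of k] eps c0_le(2)[of k] by (auto simp: vd)
    show "{t. t > T (2 * k) \<and> vector_derivative \<rho> (at t within {c 0..}) > 0} \<subseteq> {l k..}"
    proof
      fix t assume t: "t \<in> {t. t > T (2 * k) \<and> vector_derivative \<rho> (at t within {c 0..}) > 0}"
      then have "0 < \<rho>' t" using T_even(1)[of k] vd[of t] by auto
      then show "t \<in> {l k..}" using T_even(3)[of k t] t by force
    qed
  qed
  have "{l k<..<u k} \<noteq> {}" for k using lu[of k] by simp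
  then have rise_nonempty:
    "{t. t > T (2 * k) \<and> vector_derivative \<rho> (at t within {c 0..}) > 0} \<noteq> {}" for k
    using rise_set(1)[of k] by blast
  have "Inf {t. t > l k \<and> \<rho> t = \<rho> (l k)} = v k" "v k \<in> {t. t > l k \<and> \<rho> t = \<rho> (l k)}" for k
    using v[of k] lu[of k] by (auto intro!: cInf_eq_minimum leI)
  then have "{t. t > l k \<and> \<rho> t = \<rho> (l k)} \<noteq> {} \<and> v k = Inf {t. t > l k \<and> \<rho> t = \<rho> (l k)}" for k
    by (metis empty_iff)
  moreover have "l k = Inf {t. t > T (2 * k) \<and> vector_derivative \<rho> (at t within {c 0..}) > 0}" for k
    using Inf_eq_left_endpoint[OF lu rise_set] by simp
  ultimately show ?thesis
    using rise_nonempty unfolding wavy_times_def Let_def T_simps by blast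
qed

lemma T_strict_mono: "strict_mono T"
proof (subst strict_mono_Suc_iff, intro allI)
  fix m :: nat
  consider k where "m = 2 * k" | k where "m = 2 * k + 1" by (metis oddE evenE)
  then show "T m < T (Suc m)"
  proof cases
    case 1
    then show ?thesis using T_even(2)[of k] cl[of k] eps T_simps(2)[of k] by simp
  next
    case 2
    then have "T m = l k" "T (Suc m) = v k" using T_simps(2,3)[of k] by auto
    then show ?thesis using v(1)[of k] lu[of k] by simp
  qed
qed

lemma l_at_top: "filterlim l at_top sequentially"
proof -
  have c_lower: "c 0 + real k * \<epsilon> \<le> c k" for k
  proof (induction k)
    case (Suc k)
    then show ?case using cl[of k] lu[of k] uc[of k] by (simp add: algebra_simps)
  qed simp
  have "filterlim (\<lambda>k. c 0 + real k * \<epsilon>) at_top sequentially"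
    by (intro filterlim_tendsto_add_at_top[OF tendsto_const]
        filterlim_at_top_mult_tendsto_pos[OF tendsto_const eps filterlim_real_sequentially])
  then show ?thesis
  proof (rule filterlim_at_top_mono)
    show "\<forall>\<^sub>F k in sequentially. c 0 + real k * \<epsilon> \<le> l k"
    proof (intro always_eventually allI)
      show "c 0 + real k * \<epsilon> \<le> l k" for k using c_lower[of k] cl[of k] eps by linarith
    qed
  qed
qed

lemma T_at_top: "filterlim T at_top sequentially"
proof (subst filterlim_at_top, intro allI)
  fix Z
  have "\<forall>\<^sub>F k in sequentially. Z \<le> l k" using l_at_top by (simp add: filterlim_at_top)
  then obtain k where "Z \<le> l k" by (auto simp: eventually_sequentially)
  then have "Z \<le> T (2 * k + 1)" unfolding T_simps .
  then have "Z \<le> T m" if "2 * k + 1 \<le> m" for m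
    using strict_mono_less_eq[OF T_strict_mono, of "2 * k + 1" m] that by linarith
  then show "\<forall>\<^sub>F m in sequentially. Z \<le> T m" by (auto simp: eventually_sequentially)
qed

lemma osc_between_T:
  "0 \<le> osc \<rho> {l k..v k}" "osc \<rho> {l k..v k} \<le> 2 * (M * \<bar>K\<bar> * l k powr (- \<beta> - 1))"
proof -
  let ?B = "\<bar>K\<bar> * l k powr (- \<beta> - 1)"
  have lpos: "0 < l k" using c0_le(2)[of k] c0 by linarith
  have M: "v k - l k \<le> M" using v(2)[of k] width[of k] cl[of k] eps by linarith
  have *: "\<bar>\<rho> t - \<rho> (l k)\<bar> \<le> M * ?B" if t: "t \<in> {l k..v k}" for t
  proof -
    have "\<bar>\<rho> t - \<rho> (l k)\<bar> \<le> ?B * t - ?B * l k"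
    proof (rule increment_bounded_by_majorant[where a = "c 0" and g' = "\<lambda>_. ?B"])
      fix s assume s: "l k < s" "s < t"
      have "s powr (- \<beta> - 1) \<le> l k powr (- \<beta> - 1)"
        using s lpos beta by (intro powr_mono2') auto
      then have "K * s powr (- \<beta> - 1) \<le> \<bar>K\<bar> * l k powr (- \<beta> - 1)" by (intro mult_mono) auto
      then show "\<bar>\<rho>' s\<bar> \<le> ?B" using slow[of s] s c0_le(2)[of k] by simp
    qed (use t c0_le(2)[of k] in \<open>auto intro!: der derivative_eq_intros\<close>)
    also have "\<dots> = (t - l k) * ?B" by (simp add: algebra_simps)
    also have "\<dots> \<le> M * ?B" using t M by (intro mult_right_mono) auto
    finally show ?thesis .
  qed
  from osc_le[of "{l k..v k}" \<rho> "\<rho> (l k)", OF _ *] show "0 \<le> osc \<rho> {l k..v k}" "osc \<rho> {l k..v k} \<le> 2 * (M * \<bar>K\<bar> * l k powr (- \<beta> - 1))"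
    using v(1)[of k] lu[of k] by (auto simp: mult.assoc)
qed

theorem wavy: "wavy_function \<rho> (c 0)"
proof -
  define a where "a = min \<beta> 1 / 2"
  have a: "0 < a" "a < 1" "a < \<beta>" using beta by (auto simp: a_def min_def)
  have "(\<lambda>k. osc \<rho> {l k..v k}) \<in> O(\<lambda>k. l k powr (- \<beta> - 1))"
    using osc_between_T
    by (intro bigoI[where c = "2 * (M * \<bar>K\<bar>)"] always_eventually allI) (simp add: mult.assoc)
  also have "(\<lambda>k. l k powr (- \<beta> - 1)) \<in> o(\<lambda>k. l k powr (- a - 1))"
    using a(3) l_at_top by (subst powr_smallo_iff) auto
  finally have small: "(\<lambda>k. osc \<rho> {T (2 * k + 1)..T (2 * k + 2)}) \<in> o(\<lambda>k. T (2 * k + 1) powr (- a - 1))"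
    unfolding T_simps .
  have "Ck_on 1 \<rho> {c 0..}"
    unfolding Ck_on_def using der cont by (intro exI[of _ "\<lambda>j. if j = 0 then \<rho> else \<rho>'"]) auto
  moreover have "vector_derivative \<rho> (at (c 0) within {c 0..}) \<le> 0"
    using falls1[of 0 "c 0"] cl[of 0] eps by (simp add: vd)
  moreover have "\<epsilon> \<le> T (2 * k + 1) - T (2 * k)" for k
    unfolding T_simps using T_even(2)[of k] cl[of k] by linarith
  ultimately show ?thesis
    unfolding wavy_function_def
    using pos T_wavy_times T_strict_mono T_at_top eps small a(1,2) by blast
qed

end

section \<open>The polar angle\<close>

context damped_oscillation
begin

text \<open>The angle is an antiderivative of the angular velocity: writing the curve as a complex
number \<open>w\<close>, the logarithmic derivative of \<open>w\<close> is \<open>r'/r + i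
\<omega>\<close>, so \<open>w e^(-i\<phi>) / r\<close> has derivative zero, and
the constant of integration is chosen to make it 1. Its real and imaginary parts are the functions
\<open>A\<close> and \<open>B\<close> of the proof.\<close>

lemma ex_polar_angle:
  "\<exists>\<phi>. \<forall>t\<ge>t\<^sub>0. (\<phi> has_real_derivative \<omega> t) (at t within {t\<^sub>0..}) \<and>
     x t = r t * cos (\<phi> t) \<and> y t = r t * sin (\<phi> t)"
proof -
  obtain G where G: "\<And>t. t\<^sub>0 \<le> t \<Longrightarrow> (G has_real_derivative \<omega> t) (at t within {t\<^sub>0..})"
    using continuous_on_Ici_antiderivative[OF continuous_omega] by blast
  have "(x t\<^sub>0 / r t\<^sub>0)\<^sup>2 + (y t\<^sub>0 / r t\<^sub>0)\<^sup>2 = 1"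
    unfolding power_divide add_divide_distrib[symmetric] r_square[symmetric]
    using r_pos[of t\<^sub>0] by simp
  then obtain \<theta> where \<theta>: "x t\<^sub>0 / r t\<^sub>0 = cos \<theta>" "y t\<^sub>0 / r t\<^sub>0 = sin \<theta>"
    by (rule sincos_total_2pi)
  define \<phi> where "\<phi> t = G t - G t\<^sub>0 + \<theta>" for t
  have \<phi>: "(\<phi> has_real_derivative \<omega> t) (at t within {t\<^sub>0..})" if "t\<^sub>0 \<le> t" for t
    unfolding \<phi>_def[abs_def] using that by (auto intro!: derivative_eq_intros G)
  define A where "A t = (x t * cos (\<phi> t) + y t * sin (\<phi> t)) / r t" for t
  define B where "B t = (y t * cos (\<phi> t) - x t * sin (\<phi> t)) / r t" for t
  have A_deriv: "(A has_real_derivative 0) (at t within {t\<^sub>0..})"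
    and B_deriv: "(B has_real_derivative 0) (at t within {t\<^sub>0..})" if t: "t\<^sub>0 \<le> t" for t
  proof -
    let ?c = "cos (\<phi> t)" and ?s = "sin (\<phi> t)" and ?R = "(x t)\<^sup>2 + (y t)\<^sup>2"
    have R: "?R \<noteq> 0" "r t \<noteq> 0" using xy_nonzero[OF t] r_pos[OF t] by auto
    have om: "\<omega> t * ?R = x t * z t - (y t)\<^sup>2" unfolding \<omega>_def using R by simp
    have rr: "r' t * r t = y t * (x t + z t)" "r t * r t = ?R"
      unfolding r'_def using R r_square[of t] by (simp_all add: power2_eq_square)
    define nA where "nA = y t * ?c + z t * ?s + \<omega> t * (y t * ?c - x t * ?s)"
    define nB where "nB = z t * ?c - y t * ?s - \<omega> t * (y t * ?s + x t * ?c)"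
    have "?R * (nA * r t) = r t * (?R * (y t * ?c + z t * ?s) + (\<omega> t * ?R) * (y t * ?c - x t * ?s))"
      unfolding nA_def by (simp add: algebra_simps)
    also have "\<dots> = r t * ((y t * (x t + z t)) * (x t * ?c + y t * ?s))"
      unfolding om by (simp add: algebra_simps power2_eq_square)
    also have "\<dots> = ?R * ((x t * ?c + y t * ?s) * r' t)"
      unfolding rr(1)[symmetric] rr(2)[symmetric] by (simp add: algebra_simps)
    finally have nA: "nA * r t - (x t * ?c + y t * ?s) * r' t = 0" using R by auto
    have "?R * (nB * r t) = r t * (?R * (z t * ?c - y t * ?s) - (\<omega> t * ?R) * (y t * ?s + x t * ?c))"
      unfolding nB_def by (simp add: algebra_simps)
    also have "\<dots> = r t * ((y t * (x t + z t)) * (y t * ?c - x t * ?s))"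
      unfolding om by (simp add: algebra_simps power2_eq_square)
    also have "\<dots> = ?R * ((y t * ?c - x t * ?s) * r' t)"
      unfolding rr(1)[symmetric] rr(2)[symmetric] by (simp add: algebra_simps)
    finally have nB: "nB * r t - (y t * ?c - x t * ?s) * r' t = 0" using R by auto
    have "((\<lambda>t. x t * cos (\<phi> t) + y t * sin (\<phi> t)) has_real_derivative nA) (at t within {t\<^sub>0..})"
      unfolding nA_def
      by (auto intro!: derivative_eq_intros x_deriv y_deriv \<phi> t simp: algebra_simps)
    from DERIV_divide[OF this r_deriv[OF t] R(2)] show "(A has_real_derivative 0) (at t within {t\<^sub>0..})"
      unfolding A_def[abs_def] nA by simp
    have "((\<lambda>t. y t * cos (\<phi> t) - x t * sin (\<phi> t)) has_real_derivative nB) (at t within {t\<^sub>0..})"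
      unfolding nB_def
      by (auto intro!: derivative_eq_intros x_deriv y_deriv \<phi> t simp: algebra_simps)
    from DERIV_divide[OF this r_deriv[OF t] R(2)] show "(B has_real_derivative 0) (at t within {t\<^sub>0..})"
      unfolding B_def[abs_def] nB by simp
  qed
  have A0: "A t\<^sub>0 = 1" and B0: "B t\<^sub>0 = 0"
  proof -
    have xy: "x t\<^sub>0 = r t\<^sub>0 * cos \<theta>" "y t\<^sub>0 = r t\<^sub>0 * sin \<theta>"
      using \<theta> r_pos[of t\<^sub>0] by (auto simp: field_simps)
    have "x t\<^sub>0 * cos \<theta> + y t\<^sub>0 * sin \<theta> = r t\<^sub>0 * ((sin \<theta>)\<^sup>2 + (cos \<theta>)\<^sup>2)"
      unfolding xy by algebra
    then show "A t\<^sub>0 = 1" using r_pos[of t\<^sub>0] unfolding A_def \<phi>_def by simp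
    show "B t\<^sub>0 = 0" unfolding B_def \<phi>_def by (simp add: xy)
  qed
  have "\<exists>k. \<forall>t\<in>{t\<^sub>0..}. A t = k" "\<exists>k. \<forall>t\<in>{t\<^sub>0..}. B t = k"
    by (rule has_field_derivative_zero_constant; use A_deriv B_deriv in simp)+
  then have AB: "A t = 1" "B t = 0" if "t\<^sub>0 \<le> t" for t
    using A0 B0 that by (metis atLeast_iff order_refl)+
  have "x t = r t * cos (\<phi> t) \<and> y t = r t * sin (\<phi> t)" if t: "t\<^sub>0 \<le> t" for t
  proof -
    let ?c = "cos (\<phi> t)" and ?s = "sin (\<phi> t)"
    have 1: "x t * ?c + y t * ?s = r t" "y t * ?c - x t * ?s = 0"
      using AB[OF t] r_pos[OF t] unfolding A_def B_def by (auto simp: field_simps)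
    have "x t * ((sin (\<phi> t))\<^sup>2 + (cos (\<phi> t))\<^sup>2) = (x t * ?c + y t * ?s) * ?c - (y t * ?c - x t * ?s) * ?s"
      by algebra
    moreover have "y t * ((sin (\<phi> t))\<^sup>2 + (cos (\<phi> t))\<^sup>2) = (x t * ?c + y t * ?s) * ?s + (y t * ?c - x t * ?s) * ?c"
      by algebra
    ultimately show ?thesis unfolding 1 by simp
  qed
  then show ?thesis using \<phi> by blast
qed

text \<open>These properties determine the angle on the time axis up to a constant multiple of
\<open>2 \<pi>\<close>.\<close>

definition angle :: "real \<Rightarrow> real" where
  "angle = (SOME \<phi>. \<forall>t\<ge>t\<^sub>0. (\<phi> has_real_derivative \<omega> t) (at t within {t\<^sub>0..}) \<and>
     x t = r t * cos (\<phi> t) \<and> y t = r t * sin (\<phi> t))"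

lemma
  assumes "t\<^sub>0 \<le> t"
  shows angle_deriv: "(angle has_real_derivative \<omega> t) (at t within {t\<^sub>0..})"
    and x_polar: "x t = r t * cos (angle t)" and y_polar: "y t = r t * sin (angle t)"
  using someI_ex[OF ex_polar_angle] assms unfolding angle_def by blast+

lemma continuous_angle: "continuous_on {t\<^sub>0..} angle"
  using angle_deriv by (auto intro!: DERIV_continuous_on)

lemma x_zero_iff: "t\<^sub>0 \<le> t \<Longrightarrow> x t = 0 \<longleftrightarrow> sin t = 0"
  using p_pos[of t] by (simp add: x_def)

text \<open>A phase angle is tied to the curve only where \<open>x \<noteq> 0\<close>; density
extends the relation by continuity to all times.\<close>

lemma nonzero_times_dense: "{t\<^sub>0..} \<subseteq> closure {t\<in>{t\<^sub>0..}. x t \<noteq> 0}"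
proof
  fix t assume t: "t \<in> {t\<^sub>0..}"
  show "t \<in> closure {t\<in>{t\<^sub>0..}. x t \<noteq> 0}"
  proof (cases "sin t = 0")
    case False
    then show ?thesis using t by (intro subsetD[OF closure_subset]) (simp add: x_zero_iff)
  next
    case True
    then have c: "cos t \<noteq> 0" by (metis sin_zero_abs_cos_one abs_zero zero_neq_one)
    show ?thesis unfolding closure_approachable
    proof (intro allI impI)
      fix e :: real assume "0 < e"
      define d where "d = min (e / 2) 1"
      have d: "0 < d" "d < e" "d < pi" using \<open>0 < e\<close> pi_gt3 by (auto simp: d_def min_def)
      have "sin (t + d) \<noteq> 0" using True c sin_gt_zero[of d] d by (simp add: sin_add)
      then show "\<exists>s\<in>{t\<in>{t\<^sub>0..}. x t \<noteq> 0}. dist s t < e"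
        using t d by (intro bexI[of _ "t + d"]) (auto simp: x_zero_iff dist_real_def)
    qed
  qed
qed

text \<open>The tangent condition says that \<open>sin (angle - \<psi>)\<close> vanishes, so
\<open>(angle - \<psi>) / \<pi>\<close> is continuous and integer-valued, hence constant.\<close>

lemma phase_angle_unique:
  assumes cont: "continuous_on {t\<^sub>0..} \<psi>"
    and tan: "\<And>t. t\<^sub>0 \<le> t \<Longrightarrow> x t \<noteq> 0 \<Longrightarrow> cos (\<psi> t) \<noteq> 0 \<and> tan (\<psi> t) = y t / x t"
  shows "\<exists>m::int. \<forall>t\<ge>t\<^sub>0. angle t = \<psi> t + of_int m * pi"
proof -
  define S where "S t = sin (angle t - \<psi> t)" for t
  have S_cont: "continuous_on {t\<^sub>0..} S"
    unfolding S_def[abs_def] by (intro continuous_intros cont continuous_angle)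
  have S0: "S t = 0" if "t \<in> {t\<in>{t\<^sub>0..}. x t \<noteq> 0}" for t
  proof -
    have t: "t\<^sub>0 \<le> t" "x t \<noteq> 0" using that by auto
    have "x t * sin (\<psi> t) = y t * cos (\<psi> t)"
      using tan[OF t] t(2) by (auto simp: tan_def field_simps)
    then have "r t * S t = 0"
      unfolding S_def sin_diff by (auto simp: x_polar[OF t(1)] y_polar[OF t(1)] algebra_simps)
    then show ?thesis using r_pos[OF t(1)] by simp
  qed
  have "closure {t\<in>{t\<^sub>0..}. x t \<noteq> 0} \<subseteq> {t\<^sub>0..}" by (rule closure_minimal) auto
  then have "S t = 0" if "t\<^sub>0 \<le> t" for t
    using continuous_constant_on_closure[OF continuous_on_subset[OF S_cont], OF _ S0] nonzero_times_dense that
    by blast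
  then have int: "\<exists>i::int. angle t - \<psi> t = of_int i * pi" if "t\<^sub>0 \<le> t" for t
    using that by (simp add: S_def sin_zero_iff_int2)
  define g where "g t = (angle t - \<psi> t) / pi" for t
  have g_int: "g t \<in> \<int>" if "t\<^sub>0 \<le> t" for t using int[OF that] by (auto simp: g_def)
  have "g constant_on {t\<^sub>0..}"
  proof (rule continuous_discrete_range_constant)
    show "continuous_on {t\<^sub>0..} g"
      unfolding g_def[abs_def] by (intro continuous_intros cont continuous_angle) simp
    show "\<exists>e>0. \<forall>y. y \<in> {t\<^sub>0..} \<and> g y \<noteq> g x \<longrightarrow> e \<le> norm (g y - g x)" if "x \<in> {t\<^sub>0..}" for x
    proof (intro exI[of _ 1] conjI allI impI)
      fix y assume y: "y \<in> {t\<^sub>0..} \<and> g y \<noteq> g x"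
      then have "g y - g x \<in> \<int>" "g y - g x \<noteq> 0" using g_int that by auto
      then show "1 \<le> norm (g y - g x)" by (simp add: Ints_nonzero_abs_ge1)
    qed simp
  qed simp
  then obtain k where k: "\<And>t. t\<^sub>0 \<le> t \<Longrightarrow> g t = k" by (auto simp: constant_on_def)
  obtain m :: int where "k = of_int m" using g_int[of t\<^sub>0] k[of t\<^sub>0] by (auto elim!: Ints_cases)
  then have "\<forall>t\<ge>t\<^sub>0. angle t = \<psi> t + of_int m * pi"
    using k by (auto simp: g_def field_simps)
  then show ?thesis ..
qed

end

section \<open>The trajectory as a wavy spiral\<close>

context damped_oscillation
begin

lemma angular_speed_bound: "\<forall>\<^sub>F t in at_top. \<bar>\<omega> t + 1\<bar> \<le> 1/2"
  using tendstoD[OF omega_tendsto, of "1/2"] by (auto simp: dist_real_def elim: eventually_mono)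

lemma angle_change:
  assumes b: "t\<^sub>0 \<le> b" "\<And>t. b \<le> t \<Longrightarrow> \<bar>\<omega> t + 1\<bar> \<le> 1/2" and "b \<le> s" "s \<le> t"
  shows "(t - s) / 2 \<le> angle s - angle t" "angle s - angle t \<le> 3/2 * (t - s)"
proof -
  have "\<bar>(angle t + t) - (angle s + s)\<bar> \<le> t / 2 - s / 2"
  proof (rule increment_bounded_by_majorant[where a = t\<^sub>0 and f' = "\<lambda>u. \<omega> u + 1" and g' = "\<lambda>_. 1/2"])
    show "((\<lambda>u. angle u + u) has_real_derivative \<omega> u + 1) (at u within {t\<^sub>0..})" if "t\<^sub>0 \<le> u" for u
      using that by (auto intro!: derivative_eq_intros angle_deriv)
    show "((\<lambda>u. u / 2) has_real_derivative 1/2) (at u within {t\<^sub>0..})" for u :: real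
      by (auto intro!: derivative_eq_intros)
    show "\<bar>\<omega> u + 1\<bar> \<le> 1/2" if "s < u" for u using b(2)[of u] that \<open>b \<le> s\<close> by simp
  qed (use assms in auto)
  then show "(t - s) / 2 \<le> angle s - angle t" "angle s - angle t \<le> 3/2 * (t - s)"
    unfolding diff_divide_distrib right_diff_distrib by linarith+
qed

lemma angle_linear: "\<forall>\<^sub>F t in at_top. angle t \<le> - t / 4 \<and> - 2 * t \<le> angle t"
proof -
  obtain b where b: "t\<^sub>0 \<le> b" "\<And>t. b \<le> t \<Longrightarrow> \<bar>\<omega> t + 1\<bar> \<le> 1/2"
    using eventually_conj[OF eventually_ge_at_top[of t\<^sub>0] angular_speed_bound]
    unfolding eventually_at_top_linorder by blast
  have "angle t \<le> - t / 4 \<and> - 2 * t \<le> angle t" if "b + 4 * \<bar>angle b\<bar> + 4 * \<bar>b\<bar> \<le> t" for t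
  proof -
    have bt: "b \<le> t" using that by linarith
    note c = angle_change[OF b order_refl bt]
    show ?thesis
      using c[unfolded diff_divide_distrib right_diff_distrib] that b(1) t0_pos
      by (intro conjI; linarith)
  qed
  then show ?thesis unfolding eventually_at_top_linorder by blast
qed

text \<open>From time \<open>b\<close> on the curve turns clockwise at a speed between 1/2 and
3/2, so a full turn takes between \<open>4 \<pi> / 3 > 3/2\<close> and \<open>4 \<pi> <
16\<close>, and the radius falls over such spans. The angle at \<open>b\<close> is negative
because a spiral for angles tending to \<open>-\<infinity>\<close> lives on negative
angles.\<close>

definition "settled b \<longleftrightarrow> t\<^sub>0 \<le> b \<and> angle b < 0 \<and> (\<forall>t\<ge>b. \<bar>\<omega> t + 1\<bar> \<le> 1/2) \<and>
  (\<forall>t\<ge>b. \<forall>s. t + 3/2 \<le> s \<and> s \<le> t + 16 \<longrightarrow> r s < r t)"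

lemma eventually_all_later:
  fixes P :: "real \<Rightarrow> bool"
  assumes "\<forall>\<^sub>F t in at_top. P t"
  shows "\<forall>\<^sub>F b in at_top. \<forall>t\<ge>b. P t"
  using assms unfolding eventually_at_top_linorder by (meson order_trans)

lemma eventually_settled: "\<forall>\<^sub>F b in at_top. settled b"
  using eventually_ge_at_top[of t\<^sub>0] angle_linear eventually_all_later[OF angular_speed_bound]
    eventually_all_later[OF radius_falls] eventually_gt_at_top[of 0]
  unfolding settled_def by eventually_elim auto

text \<open>The spiral as a graph over the angle, obtained by inverting the strictly decreasing
angle on \<open>[b, \<infinity>)\<close>.\<close>

definition "time_at b \<theta> = inv_into {b..} angle \<theta>"
definition "radius_at b \<theta> = r (time_at b \<theta>)"

context
  fixes b :: real
  assumes b: "settled b"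
begin

lemma b_ge: "t\<^sub>0 \<le> b" and angle_b: "angle b < 0"
  using b by (auto simp: settled_def)

lemma falls: "b \<le> t \<Longrightarrow> t + 3/2 \<le> s \<Longrightarrow> s \<le> t + 16 \<Longrightarrow> r s < r t"
  using b unfolding settled_def by blast

lemma angle_change':
  assumes "b \<le> s" "s \<le> t"
  shows "(t - s) / 2 \<le> angle s - angle t" "angle s - angle t \<le> 3/2 * (t - s)"
  using angle_change[OF b_ge _ assms] b unfolding settled_def by blast+

lemma angle_strict_antimono: "strict_antimono_on {b..} angle"
proof (rule monotone_onI)
  show "angle s > angle t" if "s \<in> {b..}" "t \<in> {b..}" "s < t" for s t
    using angle_change'(1)[of s t] that by simp
qed

lemma angle_inj: "inj_on angle {b..}"
proof (rule linorder_inj_onI)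
  show "angle s \<noteq> angle t" if "s < t" "s \<in> {b..}" "t \<in> {b..}" for s t
    using angle_change'(1)[of s t] that by simp
qed auto

lemma angle_image: "angle ` {b..} = {..angle b}"
proof (intro equalityI subsetI)
  fix \<theta> assume "\<theta> \<in> angle ` {b..}"
  then obtain t where "b \<le> t" "\<theta> = angle t" by auto
  then show "\<theta> \<in> {..angle b}" using angle_change'(1)[of b t] by simp
next
  fix \<theta> assume \<theta>: "\<theta> \<in> {..angle b}"
  define t where "t = b + 2 * (angle b - \<theta>)"
  have t: "b \<le> t" using \<theta> by (simp add: t_def)
  then have "angle t \<le> \<theta>" using angle_change'(1)[of b t] by (simp add: t_def)
  moreover have "continuous_on {b..t} angle"
    using b_ge by (intro continuous_on_subset[OF continuous_angle]) auto
  ultimately obtain s where "b \<le> s" "angle s = \<theta>"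
    using IVT2'[of angle t \<theta> b] t \<theta> by auto
  then show "\<theta> \<in> angle ` {b..}" by auto
qed

lemma time_at:
  assumes "\<theta> \<le> angle b"
  shows "b \<le> time_at b \<theta>" "angle (time_at b \<theta>) = \<theta>"
  using inv_into_into[of \<theta> angle "{b..}"] f_inv_into_f[of \<theta> angle "{b..}"] angle_image assms
  by (auto simp: time_at_def)

lemma time_at_angle: "b \<le> t \<Longrightarrow> time_at b (angle t) = t"
  unfolding time_at_def by (rule inv_into_f_f[OF angle_inj]) simp

lemma radius_at_angle: "b \<le> t \<Longrightarrow> radius_at b (angle t) = r t"
  by (simp add: radius_at_def time_at_angle)

lemma time_at_ge: "b \<le> t \<Longrightarrow> \<theta> \<le> angle t \<Longrightarrow> t \<le> time_at b \<theta>"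
proof (rule ccontr)
  assume t: "b \<le> t" "\<theta> \<le> angle t" "\<not> t \<le> time_at b \<theta>"
  have \<theta>: "\<theta> \<le> angle b" using angle_change'(1)[of b t] t by simp
  show False using angle_change'(1)[of "time_at b \<theta>" t] time_at[OF \<theta>] t by simp
qed

lemma time_at_turn:
  assumes "\<theta> \<le> angle b"
  shows "time_at b \<theta> + 3/2 \<le> time_at b (\<theta> - 2 * pi)" "time_at b (\<theta> - 2 * pi) \<le> time_at b \<theta> + 16"
proof -
  have \<theta>': "\<theta> - 2 * pi \<le> angle b" using assms pi_gt_zero by linarith
  have le: "time_at b \<theta> \<le> time_at b (\<theta> - 2 * pi)"
    by (rule time_at_ge) (use time_at[OF assms] in simp_all)
  define d where "d = time_at b (\<theta> - 2 * pi) - time_at b \<theta>"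
  have "2 * pi \<le> 3/2 * d" "d / 2 \<le> 2 * pi"
    using angle_change'[OF time_at(1)[OF assms] le] time_at(2)[OF assms] time_at(2)[OF \<theta>']
    by (auto simp: d_def)
  then have "3/2 \<le> d" "d \<le> 16" using pi_gt3 pi_less_4 by linarith+
  then show "time_at b \<theta> + 3/2 \<le> time_at b (\<theta> - 2 * pi)" "time_at b (\<theta> - 2 * pi) \<le> time_at b \<theta> + 16"
    unfolding d_def by linarith+
qed

lemma time_at_at_top: "filterlim (time_at b) at_top at_bot"
proof (subst filterlim_at_top, intro allI)
  fix Z
  have "Z \<le> time_at b \<theta>" if "\<theta> \<le> angle (max b Z)" for \<theta>
    using time_at_ge[OF _ that] by simp
  then show "\<forall>\<^sub>F \<theta> in at_bot. Z \<le> time_at b \<theta>"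
    unfolding eventually_at_bot_linorder by blast
qed

lemma r_tendsto_0: "(r \<longlongrightarrow> 0) at_top"
  by (rule tendsto_zero_if_powr_tendsto[OF r_lim alpha_pos])

lemma radius_at_spiral: "spiral (radius_at b) {..angle b}"
proof -
  have "pos_spiral (\<lambda>\<phi>. radius_at b (- \<phi>)) (- angle b)"
    unfolding pos_spiral_def
  proof (intro conjI allI impI)
    show "0 < - angle b" using angle_b by simp
    show "0 < radius_at b (- \<phi>)" if "- angle b \<le> \<phi>" for \<phi>
      using time_at(1)[of "- \<phi>"] b_ge that unfolding radius_at_def by (intro r_pos) simp
    have "(radius_at b \<longlongrightarrow> 0) at_bot"
      unfolding radius_at_def[abs_def] by (rule filterlim_compose[OF r_tendsto_0 time_at_at_top])
    then show "((\<lambda>\<phi>. radius_at b (- \<phi>)) \<longlongrightarrow> 0) at_top"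
      by (rule filterlim_compose) (rule filterlim_uminus_at_bot_at_top)
    show "radius_at b (- (\<phi> + 2 * real (Suc k) * pi)) < radius_at b (- (\<phi> + 2 * real k * pi))"
      if "- angle b \<le> \<phi>" for \<phi> k
    proof -
      let ?\<theta> = "- (\<phi> + 2 * real k * pi)"
      have "0 \<le> 2 * real k * pi" by simp
      then have \<theta>: "?\<theta> \<le> angle b" using that by linarith
      have next_turn: "- (\<phi> + 2 * real (Suc k) * pi) = ?\<theta> - 2 * pi" by (simp add: algebra_simps)
      show ?thesis
        unfolding radius_at_def next_turn by (rule falls[OF time_at(1)[OF \<theta>] time_at_turn[OF \<theta>]])
    qed
  qed
  then show ?thesis unfolding spiral_def by blast
qed

lemma traj_polar:
  assumes "b \<le> t"
  shows "(x t, y t) = polar_point (radius_at b (angle t)) (angle t)"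
  using assms b_ge x_polar[of t] y_polar[of t] by (simp add: polar_point_def radius_at_angle)

lemma traj_image: "(\<lambda>t. (x t, y t)) ` {b..} = polar_graph (radius_at b) {..angle b}"
  unfolding polar_graph_def angle_image[symmetric] image_image
  by (rule image_cong) (auto simp: traj_polar)

text \<open>The curve is parametrised by time itself, starting at a multiple of
\<open>\<pi>\<close>; the marks of the wavy pattern are the later multiples of
\<open>\<pi>\<close>, where the radius is falling.\<close>

lemma radius_at_wavy:
  fixes N :: nat
  assumes N: "b = N * pi"
    and slow: "\<And>t. b \<le> t \<Longrightarrow> \<bar>r' t\<bar> \<le> 6 * \<alpha> * t powr (- \<alpha> - 1)"
    and windows: "\<And>n::nat. N \<le> n \<Longrightarrow>
      (\<exists>l u. n * pi + pi/4 < l \<and> l < u \<and> u < n * pi + pi/2 \<and>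
      (\<forall>t. n * pi \<le> t \<and> t \<le> l \<longrightarrow> r' t \<le> 0) \<and>
      (\<forall>t. l < t \<and> t < u \<longrightarrow> 0 < r' t) \<and>
      (\<forall>t. u < t \<and> t \<le> n * pi + pi \<longrightarrow> r' t < 0))"
  shows "wavy_spiral (radius_at b) {..angle b}"
proof -
  define c where "c k = (N + k) * pi" for k :: nat
  have c_0: "c 0 = b" by (simp add: c_def N)
  have c_Suc: "c (Suc k) = c k + pi" for k by (simp add: c_def algebra_simps)
  have "\<exists>l u. c k + pi/4 < l \<and> l < u \<and> u < c k + pi/2 \<and>
      (\<forall>t. c k \<le> t \<and> t \<le> l \<longrightarrow> r' t \<le> 0) \<and> (\<forall>t. l < t \<and> t < u \<longrightarrow> 0 < r' t) \<and>
      (\<forall>t. u < t \<and> t \<le> c k + pi \<longrightarrow> r' t < 0)" for k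
    using windows[of "N + k"] unfolding c_def by simp
  then obtain l u where lu: "\<And>k. c k + pi/4 < l k" "\<And>k. l k < u k" "\<And>k. u k < c k + pi/2"
    and s: "\<And>k t. c k \<le> t \<Longrightarrow> t \<le> l k \<Longrightarrow> r' t \<le> 0" "\<And>k t. l k < t \<Longrightarrow> t < u k \<Longrightarrow> 0 < r' t"
      "\<And>k t. u k < t \<Longrightarrow> t \<le> c k + pi \<Longrightarrow> r' t < 0"
    by metis
  have bc: "b \<le> c k" for k by (simp add: c_def N algebra_simps)
  let ?\<rho> = "\<lambda>t. radius_at b (angle t)"
  interpret wavy_pattern ?\<rho> r' c l u "pi/4" pi "6 * \<alpha>" \<alpha>
  proof
    show "0 < ?\<rho> t" if "c 0 \<le> t" for t
      using that b_ge r_pos[of t] by (simp add: c_0 radius_at_angle)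
    show "(?\<rho> has_real_derivative r' t) (at t within {c 0..})" if "c 0 \<le> t" for t
    proof -
      have "(r has_real_derivative r' t) (at t within {b..})"
        using that c_0 b_ge by (intro has_field_derivative_subset[OF r_deriv]) auto
      then show ?thesis unfolding c_0 has_field_derivative_def
        by (rule has_derivative_transform[rotated 2]) (use that c_0 in \<open>auto simp: radius_at_angle\<close>)
    qed
    show "continuous_on {c 0..} r'"
      unfolding c_0 using b_ge by (intro continuous_on_subset[OF continuous_r']) auto
    show "0 < c 0" using c_0 b_ge t0_pos by simp
    show "?\<rho> (c (Suc k)) < ?\<rho> (l k)" for k
    proof -
      have "b \<le> l k" using bc[of k] lu(1)[of k] pi_gt_zero by linarith
      \<comment> \<open>The rise starts in the first quarter turn after a mark, so at least
      \<open>\<pi>/2 > 3/2\<close> before the next one.\<close>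
      moreover have "r (c (Suc k)) < r (l k)"
        by (rule falls[OF calculation])
          (use lu(1,2,3)[of k] c_Suc[of k] pi_gt3 pi_less_4 in linarith)+
      ultimately show ?thesis using bc[of "Suc k"] by (simp add: radius_at_angle)
    qed
    show "c k + pi/4 \<le> l k" "l k < u k" for k using lu(1,2)[of k] by simp_all
    show "u k < c (Suc k)" "c (Suc k) \<le> c k + pi" for k
      using lu(3)[of k] c_Suc[of k] pi_gt_zero by linarith+
    show "r' t < 0" if "u k < t" "t \<le> c (Suc k)" for k t using s(3)[of k t] that c_Suc[of k] by simp
    show "\<bar>r' t\<bar> \<le> 6 * \<alpha> * t powr (- \<alpha> - 1)" if "c 0 \<le> t" for t using slow that c_0 by simp
  qed (use s(1,2) alpha_pos in auto)
  have "wavy_function ?\<rho> b" using wavy unfolding c_0 .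
  moreover have "Ck_on 1 angle {b..}"
    unfolding Ck_on_def
  proof (intro exI[of _ "\<lambda>j::nat. if j = 0 then angle else \<omega>"] conjI)
    show "\<forall>j<1. \<forall>t\<in>{b..}. ((if j = 0 then angle else \<omega>) has_real_derivative
        (if Suc j = 0 then angle else \<omega>) t) (at t within {b..})"
      using b_ge by (auto intro!: has_field_derivative_subset[OF angle_deriv])
    show "continuous_on {b..} (if (1::nat) = 0 then angle else \<omega>)"
      using b_ge continuous_on_subset[OF continuous_omega, of "{b..}"] by auto
  qed auto
  ultimately show ?thesis
    unfolding wavy_spiral_def using radius_at_spiral angle_image angle_strict_antimono by blast
qed

lemma radius_at_comparable: "asymp_comparable (radius_at b) (\<lambda>\<phi>. \<bar>\<phi>\<bar> powr (- \<alpha>)) at_bot"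
proof -
  have "\<forall>\<^sub>F t in at_top. 1 / 2 < r t * t powr \<alpha>" "\<forall>\<^sub>F t in at_top. r t * t powr \<alpha> < 2"
    by (rule order_tendstoD[OF r_lim]; simp)+
  then have "\<forall>\<^sub>F t in at_top. b \<le> t \<and> 0 < t \<and> angle t \<le> - t / 4 \<and> - 2 * t \<le> angle t \<and>
      1 / 2 < r t * t powr \<alpha> \<and> r t * t powr \<alpha> < 2"
    using eventually_ge_at_top[of b] eventually_gt_at_top[of 0] angle_linear
    by eventually_elim auto
  then have "\<forall>\<^sub>F t in at_top. (2 powr (- \<alpha>) / 2) * r t \<le> \<bar>angle t\<bar> powr (- \<alpha>) \<and>
      \<bar>angle t\<bar> powr (- \<alpha>) \<le> (2 * 4 powr \<alpha>) * r t"
  proof eventually_elim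
    case (elim t)
    have r_bounds: "r t \<le> 2 * t powr (- \<alpha>)" "t powr (- \<alpha>) \<le> 2 * r t"
      using elim by (auto simp: powr_minus field_simps)
    have "2 powr (- \<alpha>) / 2 * r t \<le> 2 powr (- \<alpha>) / 2 * (2 * t powr (- \<alpha>))"
      using r_bounds(1) by (intro mult_left_mono) auto
    also have "\<dots> = (2 * t) powr (- \<alpha>)" using elim by (simp add: powr_mult)
    also have "\<dots> \<le> \<bar>angle t\<bar> powr (- \<alpha>)"
      using elim alpha_pos by (intro powr_mono2') auto
    finally have lower: "2 powr (- \<alpha>) / 2 * r t \<le> \<bar>angle t\<bar> powr (- \<alpha>)" .
    have "\<bar>angle t\<bar> powr (- \<alpha>) \<le> (t / 4) powr (- \<alpha>)"
      using elim alpha_pos by (intro powr_mono2') auto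
    also have "\<dots> = 4 powr \<alpha> * t powr (- \<alpha>)"
      using elim by (simp add: powr_divide powr_minus field_simps)
    also have "\<dots> \<le> 4 powr \<alpha> * (2 * r t)" using r_bounds(2) by (intro mult_left_mono) auto
    finally show ?case using lower by simp
  qed
  then have "\<forall>\<^sub>F \<theta> in at_bot. (2 powr (- \<alpha>) / 2) * r (time_at b \<theta>) \<le> \<bar>angle (time_at b \<theta>)\<bar> powr (- \<alpha>) \<and>
      \<bar>angle (time_at b \<theta>)\<bar> powr (- \<alpha>) \<le> (2 * 4 powr \<alpha>) * r (time_at b \<theta>)"
    using time_at_at_top unfolding filterlim_iff by blast
  then have "\<forall>\<^sub>F \<theta> in at_bot. (2 powr (- \<alpha>) / 2) * radius_at b \<theta> \<le> \<bar>\<theta>\<bar> powr (- \<alpha>) \<and>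
      \<bar>\<theta>\<bar> powr (- \<alpha>) \<le> (2 * 4 powr \<alpha>) * radius_at b \<theta>"
    using eventually_le_at_bot[of "angle b"] by eventually_elim (simp add: time_at radius_at_def)
  moreover have "0 < 2 powr (- \<alpha>) / 2" "0 < 2 * 4 powr \<alpha>" by simp_all
  ultimately show ?thesis unfolding asymp_comparable_def by blast
qed

end

lemma ex_wavy_start:
  assumes "\<alpha> \<noteq> 1"
  obtains b where "settled b" "wavy_spiral (radius_at b) {..angle b}"
proof -
  have "\<forall>\<^sub>F b in at_top. settled b \<and> (\<forall>t\<ge>b. \<bar>r' t\<bar> \<le> 6 * \<alpha> * t powr (- \<alpha> - 1)) \<and>
     (\<forall>n::nat. b \<le> n * pi \<longrightarrow> (\<exists>l u. n * pi + pi/4 < l \<and> l < u \<and> u < n * pi + pi/2 \<and>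
      (\<forall>t. n * pi \<le> t \<and> t \<le> l \<longrightarrow> r' t \<le> 0) \<and>
      (\<forall>t. l < t \<and> t < u \<longrightarrow> 0 < r' t) \<and>
      (\<forall>t. u < t \<and> t \<le> n * pi + pi \<longrightarrow> r' t < 0)))"
    using assms by (intro eventually_conj eventually_settled eventually_all_later radial_speed_bound
        radius_increases_once_per_half_turn)
  moreover have "filterlim (\<lambda>N. real N * pi) at_top sequentially"
    by (rule filterlim_at_top_mult_tendsto_pos[OF tendsto_const pi_gt_zero filterlim_real_sequentially])
  ultimately have "\<forall>\<^sub>F N in sequentially. settled (real N * pi) \<and>
     (\<forall>t\<ge>real N * pi. \<bar>r' t\<bar> \<le> 6 * \<alpha> * t powr (- \<alpha> - 1)) \<and>
     (\<forall>n::nat. real N * pi \<le> n * pi \<longrightarrow> (\<exists>l u. n * pi + pi/4 < l \<and> l < u \<and> u < n * pi + pi/2 \<and>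
      (\<forall>t. n * pi \<le> t \<and> t \<le> l \<longrightarrow> r' t \<le> 0) \<and>
      (\<forall>t. l < t \<and> t < u \<longrightarrow> 0 < r' t) \<and>
      (\<forall>t. u < t \<and> t \<le> n * pi + pi \<longrightarrow> r' t < 0)))"
    unfolding filterlim_iff by blast
  then obtain N where N: "settled (real N * pi)"
     "\<forall>t\<ge>real N * pi. \<bar>r' t\<bar> \<le> 6 * \<alpha> * t powr (- \<alpha> - 1)"
     "\<forall>n::nat. real N * pi \<le> n * pi \<longrightarrow> (\<exists>l u. n * pi + pi/4 < l \<and> l < u \<and> u < n * pi + pi/2 \<and>
      (\<forall>t. n * pi \<le> t \<and> t \<le> l \<longrightarrow> r' t \<le> 0) \<and>
      (\<forall>t. l < t \<and> t < u \<longrightarrow> 0 < r' t) \<and>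
      (\<forall>t. u < t \<and> t \<le> n * pi + pi \<longrightarrow> r' t < 0))"
    unfolding eventually_sequentially by blast
  show thesis
  proof (rule that[OF N(1)])
    show "wavy_spiral (radius_at (real N * pi)) {..angle (real N * pi)}"
      using N by (intro radius_at_wavy) auto
  qed
qed

end

section \<open>Length and area\<close>

lemma ex_polar_point:
  fixes v :: "real \<times> real"
  shows "\<exists>\<theta>. v = polar_point (norm v) \<theta>"
proof (cases "v = 0")
  case True
  then show ?thesis by (auto simp: polar_point_def zero_prod_def)
next
  case False
  obtain a b where v: "v = (a, b)" by (cases v)
  have n: "norm v \<noteq> 0" "(norm v)\<^sup>2 = a\<^sup>2 + b\<^sup>2" using False by (auto simp: v norm_Pair zero_prod_def)
  have "(a / norm v)\<^sup>2 + (b / norm v)\<^sup>2 = 1"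
    unfolding power_divide add_divide_distrib[symmetric] n(2)[symmetric] using n(1) by simp
  then obtain \<theta> where "a / norm v = cos \<theta>" "b / norm v = sin \<theta>"
    by (rule sincos_total_2pi)
  then have "v = polar_point (norm v) \<theta>"
    unfolding polar_point_def using n(1) by (simp add: v field_simps)
  then show ?thesis ..
qed

lemma dist_polar_point: "dist (polar_point a \<theta>) (polar_point b \<theta>) = \<bar>a - b\<bar>"
proof -
  have "dist (polar_point a \<theta>) (polar_point b \<theta>) = sqrt ((a - b)\<^sup>2 * ((sin \<theta>)\<^sup>2 + (cos \<theta>)\<^sup>2))"
    unfolding polar_point_def dist_Pair_Pair dist_real_def power2_abs
    by (rule arg_cong[of _ _ sqrt]) algebra
  then show ?thesis by simp
qed

lemma polar_point_shift: "polar_point a (\<theta> - 2 * pi * of_int n) = polar_point a \<theta>"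
proof -
  have "sin \<theta> = sin (\<theta> - 2 * pi * of_int n) \<and> cos \<theta> = cos (\<theta> - 2 * pi * of_int n)"
    unfolding sin_cos_eq_iff by (intro exI[of _ n]) simp
  then show ?thesis by (simp add: polar_point_def)
qed

context damped_oscillation
begin

definition "traj t = (x t, y t)"

lemma norm_traj: "norm (traj t) = r t"
  by (simp add: traj_def norm_Pair r_def)

lemma amplitude_bounds:
  "\<exists>K>0. \<forall>t\<ge>t\<^sub>0. \<bar>p t\<bar> \<le> K * t powr (- \<alpha>) \<and> \<bar>p1 t\<bar> \<le> K * t powr (- \<alpha>) \<and> \<bar>p2 t\<bar> \<le> K * t powr (- \<alpha>)"
proof -
  have bound: "\<exists>K>0. \<forall>t\<ge>t\<^sub>0. \<bar>f t\<bar> \<le> K * t powr (- \<alpha>)"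
    if f: "continuous_on {t\<^sub>0..} f" "((\<lambda>t. f t * t powr \<alpha>) \<longlongrightarrow> L) at_top" for f L
  proof -
    have "continuous_on {t\<^sub>0..} (\<lambda>t. f t * t powr \<alpha>)"
      using t0_pos by (intro continuous_intros f) auto
    from bounded_on_Ici_if_convergent[OF this f(2)]
    obtain K where K: "0 < K" "\<And>t. t\<^sub>0 \<le> t \<Longrightarrow> \<bar>f t * t powr \<alpha>\<bar> \<le> K"
      by blast
    have "\<bar>f t\<bar> \<le> K * t powr (- \<alpha>)" if "t\<^sub>0 \<le> t" for t
      using K(2)[OF that] that t0_pos by (simp add: abs_mult powr_minus field_simps)
    then show ?thesis using K(1) by blast
  qed
  have damped: "((\<lambda>t. f t * t powr \<alpha>) \<longlongrightarrow> 0) at_top"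
    if "((\<lambda>t. f t * t powr (\<alpha> + a)) \<longlongrightarrow> L) at_top" "0 < a" for f a L
    using that by (intro tendsto_zero_if_powr_tendsto[of _ a L]) (auto simp: powr_add mult.assoc)
  obtain K0 K1 K2 where K: "0 < K0" "0 < K1" "0 < K2"
    "\<And>t. t\<^sub>0 \<le> t \<Longrightarrow> \<bar>p t\<bar> \<le> K0 * t powr (- \<alpha>)" "\<And>t. t\<^sub>0 \<le> t \<Longrightarrow> \<bar>p1 t\<bar> \<le> K1 * t powr (- \<alpha>)"
    "\<And>t. t\<^sub>0 \<le> t \<Longrightarrow> \<bar>p2 t\<bar> \<le> K2 * t powr (- \<alpha>)"
    using bound[OF continuous_p p_lim] bound[OF continuous_p1 damped[OF p1_lim]]
      bound[OF continuous_p2 damped[OF p2_lim]] by auto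
  show ?thesis
  proof (intro exI[of _ "K0 + K1 + K2"] conjI allI impI)
    show "0 < K0 + K1 + K2" using K by simp
    fix t assume t: "t\<^sub>0 \<le> t"
    have le: "K0 * t powr (- \<alpha>) \<le> (K0 + K1 + K2) * t powr (- \<alpha>)"
      "K1 * t powr (- \<alpha>) \<le> (K0 + K1 + K2) * t powr (- \<alpha>)"
      "K2 * t powr (- \<alpha>) \<le> (K0 + K1 + K2) * t powr (- \<alpha>)"
      using K by (auto intro!: mult_right_mono)
    show "\<bar>p t\<bar> \<le> (K0 + K1 + K2) * t powr (- \<alpha>)" using K(4)[OF t] le by linarith
    show "\<bar>p1 t\<bar> \<le> (K0 + K1 + K2) * t powr (- \<alpha>)" using K(5)[OF t] le by linarith
    show "\<bar>p2 t\<bar> \<le> (K0 + K1 + K2) * t powr (- \<alpha>)" using K(6)[OF t] le by linarith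
  qed
qed

lemma speed_bounds:
  "\<exists>K>0. \<forall>t\<ge>t\<^sub>0. \<bar>y t\<bar> \<le> K * t powr (- \<alpha>) \<and> \<bar>z t\<bar> \<le> K * t powr (- \<alpha>) \<and> r t \<le> K * t powr (- \<alpha>)"
proof -
  obtain K where K_pos: "0 < K" and K_bound: "\<forall>t\<ge>t\<^sub>0. \<bar>p t\<bar> \<le> K * t powr (- \<alpha>) \<and>
      \<bar>p1 t\<bar> \<le> K * t powr (- \<alpha>) \<and> \<bar>p2 t\<bar> \<le> K * t powr (- \<alpha>)"
    using amplitude_bounds by (elim exE conjE) (rule that)
  note K = K_pos K_bound[THEN spec, THEN mp]
  have "\<bar>y t\<bar> \<le> (4 * K) * t powr (- \<alpha>) \<and> \<bar>z t\<bar> \<le> (4 * K) * t powr (- \<alpha>) \<and> r t \<le> (4 * K) * t powr (- \<alpha>)"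
    if t: "t\<^sub>0 \<le> t" for t
  proof -
    have sc: "\<bar>v * sin t\<bar> \<le> \<bar>v\<bar>" "\<bar>v * cos t\<bar> \<le> \<bar>v\<bar>" for v
      by (auto simp: abs_mult intro: mult_left_le)
    have x: "\<bar>x t\<bar> \<le> \<bar>p t\<bar>" unfolding x_def by (rule sc)
    have y: "\<bar>y t\<bar> \<le> \<bar>p1 t\<bar> + \<bar>p t\<bar>"
      unfolding y_def using sc(1)[of "p1 t"] sc(2)[of "p t"] by linarith
    have z: "\<bar>z t\<bar> \<le> \<bar>p2 t\<bar> + 2 * \<bar>p1 t\<bar> + \<bar>p t\<bar>"
      unfolding z_def using sc(1)[of "p2 t"] sc(2)[of "2 * p1 t"] sc(1)[of "p t"] by linarith
    have "r t \<le> \<bar>x t\<bar> + \<bar>y t\<bar>" unfolding r_def by (rule sqrt_sum_squares_le_sum_abs)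
    moreover have "(4 * K) * t powr (- \<alpha>) = 4 * (K * t powr (- \<alpha>))" by simp
    ultimately show ?thesis using x y z K(2)[OF t] K(1) by linarith
  qed
  then show ?thesis using K(1) by (intro exI[of _ "4 * K"]) simp
qed

text \<open>The speed is \<open>O(t^(-\<alpha>))\<close>, so arc length is bounded by
increments of \<open>t^(1-\<alpha>) / (1 - \<alpha>)\<close>. For
\<open>\<alpha> > 1\<close> this primitive is bounded, which gives finite length; for
\<open>\<alpha> < 1\<close> it is the parameter in which the curve is Lipschitz.\<close>

lemma traj_dominated:
  assumes "\<alpha> \<noteq> 1"
  shows "\<exists>K>0. \<forall>s\<ge>t\<^sub>0. \<forall>t\<ge>s.
    dist (traj s) (traj t) \<le> K * (t powr (1 - \<alpha>) / (1 - \<alpha>)) - K * (s powr (1 - \<alpha>) / (1 - \<alpha>))"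
proof -
  obtain K where K_pos: "0 < K" and K_bound: "\<forall>t\<ge>t\<^sub>0.
      \<bar>y t\<bar> \<le> K * t powr (- \<alpha>) \<and> \<bar>z t\<bar> \<le> K * t powr (- \<alpha>) \<and> r t \<le> K * t powr (- \<alpha>)"
    using speed_bounds by (elim exE conjE) (rule that)
  note K = K_pos K_bound[THEN spec, THEN mp]
  let ?G = "\<lambda>t. K * (t powr (1 - \<alpha>) / (1 - \<alpha>))"
  have G: "(?G has_real_derivative K * t powr (- \<alpha>)) (at t within {t\<^sub>0..})" if "t\<^sub>0 \<le> t" for t
  proof -
    have "((\<lambda>t. t powr (1 - \<alpha>)) has_real_derivative (1 - \<alpha>) * t powr (1 - \<alpha> - 1)) (at t within {t\<^sub>0..})"
      using that t0_pos
      by (intro has_real_derivative_powr[THEN has_field_derivative_at_within]) simp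
    from DERIV_cmult[OF DERIV_cdivide[OF this, of "1 - \<alpha>"], of K] show ?thesis using assms by simp
  qed
  have "dist (traj s) (traj t) \<le> (2 * K) * (t powr (1 - \<alpha>) / (1 - \<alpha>)) - (2 * K) * (s powr (1 - \<alpha>) / (1 - \<alpha>))"
    if st: "t\<^sub>0 \<le> s" "s \<le> t" for s t
  proof -
    have "\<bar>x t - x s\<bar> \<le> ?G t - ?G s"
      by (rule increment_bounded_by_majorant[OF x_deriv G st]) (use K(2) st in auto)
    moreover have "\<bar>y t - y s\<bar> \<le> ?G t - ?G s"
      by (rule increment_bounded_by_majorant[OF y_deriv G st]) (use K(2) st in auto)
    moreover have "dist (traj s) (traj t) \<le> \<bar>x t - x s\<bar> + \<bar>y t - y s\<bar>"
      using sqrt_sum_squares_le_sum_abs[of "dist (x s) (x t)" "dist (y s) (y t)"]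
      by (simp add: traj_def dist_Pair_Pair dist_real_def abs_minus_commute)
    ultimately show ?thesis by simp
  qed
  then show ?thesis using K(1) by (intro exI[of _ "2 * K"]) simp
qed

lemma traj_rectifiable:
  assumes "1 < \<alpha>" and c: "\<And>t. t\<^sub>0 \<le> t \<Longrightarrow> c t = traj t"
  shows "rectifiable c {t\<^sub>0..}"
proof -
  have "\<alpha> \<noteq> 1" using assms by simp
  from traj_dominated[OF this]
  obtain K where K: "0 < K" "\<And>s t. t\<^sub>0 \<le> s \<Longrightarrow> s \<le> t \<Longrightarrow>
    dist (traj s) (traj t) \<le> K * (t powr (1 - \<alpha>) / (1 - \<alpha>)) - K * (s powr (1 - \<alpha>) / (1 - \<alpha>))"
    by blast
  show ?thesis
  proof (rule rectifiable_if_dominated)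
    fix s t assume st: "s \<in> {t\<^sub>0..}" "t \<in> {t\<^sub>0..}" "s \<le> t"
    have "K * (t powr (1 - \<alpha>) / (1 - \<alpha>)) \<le> 0"
      using K(1) assms by (auto simp: mult_le_0_iff divide_le_0_iff)
    moreover have "s powr (1 - \<alpha>) \<le> t\<^sub>0 powr (1 - \<alpha>)"
      using st t0_pos assms by (intro powr_mono2') auto
    then have "K * (t\<^sub>0 powr (1 - \<alpha>) / (1 - \<alpha>)) \<le> K * (s powr (1 - \<alpha>) / (1 - \<alpha>))"
      using K(1) assms by (intro mult_left_mono divide_right_mono_neg) auto
    ultimately show "dist (c s) (c t) \<le> K * (t powr (1 - \<alpha>) / (1 - \<alpha>)) - K * (s powr (1 - \<alpha>) / (1 - \<alpha>)) \<and>
       K * (t powr (1 - \<alpha>) / (1 - \<alpha>)) - K * (s powr (1 - \<alpha>) / (1 - \<alpha>)) \<le> - (K * (t\<^sub>0 powr (1 - \<alpha>) / (1 - \<alpha>)))"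
      using K(2)[of s t] st by (auto simp: c)
  qed
qed

lemma traj_bounded: "bounded (traj ` {t\<^sub>0..})"
proof -
  obtain K where K_pos: "0 < K" and K_bound: "\<forall>t\<ge>t\<^sub>0.
      \<bar>y t\<bar> \<le> K * t powr (- \<alpha>) \<and> \<bar>z t\<bar> \<le> K * t powr (- \<alpha>) \<and> r t \<le> K * t powr (- \<alpha>)"
    using speed_bounds by (elim exE conjE) (rule that)
  note K = K_pos K_bound[THEN spec, THEN mp]
  have "norm (traj t) \<le> K * t\<^sub>0 powr (- \<alpha>)" if "t\<^sub>0 \<le> t" for t
  proof -
    have "t powr (- \<alpha>) \<le> t\<^sub>0 powr (- \<alpha>)" using that t0_pos alpha_pos by (intro powr_mono2') auto
    then have "K * t powr (- \<alpha>) \<le> K * t\<^sub>0 powr (- \<alpha>)" using K(1) by simp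
    then show ?thesis using K(2)[OF that] unfolding norm_traj by linarith
  qed
  then show ?thesis unfolding bounded_iff by blast
qed

text \<open>Neighbouring turns at time \<open>t\<close> are about
\<open>t^(-\<alpha>-1)\<close> apart, so their
\<open>\<epsilon>\<close>-neighbourhoods start to overlap around the time \<open>cutoff
\<epsilon>\<close>, when the radius is of order \<open>core_radius \<epsilon>\<close>.\<close>

definition "cutoff \<epsilon> = \<epsilon> powr (- 1 / (1 + \<alpha>))"
definition "core_radius \<epsilon> = \<epsilon> powr (\<alpha> / (1 + \<alpha>))"

text \<open>All relevant areas have the same order at the cutoff: that of the core filled by the
late turns, and \<open>\<epsilon>\<close> times the length of the early ones. The common exponent
\<open>2 - 2 / (1 + \<alpha>)\<close> is the codimension.\<close>

lemma cutoff_scales: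
  assumes "0 < \<epsilon>"
  shows cutoff_pos: "0 < cutoff \<epsilon>" and core_radius_pos: "0 < core_radius \<epsilon>"
    and cutoff_radius: "cutoff \<epsilon> powr (- \<alpha>) = core_radius \<epsilon>"
    and cutoff_gap: "cutoff \<epsilon> powr (- \<alpha> - 1) = \<epsilon>"
    and core_area: "(core_radius \<epsilon>)\<^sup>2 = \<epsilon> powr (2 - 2 / (1 + \<alpha>))"
    and cutoff_length: "cutoff \<epsilon> powr (1 - \<alpha>) * \<epsilon> = (core_radius \<epsilon>)\<^sup>2"
proof -
  show "0 < cutoff \<epsilon>" "0 < core_radius \<epsilon>"
    using assms by (simp_all add: cutoff_def core_radius_def)
  show "cutoff \<epsilon> powr (- \<alpha>) = core_radius \<epsilon>"
    by (simp add: cutoff_def core_radius_def powr_powr)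
  have "- 1 / (1 + \<alpha>) * (- \<alpha> - 1) = 1" using alpha_pos by (simp add: divide_eq_eq)
  then show "cutoff \<epsilon> powr (- \<alpha> - 1) = \<epsilon>"
    unfolding cutoff_def powr_powr using assms by simp
  have inv: "\<alpha> / (1 + \<alpha>) = 1 - 1 / (1 + \<alpha>)"
    using alpha_pos by (simp add: divide_simps)
  have "\<alpha> / (1 + \<alpha>) + \<alpha> / (1 + \<alpha>) = 2 - 2 / (1 + \<alpha>)"
    unfolding inv by simp
  then show area: "(core_radius \<epsilon>)\<^sup>2 = \<epsilon> powr (2 - 2 / (1 + \<alpha>))"
    unfolding core_radius_def power2_eq_square powr_add[symmetric] by simp
  have "- 1 / (1 + \<alpha>) * (1 - \<alpha>) + 1 = \<alpha> / (1 + \<alpha>) - 1 / (1 + \<alpha>) + 1"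
    by (simp add: diff_divide_distrib)
  also have "\<dots> = 2 - 2 / (1 + \<alpha>)" unfolding inv by simp
  finally show "cutoff \<epsilon> powr (1 - \<alpha>) * \<epsilon> = (core_radius \<epsilon>)\<^sup>2"
    unfolding area cutoff_def powr_powr
    using assms by (metis powr_add powr_one order_less_imp_le)
qed

text \<open>The part before the cutoff is covered by balls placed along it, and the part after the
cutoff stays in the core.\<close>

lemma area_upper_bound:
  assumes "\<alpha> < 1"
  shows "\<exists>C. \<forall>\<^sub>F \<epsilon> in at_right 0.
    emeasure lborel (nbhd_of (traj ` {t\<^sub>0..}) \<epsilon>) \<le> ennreal (C * \<epsilon> powr (2 - 2 / (1 + \<alpha>)))"
proof -
  obtain K where K_pos: "0 < K" and K_bound: "\<forall>t\<ge>t\<^sub>0.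
      \<bar>y t\<bar> \<le> K * t powr (- \<alpha>) \<and> \<bar>z t\<bar> \<le> K * t powr (- \<alpha>) \<and> r t \<le> K * t powr (- \<alpha>)"
    using speed_bounds by (elim exE conjE) (rule that)
  note K = K_pos K_bound[THEN spec, THEN mp]
  have "\<alpha> \<noteq> 1" using assms by simp
  from traj_dominated[OF this]
  obtain L where L: "0 < L" "\<And>s t. t\<^sub>0 \<le> s \<Longrightarrow> s \<le> t \<Longrightarrow>
    dist (traj s) (traj t) \<le> L * (t powr (1 - \<alpha>) / (1 - \<alpha>)) - L * (s powr (1 - \<alpha>) / (1 - \<alpha>))"
    by blast
  define L' where "L' = L / (1 - \<alpha>)"
  have L': "0 < L'" using L assms by (simp add: L'_def)
  have lip: "dist (traj s) (traj t) \<le> L' * \<bar>t powr (1 - \<alpha>) - s powr (1 - \<alpha>)\<bar>" if "t\<^sub>0 \<le> s" "t\<^sub>0 \<le> t" for s t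
  proof -
    have 1: "dist (traj s) (traj t) \<le> L' * \<bar>t powr (1 - \<alpha>) - s powr (1 - \<alpha>)\<bar>" if "t\<^sub>0 \<le> s" "s \<le> t" for s t
    proof -
      have "dist (traj s) (traj t) \<le> L' * (t powr (1 - \<alpha>) - s powr (1 - \<alpha>))"
        using L(2)[OF that] by (simp add: L'_def right_diff_distrib)
      also have "\<dots> \<le> L' * \<bar>t powr (1 - \<alpha>) - s powr (1 - \<alpha>)\<bar>" using L' by (intro mult_left_mono) auto
      finally show ?thesis .
    qed
    show ?thesis
      using 1[of s t] 1[of t s] that by (cases "s \<le> t") (auto simp: dist_commute abs_minus_commute)
  qed
  define V where "V = unit_ball_vol 2"
  have V: "0 \<le> V" by (simp add: V_def)
  define C where "C = 2 * (V * (L' + 1)\<^sup>2) + V * (K + 1)\<^sup>2"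
  have "\<forall>\<^sub>F \<epsilon>::real in at_right 0. 0 < \<epsilon> \<and> \<epsilon> < 1"
    by (auto simp: eventually_at_right_field intro!: exI[of _ 1])
  then have "\<forall>\<^sub>F \<epsilon> in at_right 0.
    emeasure lborel (nbhd_of (traj ` {t\<^sub>0..}) \<epsilon>) \<le> ennreal (C * \<epsilon> powr (2 - 2 / (1 + \<alpha>)))"
  proof eventually_elim
    case (elim \<epsilon>)
    then have eps: "0 < \<epsilon>" by simp
    define \<tau> where "\<tau> = cutoff \<epsilon>"
    define \<rho> where "\<rho> = core_radius \<epsilon>"
    note \<tau> = cutoff_pos[OF eps, folded \<tau>_def]
      and tail_radius = cutoff_radius[OF eps, folded \<tau>_def \<rho>_def]
      and tail_length = cutoff_length[OF eps, folded \<tau>_def \<rho>_def]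
      and \<rho>_sq = core_area[OF eps, folded \<rho>_def]
    have \<rho>: "0 < \<rho>" "\<epsilon> \<le> \<rho>"
      using core_radius_pos[OF eps] elim alpha_pos powr_mono'[of "\<alpha> / (1 + \<alpha>)" 1 \<epsilon>] by (auto simp: \<rho>_def core_radius_def)
    let ?S = "{t\<^sub>0..} \<inter> {..\<tau>}"
    have "emeasure lborel (nbhd_of (traj ` ?S) \<epsilon>)
        \<le> ennreal ((\<tau> powr (1 - \<alpha>) / \<epsilon> + 1) * (unit_ball_vol DIM(real \<times> real) * ((L' + 1) * \<epsilon>) ^ DIM(real \<times> real)))"
      using elim L' lip t0_pos assms
      by (intro emeasure_nbhd_of_lipschitz_le[where G = "\<lambda>t. t powr (1 - \<alpha>)"]) (auto intro!: powr_mono2)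
    also have "(\<tau> powr (1 - \<alpha>) / \<epsilon> + 1) * (unit_ball_vol DIM(real \<times> real) * ((L' + 1) * \<epsilon>) ^ DIM(real \<times> real))
        = V * (L' + 1)\<^sup>2 * (\<tau> powr (1 - \<alpha>) * \<epsilon> + \<epsilon>\<^sup>2)"
      using elim by (simp add: V_def power2_eq_square field_simps)
    also have "\<dots> \<le> V * (L' + 1)\<^sup>2 * (\<rho>\<^sup>2 + \<rho>\<^sup>2)"
      unfolding tail_length using elim \<rho> V by (intro mult_left_mono add_left_mono power_mono) auto
    finally have tail: "emeasure lborel (nbhd_of (traj ` ?S) \<epsilon>) \<le> ennreal (V * (L' + 1)\<^sup>2 * (\<rho>\<^sup>2 + \<rho>\<^sup>2))"
      by (simp add: ennreal_leI)
    have sub: "nbhd_of (traj ` {t\<^sub>0..}) \<epsilon> \<subseteq> nbhd_of (traj ` ?S) \<epsilon> \<union> ball 0 ((K + 1) * \<rho>)"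
    proof
      fix v assume "v \<in> nbhd_of (traj ` {t\<^sub>0..}) \<epsilon>"
      then obtain t where t: "t\<^sub>0 \<le> t" "dist v (traj t) < \<epsilon>" by (auto simp: nbhd_of_iff)
      show "v \<in> nbhd_of (traj ` ?S) \<epsilon> \<union> ball 0 ((K + 1) * \<rho>)"
      proof (cases "t \<le> \<tau>")
        case True
        then show ?thesis using t by (auto simp: nbhd_of_iff)
      next
        case False
        then have "t powr (- \<alpha>) \<le> \<rho>"
          unfolding tail_radius[symmetric] using \<tau> alpha_pos by (intro powr_mono2') auto
        then have "K * t powr (- \<alpha>) \<le> K * \<rho>" using K(1) by simp
        then have "norm (traj t) \<le> K * \<rho>" using K(2)[OF t(1)] unfolding norm_traj by linarith
        moreover have "norm v \<le> norm (traj t) + dist v (traj t)"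
          using norm_triangle_sub[of v "traj t"] by (simp add: dist_norm)
        ultimately have "norm v < (K + 1) * \<rho>" using t(2) \<rho>(2) by (simp add: algebra_simps)
        then show ?thesis by simp
      qed
    qed
    have "emeasure lborel (nbhd_of (traj ` {t\<^sub>0..}) \<epsilon>)
        \<le> emeasure lborel (nbhd_of (traj ` ?S) \<epsilon> \<union> ball 0 ((K + 1) * \<rho>))"
      by (intro emeasure_mono sub) (auto simp: open_nbhd_of)
    also have "\<dots> \<le> emeasure lborel (nbhd_of (traj ` ?S) \<epsilon>) + emeasure lborel (ball (0 :: real \<times> real) ((K + 1) * \<rho>))"
      by (intro emeasure_subadditive) (auto simp: open_nbhd_of)
    also have "emeasure lborel (ball (0 :: real \<times> real) ((K + 1) * \<rho>)) = ennreal (V * ((K + 1) * \<rho>)\<^sup>2)"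
      using K(1) \<rho> by (subst emeasure_ball) (auto simp: V_def power2_eq_square)
    also have "emeasure lborel (nbhd_of (traj ` ?S) \<epsilon>) + ennreal (V * ((K + 1) * \<rho>)\<^sup>2)
        \<le> ennreal (V * (L' + 1)\<^sup>2 * (\<rho>\<^sup>2 + \<rho>\<^sup>2)) + ennreal (V * ((K + 1) * \<rho>)\<^sup>2)"
      by (intro add_right_mono tail)
    also have "\<dots> = ennreal (C * \<epsilon> powr (2 - 2 / (1 + \<alpha>)))"
      using V unfolding \<rho>_sq[symmetric] C_def power_mult_distrib
      by (subst ennreal_plus[symmetric]) (auto simp: algebra_simps)
    finally show ?case .
  qed
  then show ?thesis ..
qed

end

context damped_oscillation
begin

text \<open>Beyond a time at which neighbouring turns are closer than \<open>\<epsilon>\<close>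
the curve is \<open>\<epsilon>\<close>-dense in a disc: on the ray through \<open>v\<close> the
successive crossings \<open>s k\<close> start outside of \<open>v\<close> and tend to the origin
with steps smaller than \<open>\<epsilon>\<close>, so the last crossing before the radius drops
below that of \<open>v\<close> is close to \<open>v\<close>.\<close>

lemma disc_subset_nbhd:
  assumes b: "settled b" and t: "b \<le> t"
    and far: "\<And>s. t \<le> s \<Longrightarrow> s \<le> t + 16 \<Longrightarrow> R \<le> r s"
    and gap: "\<And>s s'. t \<le> s \<Longrightarrow> s \<le> s' \<Longrightarrow> s' \<le> s + 16 \<Longrightarrow> r s - r s' < \<epsilon>"
    and eps: "0 < \<epsilon>"
  shows "ball 0 R \<subseteq> nbhd_of (traj ` {t\<^sub>0..}) \<epsilon>"
proof
  fix v :: "real \<times> real" assume "v \<in> ball 0 R"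
  then have vR: "norm v < R" by simp
  have bt: "t\<^sub>0 \<le> b" using b by (simp add: settled_def)
  have r_small: "\<exists>B. \<forall>s\<ge>B. r s < d" if "0 < d" for d
    using order_tendstoD(2)[OF r_tendsto_0[OF b] that] unfolding eventually_at_top_linorder .
  show "v \<in> nbhd_of (traj ` {t\<^sub>0..}) \<epsilon>"
  proof (cases "v = 0")
    case True
    obtain B where "\<forall>s\<ge>B. r s < \<epsilon>" using r_small[OF eps] ..
    then have "dist v (traj (max B t\<^sub>0)) < \<epsilon>" using True by (simp add: norm_traj)
    then show ?thesis unfolding nbhd_of_iff by force
  next
    case False
    obtain \<theta> where \<theta>: "v = polar_point (norm v) \<theta>" using ex_polar_point[of v] ..
    \<comment> \<open>The angle of \<open>v\<close> is shifted so that the first crossing is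
    within one turn after time \<open>t\<close>.\<close>
    define n where "n = \<lceil>(\<theta> - angle t) / (2 * pi)\<rceil>"
    define \<theta>' where "\<theta>' = \<theta> - 2 * pi * of_int n"
    have "(\<theta> - angle t) / (2 * pi) \<le> of_int n" "of_int n < (\<theta> - angle t) / (2 * pi) + 1"
      unfolding n_def by linarith+
    then have \<theta>': "\<theta>' \<le> angle t" "angle t - 2 * pi < \<theta>'"
      unfolding \<theta>'_def by (auto simp: field_simps)
    have at_le: "angle t \<le> angle b" using angle_change'(1)[OF b, of b t] t by simp
    define s where "s k = time_at b (\<theta>' - 2 * pi * real k)" for k
    have th_le: "\<theta>' - 2 * pi * real k \<le> angle b" for k
    proof -
      have "0 \<le> 2 * pi * real k" by simp
      then show ?thesis using \<theta>'(1) at_le by linarith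
    qed
    have s_b: "b \<le> s k" and s_angle: "angle (s k) = \<theta>' - 2 * pi * real k" for k
      unfolding s_def by (rule time_at[OF b th_le])+
    have s_step: "s k + 3/2 \<le> s (Suc k)" "s (Suc k) \<le> s k + 16" for k
    proof -
      have "\<theta>' - 2 * pi * real (Suc k) = (\<theta>' - 2 * pi * real k) - 2 * pi" by (simp add: algebra_simps)
      then show "s k + 3/2 \<le> s (Suc k)" "s (Suc k) \<le> s k + 16"
        unfolding s_def using time_at_turn[OF b th_le] by metis+
    qed
    have s0: "t \<le> s 0" unfolding s_def using \<theta>'(1) by (intro time_at_ge[OF b t]) simp
    have "(s 0 - t) / 2 \<le> 2 * pi"
      using angle_change'(1)[OF b t s0] s_angle[of 0] \<theta>'(2) by simp
    then have s0': "s 0 \<le> t + 16"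
      unfolding diff_divide_distrib using pi_less_4 by linarith
    have s_grow: "s 0 + 3/2 * real k \<le> s k" for k
    proof (induction k)
      case (Suc k)
      then show ?case using s_step(1)[of k] unfolding of_nat_Suc distrib_left by linarith
    qed simp
    have s_t: "t \<le> s k" for k using s_grow[of k] s0 of_nat_0_le_iff[of k] by linarith
    obtain B where B: "\<forall>u\<ge>B. r u < norm v" using r_small[of "norm v"] False by auto
    obtain k where "B \<le> real k" using real_arch_simple by blast
    moreover have "0 \<le> s 0" using s_b[of 0] bt t0_pos by linarith
    ultimately have "B \<le> s k" using s_grow[of k] by linarith
    then have "r (s k) < norm v" using B by simp
    then have ex: "\<exists>k. r (s k) < norm v" ..
    define m where "m = (LEAST k. r (s k) < norm v)"
    have m: "r (s m) < norm v" unfolding m_def by (rule LeastI_ex[OF ex])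
    have "m \<noteq> 0" using m far[OF s0 s0'] vR by (cases "m = 0") auto
    then obtain j where j: "m = Suc j" by (cases m) auto
    have "\<not> r (s j) < norm v" using not_less_Least[of j "\<lambda>k. r (s k) < norm v"] j unfolding m_def by simp
    moreover have "r (s j) - r (s (Suc j)) < \<epsilon>"
      using s_step[of j] by (intro gap s_t) auto
    ultimately have close: "\<bar>norm v - r (s j)\<bar> < \<epsilon>" using m unfolding j by linarith
    have t0s: "t\<^sub>0 \<le> s j" using s_b[of j] bt by linarith
    have "traj (s j) = polar_point (r (s j)) (angle (s j))"
      unfolding traj_def polar_point_def using x_polar[OF t0s] y_polar[OF t0s] by simp
    also have "angle (s j) = \<theta> - 2 * pi * of_int (n + int j)"
      unfolding s_angle \<theta>'_def by (simp add: algebra_simps)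
    also have "polar_point (r (s j)) \<dots> = polar_point (r (s j)) \<theta>" by (rule polar_point_shift)
    finally have "dist v (traj (s j)) = \<bar>norm v - r (s j)\<bar>"
      using dist_polar_point[of "norm v" \<theta> "r (s j)"] \<theta> by simp
    then show ?thesis unfolding nbhd_of_iff using close t0s by force
  qed
qed

text \<open>From a large constant multiple of the cutoff on, neighbouring turns are closer than
\<open>\<epsilon>\<close>, and there the radius is still of the order of the core radius.\<close>

lemma area_lower_bound:
  "\<exists>c>0. \<forall>\<^sub>F \<epsilon> in at_right 0.
    ennreal (c * \<epsilon> powr (2 - 2 / (1 + \<alpha>))) \<le> emeasure lborel (nbhd_of (traj ` {t\<^sub>0..}) \<epsilon>)"
proof -
  have "\<forall>\<^sub>F t in at_top. 1 / 2 < r t * t powr \<alpha>" by (rule order_tendstoD[OF r_lim]) simp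
  then have "\<forall>\<^sub>F b in at_top. settled b \<and> 16 \<le> b \<and> (\<forall>t\<ge>b. \<bar>r' t\<bar> \<le> 6 * \<alpha> * t powr (- \<alpha> - 1)) \<and>
      (\<forall>t\<ge>b. 1 / 2 < r t * t powr \<alpha>)"
    by (intro eventually_conj eventually_settled eventually_ge_at_top eventually_all_later radial_speed_bound)
  then obtain b where b: "settled b" "16 \<le> b"
    and speed: "\<And>t. b \<le> t \<Longrightarrow> \<bar>r' t\<bar> \<le> 6 * \<alpha> * t powr (- \<alpha> - 1)"
    and r_ge: "\<And>t. b \<le> t \<Longrightarrow> 1 / 2 < r t * t powr \<alpha>"
    unfolding eventually_at_top_linorder by blast
  have b_t0: "t\<^sub>0 \<le> b" using b by (simp add: settled_def)
  \<comment> \<open>Over a turn of duration at most 16 the radius changes by at most \<open>16 * 6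
  \<alpha> (M \<tau>)^(-\<alpha>-1) \<le> (96 \<alpha> / M) \<epsilon>\<close>.\<close>
  define M where "M = 96 * \<alpha> + 1"
  have M: "1 \<le> M" using alpha_pos by (simp add: M_def)
  define k where "k = (2 * M) powr (- \<alpha>) / 2"
  have k: "0 < k" using M by (simp add: k_def)
  \<comment> \<open>Below \<open>\<epsilon>\<^sub>1\<close> the cutoff lies beyond
  \<open>b\<close>.\<close>
  define \<epsilon>\<^sub>1 where "\<epsilon>\<^sub>1 = b powr (- (1 + \<alpha>))"
  have "0 < \<epsilon>\<^sub>1" using b(2) by (simp add: \<epsilon>\<^sub>1_def)
  then have "\<forall>\<^sub>F \<epsilon>::real in at_right 0. 0 < \<epsilon> \<and> \<epsilon> < \<epsilon>\<^sub>1"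
    by (auto simp: eventually_at_right_field intro!: exI[of _ \<epsilon>\<^sub>1])
  then have "\<forall>\<^sub>F \<epsilon> in at_right 0. ennreal (unit_ball_vol 2 * k\<^sup>2 * \<epsilon> powr (2 - 2 / (1 + \<alpha>)))
      \<le> emeasure lborel (nbhd_of (traj ` {t\<^sub>0..}) \<epsilon>)"
  proof eventually_elim
    case (elim \<epsilon>)
    then have eps: "0 < \<epsilon>" by simp
    define \<tau> where "\<tau> = cutoff \<epsilon>"
    define \<rho> where "\<rho> = core_radius \<epsilon>"
    note \<rho> = core_radius_pos[OF eps, folded \<rho>_def] and \<rho>_sq = core_area[OF eps, folded \<rho>_def]
    have "- (1 + \<alpha>) * (- 1 / (1 + \<alpha>)) = 1" using alpha_pos by (simp add: divide_eq_eq)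
    then have "\<epsilon>\<^sub>1 powr (- 1 / (1 + \<alpha>)) = b"
      unfolding \<epsilon>\<^sub>1_def powr_powr using b(2) by simp
    then have \<tau>_b: "b \<le> \<tau>"
      unfolding \<tau>_def cutoff_def using elim alpha_pos powr_mono2'[of "- 1 / (1 + \<alpha>)" \<epsilon> \<epsilon>\<^sub>1] by simp
    define t where "t = M * \<tau>"
    have \<tau>_t: "\<tau> \<le> t" using M \<tau>_b b(2) mult_right_mono[of 1 M \<tau>] by (simp add: t_def)
    have t: "b \<le> t" "16 \<le> t" "0 < t" "0 < \<tau>" using \<tau>_t \<tau>_b b(2) by auto
    have "ball 0 (k * \<rho>) \<subseteq> nbhd_of (traj ` {t\<^sub>0..}) \<epsilon>"
    proof (rule disc_subset_nbhd[OF b(1) t(1)])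
      show "0 < \<epsilon>" using elim by simp
      show "k * \<rho> \<le> r s" if s: "t \<le> s" "s \<le> t + 16" for s
      proof -
        have "k * \<rho> = ((2 * M) powr (- \<alpha>) * \<tau> powr (- \<alpha>)) / 2"
          by (simp add: k_def cutoff_radius[OF eps, folded \<tau>_def \<rho>_def])
        also have "\<dots> = (2 * t) powr (- \<alpha>) / 2"
          using M t by (simp add: t_def powr_mult)
        also have "\<dots> \<le> s powr (- \<alpha>) / 2"
          using s t alpha_pos by (intro divide_right_mono powr_mono2') auto
        also have "\<dots> \<le> r s"
          using r_ge[of s] s t by (simp add: powr_minus field_simps)
        finally show ?thesis .
      qed
      show "r s - r s' < \<epsilon>" if s: "t \<le> s" "s \<le> s'" "s' \<le> s + 16" for s s'
      proof -
        define B where "B = 6 * \<alpha> * t powr (- \<alpha> - 1)"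
        have B: "0 \<le> B" using alpha_pos by (simp add: B_def)
        have "\<bar>r s' - r s\<bar> \<le> B * s' - B * s"
        proof (rule increment_bounded_by_majorant[where g' = "\<lambda>_. B", OF r_deriv _ _ s(2)])
          show "t\<^sub>0 \<le> s" using s t b_t0 by linarith
          show "\<bar>r' u\<bar> \<le> B" if u: "s < u" "u < s'" for u
          proof -
            have "u powr (- \<alpha> - 1) \<le> t powr (- \<alpha> - 1)"
              using u s t alpha_pos by (intro powr_mono2') auto
            then have "6 * \<alpha> * u powr (- \<alpha> - 1) \<le> B"
              unfolding B_def using alpha_pos by (intro mult_left_mono) auto
            then show ?thesis using speed[of u] u s t by linarith
          qed
        qed (auto intro!: derivative_eq_intros)
        also have "\<dots> = B * (s' - s)" by (simp add: right_diff_distrib)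
        also have "\<dots> \<le> B * 16" using s B by (intro mult_left_mono) auto
        also have "B * 16 = 96 * \<alpha> * (M powr (- \<alpha> - 1) * \<epsilon>)"
          unfolding B_def t_def using M t cutoff_gap[OF eps, folded \<tau>_def] by (simp add: powr_mult)
        also have "\<dots> \<le> 96 * \<alpha> * (M powr (- 1) * \<epsilon>)"
          using M alpha_pos elim by (intro mult_left_mono mult_right_mono powr_mono) auto
        also have "\<dots> = (96 * \<alpha> / M) * \<epsilon>" using M by (simp add: powr_minus_divide)
        also have "\<dots> < 1 * \<epsilon>"
          using M alpha_pos elim by (intro mult_strict_right_mono) (auto simp: M_def)
        finally show ?thesis by simp
      qed
    qed
    then have "emeasure lborel (ball (0 :: real \<times> real) (k * \<rho>)) \<le> emeasure lborel (nbhd_of (traj ` {t\<^sub>0..}) \<epsilon>)"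
      by (intro emeasure_mono) (auto simp: open_nbhd_of)
    also have "emeasure lborel (ball (0 :: real \<times> real) (k * \<rho>)) = ennreal (unit_ball_vol 2 * k\<^sup>2 * \<rho>\<^sup>2)"
      using k \<rho> by (subst emeasure_ball) (auto simp: power2_eq_square mult_ac)
    finally show ?case unfolding \<rho>_sq .
  qed
  moreover have "0 < unit_ball_vol 2 * k\<^sup>2" using k by simp
  ultimately show ?thesis by blast
qed

lemma traj_box_dim:
  assumes "\<alpha> < 1"
  shows "has_box_dim (traj ` {t\<^sub>0..}) (2 / (1 + \<alpha>))"
proof -
  obtain C where "\<forall>\<^sub>F \<epsilon> in at_right 0.
    emeasure lborel (nbhd_of (traj ` {t\<^sub>0..}) \<epsilon>) \<le> ennreal (C * \<epsilon> powr (2 - 2 / (1 + \<alpha>)))"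
    using area_upper_bound[OF assms] ..
  moreover obtain c where "0 < c" "\<forall>\<^sub>F \<epsilon> in at_right 0.
    ennreal (c * \<epsilon> powr (2 - 2 / (1 + \<alpha>))) \<le> emeasure lborel (nbhd_of (traj ` {t\<^sub>0..}) \<epsilon>)"
    using area_lower_bound by blast
  ultimately show ?thesis
    using alpha_pos by (intro has_box_dim_if_volume_comparable[OF traj_bounded, of _ c C]) auto
qed

end

section \<open>The phase trajectory of an oscillation near zero\<close>

lemma iterated_deriv_powr:
  fixes a t :: real
  assumes "0 < t"
  shows "(deriv ^^ j) (\<lambda>t. t powr a) t = (\<Prod>i<j. a - real i) * t powr (a - real j)"
  using assms
proof (induction j arbitrary: t)
  case (Suc j)
  have "\<forall>\<^sub>F u in nhds t. 0 < u" using eventually_nhds_in_open[of "{0<..}" t] Suc.prems by simp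
  then have "\<forall>\<^sub>F u in nhds t. (deriv ^^ j) (\<lambda>t. t powr a) u = (\<Prod>i<j. a - real i) * u powr (a - real j)"
    by (rule eventually_mono) (rule Suc.IH)
  then have "(deriv ^^ Suc j) (\<lambda>t. t powr a) t = deriv (\<lambda>u. (\<Prod>i<j. a - real i) * u powr (a - real j)) t"
    by (simp add: deriv_cong_ev)
  also have "\<dots> = (\<Prod>i<j. a - real i) * ((a - real j) * t powr (a - real j - 1))"
    by (intro DERIV_imp_deriv DERIV_cmult has_real_derivative_powr Suc.prems)
  finally show ?case by (simp add: algebra_simps)
qed simp

lemma iterated_deriv_eq:
  fixes f :: "real \<Rightarrow> real"
  assumes S: "open S" and D0: "\<And>t. t \<in> S \<Longrightarrow> D 0 t = f t"
    and D: "\<And>j t. j < k \<Longrightarrow> t \<in> S \<Longrightarrow> (D j has_real_derivative D (Suc j) t) (at t)"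
    and "j \<le> k" "t \<in> S"
  shows "(deriv ^^ j) f t = D j t"
  using assms(4,5)
proof (induction j arbitrary: t)
  case (Suc j)
  have "\<forall>\<^sub>F u in nhds t. u \<in> S" using S Suc.prems(2) by (rule eventually_nhds_in_open)
  then have "\<forall>\<^sub>F u in nhds t. (deriv ^^ j) f u = D j u"
    by (rule eventually_mono) (use Suc in auto)
  then have "(deriv ^^ Suc j) f t = deriv (D j) t" by (simp add: deriv_cong_ev)
  also have "\<dots> = D (Suc j) t" using D Suc.prems by (intro DERIV_imp_deriv) auto
  finally show ?case .
qed (simp add: D0)

text \<open>The substitution \<open>\<tau> = 1/t\<close>. Each derivative of \<open>P(1/t)\<close>
is a combination of derivatives of \<open>P\<close> that all contribute at the same order, and
their coefficients add up to the leading coefficients of the derivatives of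
\<open>t^(-\<alpha>)\<close>. For \<open>\<alpha> = 1\<close> and \<open>\<alpha> =
2\<close> some derivative of \<open>\<tau>^(\<alpha>)\<close> vanishes and the limit \<open>ff
j\<close> is zero; the asymptotic equivalence then says that the derivative of \<open>P\<close>
vanishes near 0, so the limits remain valid.\<close>

lemma damped_oscillation_if_Ck_asymp:
  fixes \<alpha> \<tau>\<^sub>0 :: real
  assumes alpha: "\<alpha> > 0" and \<tau>\<^sub>0: "\<tau>\<^sub>0 > 0"
    and pos: "\<forall>\<tau>\<in>{0<..1/\<tau>\<^sub>0}. P \<tau> > 0"
    and smooth: "Ck_on 3 P {0<..1/\<tau>\<^sub>0}"
    and asymp: "asymp_equiv_Ck 3 P (\<lambda>\<tau>. \<tau> powr \<alpha>) (at_right 0)"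
  shows "\<exists>p p1 p2 p3. damped_oscillation \<alpha> \<tau>\<^sub>0 p p1 p2 p3 \<and> (\<forall>t\<ge>\<tau>\<^sub>0. p t = P (1 / t))"
proof -
  let ?I = "{0<..1/\<tau>\<^sub>0}"
  obtain D where D0: "\<And>t. t \<in> ?I \<Longrightarrow> D 0 t = P t"
    and D: "\<And>j t. j < 3 \<Longrightarrow> t \<in> ?I \<Longrightarrow> (D j has_real_derivative D (Suc j) t) (at t within ?I)"
    using smooth unfolding Ck_on_def by blast
  have inv_I: "1 / t \<in> ?I" if "\<tau>\<^sub>0 \<le> t" for t
    using that \<tau>\<^sub>0 by (auto simp: field_simps)
  \<comment> \<open>\<open>E 0\<close> is the amplitude and \<open>E j\<close> is the
  \<open>j\<close>-th derivative of \<open>P\<close> at \<open>1/t\<close>, not a derivative in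
  \<open>t\<close>.\<close>
  define E where "E j t = D j (1 / t)" for j t
  have E: "(E j has_real_derivative - (E (Suc j) t / t\<^sup>2)) (at t within {\<tau>\<^sub>0..})" if "j < 3" "\<tau>\<^sub>0 \<le> t" for j t
  proof -
    have outer: "(D j has_real_derivative D (Suc j) (1 / t)) (at (1 / t) within (\<lambda>t. 1 / t) ` {\<tau>\<^sub>0..})"
      using D[OF that(1) inv_I[OF that(2)]] by (rule has_field_derivative_subset) (use inv_I in auto)
    have "((\<lambda>t. 1 / t) has_real_derivative - (1 / t\<^sup>2)) (at t within {\<tau>\<^sub>0..})"
      using that \<tau>\<^sub>0 by (auto intro!: derivative_eq_intros simp: power2_eq_square)
    from DERIV_image_chain[OF outer this] show ?thesis by (simp add: E_def[abs_def] o_def)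
  qed
  define ff where "ff j = (\<Prod>i<j. \<alpha> - real i)" for j
  have E_lim: "((\<lambda>t. E j t * t powr (\<alpha> - real j)) \<longlongrightarrow> ff j) at_top" if j: "j \<le> 3" for j
  proof -
    have near: "\<forall>\<^sub>F \<tau> in at_right 0. 0 < \<tau> \<and> \<tau> < 1 / \<tau>\<^sub>0"
      using \<tau>\<^sub>0 by (auto simp: eventually_at_right_field intro!: exI[of _ "1 / \<tau>\<^sub>0"])
    have P_asymp: "(deriv ^^ j) P \<sim>[at_right 0] (deriv ^^ j) (\<lambda>\<tau>. \<tau> powr \<alpha>)"
      using asymp j unfolding asymp_equiv_Ck_def by blast
    have P_eq: "\<forall>\<^sub>F \<tau> in at_right 0. (deriv ^^ j) P \<tau> = D j \<tau>"
      using near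
    proof eventually_elim
      case (elim \<tau>)
      show ?case
      proof (rule iterated_deriv_eq[where S = "{0<..<1/\<tau>\<^sub>0}" and k = 3])
        show "(D i has_real_derivative D (Suc i) u) (at u)" if "i < 3" "u \<in> {0<..<1/\<tau>\<^sub>0}" for i u
          using D[OF that(1), of u] that(2) at_within_interior[of u ?I] by auto
      qed (use elim j D0 in auto)
    qed
    have powr_eq: "\<forall>\<^sub>F \<tau> in at_right 0. (deriv ^^ j) (\<lambda>\<tau>. \<tau> powr \<alpha>) \<tau> = ff j * \<tau> powr (\<alpha> - real j)"
      using near by eventually_elim (simp add: ff_def iterated_deriv_powr)
    have "D j \<sim>[at_right 0] (\<lambda>\<tau>. ff j * \<tau> powr (\<alpha> - real j))"
      by (rule iffD1[OF asymp_equiv_cong[OF P_eq powr_eq] P_asymp])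
    then have quotient: "(\<lambda>\<tau>. D j \<tau> * \<tau> powr (real j - \<alpha>)) \<sim>[at_right 0]
        (\<lambda>\<tau>. ff j * \<tau> powr (\<alpha> - real j) * \<tau> powr (real j - \<alpha>))"
      by (intro asymp_equiv_mult asymp_equiv_refl)
    have "\<forall>\<^sub>F \<tau> in at_right 0. ff j = ff j * \<tau> powr (\<alpha> - real j) * \<tau> powr (real j - \<alpha>)"
      using near by eventually_elim (simp add: mult.assoc flip: powr_add)
    then have "((\<lambda>\<tau>. ff j * \<tau> powr (\<alpha> - real j) * \<tau> powr (real j - \<alpha>)) \<longlongrightarrow> ff j) (at_right 0)"
      by (rule Lim_transform_eventually[OF tendsto_const])
    then have lim: "((\<lambda>\<tau>. D j \<tau> * \<tau> powr (real j - \<alpha>)) \<longlongrightarrow> ff j) (at_right 0)"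
      by (rule iffD2[OF tendsto_asymp_equiv_cong[OF quotient]])
    have "((\<lambda>t. D j (inverse t) * inverse t powr (real j - \<alpha>)) \<longlongrightarrow> ff j) at_top"
      by (rule filterlim_compose[OF lim filterlim_inverse_at_right_top])
    moreover have "\<forall>\<^sub>F t in at_top. D j (inverse t) * inverse t powr (real j - \<alpha>) = E j t * t powr (\<alpha> - real j)"
      using eventually_gt_at_top[of 0]
    proof eventually_elim
      case (elim t)
      have "inverse t powr (real j - \<alpha>) = t powr - (real j - \<alpha>)"
        unfolding powr_minus using elim by (simp add: inverse_powr)
      then show ?case by (simp add: E_def inverse_eq_divide)
    qed
    ultimately show ?thesis by (rule Lim_transform_eventually)
  qed
  have ff: "ff 0 = 1" "ff 1 = \<alpha>" "ff 2 = \<alpha> * (\<alpha> - 1)" "ff 3 = \<alpha> * (\<alpha> - 1) * (\<alpha> - 2)"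
    by (simp_all add: ff_def numeral_2_eq_2 numeral_3_eq_3)
  define E1 E2 E3 where "E1 = E 1" and "E2 = E 2" and "E3 = E 3"
  have lims: "((\<lambda>t. E1 t * t powr (\<alpha> - 1)) \<longlongrightarrow> \<alpha>) at_top"
    "((\<lambda>t. E2 t * t powr (\<alpha> - 2)) \<longlongrightarrow> \<alpha> * (\<alpha> - 1)) at_top"
    "((\<lambda>t. E3 t * t powr (\<alpha> - 3)) \<longlongrightarrow> \<alpha> * (\<alpha> - 1) * (\<alpha> - 2)) at_top"
    using E_lim[of 1] E_lim[of 2] E_lim[of 3] ff by (simp_all add: E1_def E2_def E3_def)
  \<comment> \<open>The first three derivatives of \<open>P(1/t)\<close> by the chain
  rule.\<close>
  define p1 where "p1 t = - (E1 t / t ^ 2)" for t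
  define p2 where "p2 t = E2 t / t ^ 4 + 2 * E1 t / t ^ 3" for t
  define p3 where "p3 t = - (E3 t / t ^ 6) - 6 * E2 t / t ^ 5 - 6 * E1 t / t ^ 4" for t
  have powr_shift: "v / t ^ m * t powr (a + real n) = v * t powr (a + real n - real m)"
    if "0 < t" for t a v :: real and n m
    using that by (simp add: powr_diff powr_realpow)
  have "damped_oscillation \<alpha> \<tau>\<^sub>0 (E 0) p1 p2 p3"
  proof
    show "0 < E 0 t" if "\<tau>\<^sub>0 \<le> t" for t
      using pos inv_I[OF that] D0 by (simp add: E_def)
    fix t assume t: "\<tau>\<^sub>0 \<le> t"
    then have t0: "t \<noteq> 0" using \<tau>\<^sub>0 by auto
    have E': "(E 0 has_real_derivative - (E1 t / t\<^sup>2)) (at t within {\<tau>\<^sub>0..})"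
      "(E1 has_real_derivative - (E2 t / t\<^sup>2)) (at t within {\<tau>\<^sub>0..})"
      "(E2 has_real_derivative - (E3 t / t\<^sup>2)) (at t within {\<tau>\<^sub>0..})"
      using E[of 0 t] E[of 1 t] E[of 2 t] t by (simp_all add: E1_def E2_def E3_def numeral_2_eq_2 numeral_3_eq_3)
    show "(E 0 has_real_derivative p1 t) (at t within {\<tau>\<^sub>0..})"
      unfolding p1_def by (rule E')
    show "(p1 has_real_derivative p2 t) (at t within {\<tau>\<^sub>0..})"
      unfolding p1_def[abs_def] p2_def using t0
      by (auto intro!: derivative_eq_intros E' simp: field_simps eval_nat_numeral)
    show "(p2 has_real_derivative p3 t) (at t within {\<tau>\<^sub>0..})"
      unfolding p2_def[abs_def] p3_def using t0
      by (auto intro!: derivative_eq_intros E' simp: field_simps eval_nat_numeral)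
  next
    show "((\<lambda>t. E 0 t * t powr \<alpha>) \<longlongrightarrow> 1) at_top" using E_lim[of 0] ff by simp
    have ev: "\<forall>\<^sub>F t::real in at_top. 0 < t" by (rule eventually_gt_at_top)
    have "((\<lambda>t. - (E1 t * t powr (\<alpha> - 1))) \<longlongrightarrow> - \<alpha>) at_top"
      by (rule tendsto_minus[OF lims(1)])
    moreover have "\<forall>\<^sub>F t in at_top. - (E1 t * t powr (\<alpha> - 1)) = p1 t * t powr (\<alpha> + 1)"
      using ev
    proof eventually_elim
      case (elim t)
      show ?case using powr_shift[OF elim, of "E1 t" 2 \<alpha> 1] by (simp add: p1_def)
    qed
    ultimately show "((\<lambda>t. p1 t * t powr (\<alpha> + 1)) \<longlongrightarrow> - \<alpha>) at_top"
      by (rule Lim_transform_eventually)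
    have "((\<lambda>t. E2 t * t powr (\<alpha> - 2) + 2 * (E1 t * t powr (\<alpha> - 1))) \<longlongrightarrow> \<alpha> * (\<alpha> - 1) + 2 * \<alpha>) at_top"
      by (intro tendsto_intros lims)
    also have "\<alpha> * (\<alpha> - 1) + 2 * \<alpha> = \<alpha> * (\<alpha> + 1)" by (simp add: algebra_simps)
    finally have "((\<lambda>t. E2 t * t powr (\<alpha> - 2) + 2 * (E1 t * t powr (\<alpha> - 1))) \<longlongrightarrow> \<alpha> * (\<alpha> + 1)) at_top" .
    moreover have "\<forall>\<^sub>F t in at_top. E2 t * t powr (\<alpha> - 2) + 2 * (E1 t * t powr (\<alpha> - 1)) = p2 t * t powr (\<alpha> + 2)"
      using ev
    proof eventually_elim
      case (elim t)
      show ?case using powr_shift[OF elim, of "E2 t" 4 \<alpha> 2] powr_shift[OF elim, of "2 * E1 t" 3 \<alpha> 2]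
        by (simp add: p2_def distrib_right)
    qed
    ultimately show "((\<lambda>t. p2 t * t powr (\<alpha> + 2)) \<longlongrightarrow> \<alpha> * (\<alpha> + 1)) at_top"
      by (rule Lim_transform_eventually)
    have "((\<lambda>t. - (E3 t * t powr (\<alpha> - 3)) - 6 * (E2 t * t powr (\<alpha> - 2)) - 6 * (E1 t * t powr (\<alpha> - 1)))
        \<longlongrightarrow> - (\<alpha> * (\<alpha> - 1) * (\<alpha> - 2)) - 6 * (\<alpha> * (\<alpha> - 1)) - 6 * \<alpha>) at_top"
      by (intro tendsto_intros lims)
    also have "- (\<alpha> * (\<alpha> - 1) * (\<alpha> - 2)) - 6 * (\<alpha> * (\<alpha> - 1)) - 6 * \<alpha> = - (\<alpha> * (\<alpha> + 1) * (\<alpha> + 2))"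
      by (simp add: algebra_simps)
    finally have "((\<lambda>t. - (E3 t * t powr (\<alpha> - 3)) - 6 * (E2 t * t powr (\<alpha> - 2)) - 6 * (E1 t * t powr (\<alpha> - 1)))
        \<longlongrightarrow> - (\<alpha> * (\<alpha> + 1) * (\<alpha> + 2))) at_top" .
    moreover have "\<forall>\<^sub>F t in at_top. - (E3 t * t powr (\<alpha> - 3)) - 6 * (E2 t * t powr (\<alpha> - 2)) - 6 * (E1 t * t powr (\<alpha> - 1))
        = p3 t * t powr (\<alpha> + 3)"
      using ev
    proof eventually_elim
      case (elim t)
      show ?case
        using powr_shift[OF elim, of "E3 t" 6 \<alpha> 3] powr_shift[OF elim, of "6 * E2 t" 5 \<alpha> 3]
          powr_shift[OF elim, of "6 * E1 t" 4 \<alpha> 3]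
        by (simp add: p3_def left_diff_distrib)
    qed
    ultimately show "((\<lambda>t. p3 t * t powr (\<alpha> + 3)) \<longlongrightarrow> - (\<alpha> * (\<alpha> + 1) * (\<alpha> + 2))) at_top"
      by (rule Lim_transform_eventually)
  qed (use alpha \<tau>\<^sub>0 in auto)
  moreover have "E 0 t = P (1 / t)" if "\<tau>\<^sub>0 \<le> t" for t
    using D0[OF inv_I[OF that]] by (simp add: E_def)
  ultimately show ?thesis by blast
qed

theorem theorem4:
  fixes \<alpha> \<tau>\<^sub>0 :: real and P X x :: "real \<Rightarrow> real"
  assumes "\<alpha> > 0" and "\<tau>\<^sub>0 > 0"
    and "\<forall>\<tau>\<in>{0<..1/\<tau>\<^sub>0}. P \<tau> > 0"
    and "Ck_on 3 P {0<..1/\<tau>\<^sub>0}"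
    and "asymp_equiv_Ck 3 P (\<lambda>\<tau>. \<tau> powr \<alpha>) (at_right 0)"
    and "\<forall>\<tau>\<in>{0<..1/\<tau>\<^sub>0}. X \<tau> = P \<tau> * sin (1 / \<tau>)"
    and "\<forall>t\<ge>\<tau>\<^sub>0. x t = X (1 / t)"
  shows "(\<exists>\<phi>. phase_angle \<tau>\<^sub>0 (phase_traj \<tau>\<^sub>0 x) \<phi>) \<and>
    (\<alpha> < 1 \<longrightarrow>
      (\<exists>f \<phi>\<^sub>0. \<phi>\<^sub>0 > 0 \<and>
        wavy_spiral_near_origin (phase_traj \<tau>\<^sub>0 x) \<tau>\<^sub>0 f {..-\<phi>\<^sub>0} \<and>
        (\<forall>\<phi>. phase_angle \<tau>\<^sub>0 (phase_traj \<tau>\<^sub>0 x) \<phi> \<longrightarrow>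
          (\<exists>m::int. \<forall>\<^sub>F t in at_top. \<phi> t + of_int m * pi \<in> {..-\<phi>\<^sub>0} \<and>
            phase_traj \<tau>\<^sub>0 x t = polar_point (f (\<phi> t + of_int m * pi)) (\<phi> t + of_int m * pi))) \<and>
        asymp_comparable f (\<lambda>\<phi>. \<bar>\<phi>\<bar> powr (-\<alpha>)) at_bot) \<and>
      has_box_dim (phase_traj \<tau>\<^sub>0 x ` {\<tau>\<^sub>0..}) (2 / (1 + \<alpha>))) \<and>
    (\<alpha> > 1 \<longrightarrow>
      rectifiable (phase_traj \<tau>\<^sub>0 x) {\<tau>\<^sub>0..} \<and>
      (\<exists>f I. wavy_spiral_near_origin (phase_traj \<tau>\<^sub>0 x) \<tau>\<^sub>0 f I))"
proof -
  obtain p p1 p2 p3 where p: "damped_oscillation \<alpha> \<tau>\<^sub>0 p p1 p2 p3" "\<forall>t\<ge>\<tau>\<^sub>0. p t = P (1 / t)"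
    using damped_oscillation_if_Ck_asymp[OF assms(1-5)] by blast
  interpret D: damped_oscillation \<alpha> \<tau>\<^sub>0 p p1 p2 p3 by (rule p(1))
  let ?c = "phase_traj \<tau>\<^sub>0 x"
  have x_eq: "x t = D.x t" if "\<tau>\<^sub>0 \<le> t" for t
  proof -
    have "1 / t \<in> {0<..1/\<tau>\<^sub>0}" using that assms(2) by (auto simp: field_simps)
    then show ?thesis using assms(6,7) p(2) that by (simp add: D.x_def)
  qed
  have c_eq: "?c t = D.traj t" if t: "\<tau>\<^sub>0 \<le> t" for t
  proof -
    have "(x has_real_derivative D.y t) (at t within {\<tau>\<^sub>0..})"
      using D.x_deriv[OF t] unfolding has_field_derivative_def
      by (rule has_derivative_transform[rotated 2]) (use t x_eq in auto)
    then show ?thesis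
      using t x_eq[OF t] vector_derivative_within_Ici[OF t]
      by (simp add: phase_traj_def D.traj_def)
  qed
  have image: "?c ` {\<tau>\<^sub>0..} = D.traj ` {\<tau>\<^sub>0..}" using c_eq by (intro image_cong) auto
  have angle: "phase_angle \<tau>\<^sub>0 ?c D.angle"
    unfolding phase_angle_def
  proof (intro conjI allI impI)
    show "continuous_on {\<tau>\<^sub>0..} D.angle" by (rule D.continuous_angle)
    fix t assume t: "\<tau>\<^sub>0 \<le> t" "fst (?c t) \<noteq> 0"
    then have "D.x t \<noteq> 0" using c_eq by (simp add: D.traj_def)
    then show "cos (D.angle t) \<noteq> 0" "tan (D.angle t) = snd (?c t) / fst (?c t)"
      using D.x_polar[OF t(1)] D.y_polar[OF t(1)] D.r_pos[OF t(1)] c_eq[OF t(1)]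
      by (auto simp: D.traj_def tan_def)
  qed
  have unique: "\<exists>m::int. \<forall>t\<ge>\<tau>\<^sub>0. D.angle t = \<phi> t + of_int m * pi" if "phase_angle \<tau>\<^sub>0 ?c \<phi>" for \<phi>
    using that c_eq unfolding phase_angle_def
    by (intro D.phase_angle_unique) (auto simp: D.traj_def)
  have spiral: "\<exists>b\<ge>\<tau>\<^sub>0. D.settled b \<and> wavy_spiral_near_origin ?c \<tau>\<^sub>0 (D.radius_at b) {..D.angle b}"
    if neq: "\<alpha> \<noteq> 1"
  proof -
    obtain b where b: "D.settled b" "wavy_spiral (D.radius_at b) {..D.angle b}"
      using D.ex_wavy_start[OF neq] by blast
    have "?c ` {b..} = D.traj ` {b..}"
      using D.b_ge[OF b(1)] c_eq by (intro image_cong) auto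
    then have "?c ` {b..} = polar_graph (D.radius_at b) {..D.angle b}"
      using D.traj_image[OF b(1)] by (simp add: D.traj_def[abs_def])
    then show ?thesis
      using b D.b_ge[OF b(1)] unfolding wavy_spiral_near_origin_def by blast
  qed
  have "\<exists>f \<phi>\<^sub>0. \<phi>\<^sub>0 > 0 \<and> wavy_spiral_near_origin ?c \<tau>\<^sub>0 f {..-\<phi>\<^sub>0} \<and>
      (\<forall>\<phi>. phase_angle \<tau>\<^sub>0 ?c \<phi> \<longrightarrow>
        (\<exists>m::int. \<forall>\<^sub>F t in at_top. \<phi> t + of_int m * pi \<in> {..-\<phi>\<^sub>0} \<and>
          ?c t = polar_point (f (\<phi> t + of_int m * pi)) (\<phi> t + of_int m * pi))) \<and>
      asymp_comparable f (\<lambda>\<phi>. \<bar>\<phi>\<bar> powr (-\<alpha>)) at_bot" if "\<alpha> < 1"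
  proof -
    have "\<alpha> \<noteq> 1" using that by simp
    from spiral[OF this]
    obtain b where b: "\<tau>\<^sub>0 \<le> b" "D.settled b" "wavy_spiral_near_origin ?c \<tau>\<^sub>0 (D.radius_at b) {..D.angle b}"
      by blast
    have "\<exists>m::int. \<forall>\<^sub>F t in at_top. \<phi> t + of_int m * pi \<in> {..D.angle b} \<and>
          ?c t = polar_point (D.radius_at b (\<phi> t + of_int m * pi)) (\<phi> t + of_int m * pi)"
      if \<phi>: "phase_angle \<tau>\<^sub>0 ?c \<phi>" for \<phi>
    proof -
      obtain m :: int where m: "\<And>t. \<tau>\<^sub>0 \<le> t \<Longrightarrow> D.angle t = \<phi> t + of_int m * pi"
        using unique[OF \<phi>] by blast
      have "\<forall>\<^sub>F t in at_top. \<phi> t + of_int m * pi \<in> {..D.angle b} \<and>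
          ?c t = polar_point (D.radius_at b (\<phi> t + of_int m * pi)) (\<phi> t + of_int m * pi)"
        using eventually_ge_at_top[of b]
      proof eventually_elim
        case (elim t)
        then have t: "\<tau>\<^sub>0 \<le> t" using b(1) by simp
        have "D.angle t \<in> {..D.angle b}" using D.angle_image[OF b(2)] elim by blast
        then show ?case
          using D.traj_polar[OF b(2) elim] c_eq[OF t] by (simp add: D.traj_def flip: m[OF t])
      qed
      then show ?thesis by (rule exI[of _ m])
    qed
    then have "\<forall>\<phi>. phase_angle \<tau>\<^sub>0 ?c \<phi> \<longrightarrow>
        (\<exists>m::int. \<forall>\<^sub>F t in at_top. \<phi> t + of_int m * pi \<in> {..- (- D.angle b)} \<and>
          ?c t = polar_point (D.radius_at b (\<phi> t + of_int m * pi)) (\<phi> t + of_int m * pi))"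
      unfolding minus_minus by blast
    moreover have "0 < - D.angle b" using D.angle_b[OF b(2)] by simp
    moreover have "wavy_spiral_near_origin ?c \<tau>\<^sub>0 (D.radius_at b) {..- (- D.angle b)}" using b(3) by simp
    ultimately show ?thesis using D.radius_at_comparable[OF b(2)] by blast
  qed
  moreover have "has_box_dim (?c ` {\<tau>\<^sub>0..}) (2 / (1 + \<alpha>))" if "\<alpha> < 1"
    unfolding image by (rule D.traj_box_dim[OF that])
  moreover have "rectifiable ?c {\<tau>\<^sub>0..} \<and> (\<exists>f I. wavy_spiral_near_origin ?c \<tau>\<^sub>0 f I)" if "1 < \<alpha>"
  proof
    show "rectifiable ?c {\<tau>\<^sub>0..}" by (rule D.traj_rectifiable[OF that c_eq])
    have "\<alpha> \<noteq> 1" using that by simp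
    from spiral[OF this] show "\<exists>f I. wavy_spiral_near_origin ?c \<tau>\<^sub>0 f I" by blast
  qed
  ultimately show ?thesis using angle by blast
qed

end
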